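(* Let $\mu_m$ be a Borel probability measure on $\mathcal{M}$, $\mathcal{Z}_{ad}\subset\mathcal{Z}$ compact, $\mathcal{B}\supset\mathcal{Z}_{ad}$ open in $\mathcal{Z}$, $p\ge2$, and suppose $u:\mathcal{M}\times\mathcal{B}\to\mathcal{U}$ satisfies Assumption A with $(\mu_m,\mathcal{Z}_{ad},\mathcal{B},p)$. Let $\{\phi_i\}_{i=1}^\infty$ and $\{\psi_i\}_{i=1}^\infty$ be orthonormal bases of $\mathcal{U}$ and $\mathcal{M}$, respectively, and let $b_u\in\mathcal{U}$ and $b_m\in\mathcal{M}$ be any two vectors. Then for any $\epsilon>0$ there exist ranks $r_m,r_u\in\mathbb{N}$ and a GELU neural network $g_\theta:\mathbb{R}^{r_m}\times\mathbb{R}^{d_z}\to\mathbb{R}^{r_u}$ such that $$u_\theta(m,z)=\mathbf{\Phi}_{r_u}\,g_\theta(\mathbf{\Psi}_{r_m}^*(m-b_m),z)+b_u$$ satisfies $$\sup_{z\in\mathcal{Z}_{ad}}\ \mathbb{E}_{m\sim\mu_m}\big[\|u(m,z)-u_\theta(m,z)\|_{\mathcal{U}}^p\big]+\mathbb{E}_{m\sim\mu_m}\big[\|D_zu(m,z)-D_zu_\theta(m,z)\|_{\mathrm{HS}(\mathcal{Z},\mathcal{U})}^p\big]\le\epsilon^p ,$$ where the supremum is of the sum of the two expectations.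
   Context: $\mathcal{M}$ and $\mathcal{U}$ are separable real Hilbert spaces and $\mathcal{Z}=\mathbb{R}^{d_z}$. $\mathrm{HS}(X,Y)$ denotes Hilbert–Schmidt operators with the Hilbert–Schmidt norm, $D$ Fréchet derivatives. Assumption A (on a map $u$, with $(\mu_m,\mathcal{Z}_{ad},\mathcal{B},p)$): $\mu_m$ is a Borel probability measure on $\mathcal{M}$ with finite $p$-th moment $\mathbb{E}_{\mu_m}\|m\|_{\mathcal{M}}^p<\infty$, $\mathcal{Z}_{ad}\subset\mathcal{Z}$ is compact, $\mathcal{B}\supset\mathcal{Z}_{ad}$ is open, and: (1) $u:\mathcal{M}\times\mathcal{B}\to\mathcal{U}$ is continuously (Fréchet) differentiable; (2) there are constants $\kappa_u,\kappa_{u_z}>0$ such that for all $z_1,z_2\in\mathcal{B}$, $m_1,m_2\in\mathcal{M}$: $\|u(m_2,z_2)-u(m_1,z_1)\|_{\mathcal{U}}\le\kappa_u(\|m_2-m_1\|_{\mathcal{M}}+\|z_2-z_1\|_{\mathcal{Z}})$ and $\|D_zu(m_2,z_2)-D_zu(m_1,z_1)\|_{\mathrm{HS}(\mathcal{Z},\mathcal{U})}\le\kappa_{u_z}(\|m_2-m_1\|_{\mathcal{M}}+\|z_2-z_1\|_{\mathcal{Z}})$. Encoding/decoding: $\mathbf{\Phi}_{r}c=\sum_{i=1}^{r}c_i\phi_i$ for $c\in\mathbb{R}^{r}$, and $\mathbf{\Psi}_{r}^*m=(\langle m,\psi_i\rangle_{\mathcal{M}})_{i=1}^{r}\in\mathbb{R}^{r}$.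 GELU neural network: $\sigma_{\mathrm{GELU}}(x)=x\,\Phi_{\mathrm{Gauss}}(x)$ with $\Phi_{\mathrm{Gauss}}$ the standard Gaussian CDF, applied componentwise to vectors. A GELU neural network with $d_L$ hidden layers is a map $a_0\mapsto a_{d_L+1}$ with $a_i=\sigma_{\mathrm{GELU}}(W_{i-1}a_{i-1}+b_{i-1})$ for $i=1,\dots,d_L$ and $a_{d_L+1}=W_{d_L}a_{d_L}+b_{d_L}$, for real matrices $W_i$ and vectors $b_i$ of compatible (arbitrary finite) sizes. *)

theory Defs
  imports "HOL-Probability.Probability" "Jordan_Normal_Form.Matrix"
begin

(* Two vector types occur. The fixed space Z is real ^ 'd. Vectors and matrices whose sizes are
   existentially quantified (codes, network layers) are those of Jordan_Normal_Form; the infix $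
   is reserved for them. *)
no_notation vec_nth (infixl "$" 90)

hide_const (open) Finite_Cartesian_Product.vec
hide_type (open) Finite_Cartesian_Product.vec


subsection \<open>Derivatives, Hilbert--Schmidt norm, orthonormal bases\<close>

definition continuously_differentiable_on ::
  "('a::real_normed_vector \<Rightarrow> 'b::real_normed_vector) \<Rightarrow> 'a set \<Rightarrow> bool" where
  "continuously_differentiable_on f S \<longleftrightarrow>
     (\<exists>f' :: 'a \<Rightarrow> 'a \<Rightarrow>\<^sub>L 'b.
        (\<forall>x\<in>S. (f has_derivative blinfun_apply (f' x)) (at x)) \<and> continuous_on S f')"

definition D_z ::
  "('m \<times> 'z \<Rightarrow> 'u) \<Rightarrow> 'm \<Rightarrow> 'z::real_normed_vector \<Rightarrow> 'z \<Rightarrow> 'u::real_normed_vector" where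
  "D_z f m z = frechet_derivative (\<lambda>z'. f (m, z')) (at z)"

(* For a linear map on a finite-dimensional space. *)
definition hs_norm :: "('z::euclidean_space \<Rightarrow> 'u::real_inner) \<Rightarrow> real" where
  "hs_norm A = sqrt (\<Sum>e\<in>Basis. (norm (A e))\<^sup>2)"

definition orthonormal_basis :: "(nat \<Rightarrow> 'a::real_inner) \<Rightarrow> bool" where
  "orthonormal_basis \<phi> \<longleftrightarrow>
     (\<forall>i j. inner (\<phi> i) (\<phi> j) = (if i = j then 1 else 0)) \<and> closure (span (range \<phi>)) = UNIV"


subsection \<open>The assumption on the parameter-to-solution map\<close>

(* u is a total function, but only its values on UNIV \<times> B matter: B is open, so the derivatives
   at points of UNIV \<times> B do not depend on values outside. *)
definition assumption_A ::
  "'m::{real_inner, polish_space} measure \<Rightarrow> (real ^ 'd::finite) set \<Rightarrow> (real ^ 'd) set \<Rightarrow> real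
     \<Rightarrow> ('m \<times> (real ^ 'd) \<Rightarrow> 'u::{real_inner, polish_space}) \<Rightarrow> bool" where
  "assumption_A \<mu> Z_ad B p u \<longleftrightarrow>
     prob_space \<mu> \<and> sets \<mu> = sets borel \<and>
     (\<integral>\<^sup>+ m. ennreal (norm m powr p) \<partial>\<mu>) < \<infinity> \<and>
     compact Z_ad \<and> open B \<and> Z_ad \<subseteq> B \<and>
     continuously_differentiable_on u (UNIV \<times> B) \<and>
     (\<exists>\<kappa>_u > 0. \<exists>\<kappa>_u_z > 0. \<forall>z1\<in>B. \<forall>z2\<in>B. \<forall>m1 m2.
        norm (u (m2, z2) - u (m1, z1)) \<le> \<kappa>_u * (norm (m2 - m1) + norm (z2 - z1)) \<and>
        hs_norm (\<lambda>h. D_z u m2 z2 h - D_z u m1 z1 h)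
          \<le> \<kappa>_u_z * (norm (m2 - m1) + norm (z2 - z1)))"


subsection \<open>GELU neural networks\<close>

definition gelu :: "real \<Rightarrow> real" where
  "gelu x = x * cdf std_normal_distribution x"

primrec gelu_hidden ::
  "(nat \<Rightarrow> real mat) \<Rightarrow> (nat \<Rightarrow> real vec) \<Rightarrow> nat \<Rightarrow> real vec \<Rightarrow> real vec" where
  "gelu_hidden W b 0 x = x"
| "gelu_hidden W b (Suc i) x = map_vec gelu (W i *\<^sub>v gelu_hidden W b i x + b i)"

(* d_L is the number of hidden layers and n i the width of layer i. *)
definition is_gelu_network :: "nat \<Rightarrow> nat \<Rightarrow> (real vec \<Rightarrow> real vec) \<Rightarrow> bool" where
  "is_gelu_network n_in n_out g \<longleftrightarrow>
     (\<exists>d_L n W b. d_L \<ge> 1 \<and> n 0 = n_in \<and> n (d_L + 1) = n_out \<and>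
        (\<forall>i\<le>d_L. W i \<in> carrier_mat (n (i + 1)) (n i) \<and> b i \<in> carrier_vec (n (i + 1))) \<and>
        (\<forall>x\<in>carrier_vec n_in. g x = W d_L *\<^sub>v gelu_hidden W b d_L x + b d_L))"


subsection \<open>Encoding, decoding and the surrogate\<close>

(* Bases are indexed from 0, so the first r elements are \<phi> 0, ..., \<phi> (r - 1). *)
definition decode :: "(nat \<Rightarrow> 'u::real_inner) \<Rightarrow> nat \<Rightarrow> real vec \<Rightarrow> 'u" where
  "decode \<phi> r c = (\<Sum>i<r. (c $ i) *\<^sub>R \<phi> i)"

definition encode :: "(nat \<Rightarrow> 'm::real_inner) \<Rightarrow> nat \<Rightarrow> 'm \<Rightarrow> real vec" where
  "encode \<psi> r m = vec r (\<lambda>i. inner m (\<psi> i))"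

(* from_nat_into UNIV is a bijection from {..<CARD('d)} onto the index type 'd. Which enumeration
   of the coordinates is chosen is immaterial for network inputs, as the columns of the first
   weight matrix can be permuted. *)
definition coords :: "real ^ 'd::finite \<Rightarrow> real vec" where
  "coords z = vec CARD('d) (\<lambda>j. vec_nth z (from_nat_into UNIV j))"

(* The network input (c, z) is the concatenation of c and the coordinates of z. *)
definition surrogate ::
  "(nat \<Rightarrow> 'u::real_inner) \<Rightarrow> nat \<Rightarrow> (nat \<Rightarrow> 'm::real_inner) \<Rightarrow> nat \<Rightarrow> 'u \<Rightarrow> 'm
     \<Rightarrow> (real vec \<Rightarrow> real vec) \<Rightarrow> 'm \<times> (real ^ 'd::finite) \<Rightarrow> 'u" where
  "surrogate \<phi> r_u \<psi> r_m b_u b_m g =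
     (\<lambda>(m, z). decode \<phi> r_u (g (encode \<psi> r_m (m - b_m) @\<^sub>v coords z)) + b_u)"

end

theory Submission
  imports Defs
begin

text \<open>
  Clipping the input first, \<open>c \<mapsto> T c\<close> with \<open>T x = gelu (x + R) - gelu (x - R) - R\<close>, and applying a
  network that is accurate on a bounded set afterwards gives a surrogate that is uniformly close, with its
  \<open>z\<close>-derivative, to a projection of \<open>u (m', z)\<close>, where \<open>m'\<close> is the clipped projection of \<open>m\<close>. As \<open>u\<close>
  and \<open>D_z u\<close> are Lipschitz, the remaining errors are bounded by the norm of \<open>m - m'\<close> and by the tails of
  \<open>u (m, \<zeta>)\<close> and \<open>D_z u (m, \<zeta>)\<close> at finitely many points \<open>\<zeta>\<close> of \<open>Z_ad\<close>; both tend to zero in \<open>L\<^sup>p\<close> by dominated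
  convergence.

  On a bounded set, limits of networks that converge together with their \<open>z\<close>-gradients form an algebra,
  because \<open>gelu (h * x) + gelu (- h * x)\<close>, suitably scaled, tends to \<open>x\<^sup>2\<close>. They contain a \<open>C\<^sup>1\<close> partition of
  unity on a grid, and gluing the first-order Taylor polynomials of \<open>u\<close> with it approximates \<open>u\<close> and \<open>D_z u\<close>.
\<close>

section \<open>The GELU function\<close>

text \<open>The measure may have unbounded support, whereas a network is controlled only on a
  bounded set; without the clip nothing would bound its values and gradients in the tails. Clipping
  touches the coordinates of \<open>m\<close> alone, so it commutes with differentiation in
  \<open>z\<close>, and for a fixed rank its error is dominated by a multiple of
  \<open>1 + norm m\<close>, whose p-th power is integrable. Two more points shape the argument. The
  supremum over \<open>z\<close> stands outside the expectations, so one output rank must make the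
  projection tail small for all \<open>z\<close>. Because the complementary projection is a
  contraction, moving from a net point to any other point costs only Lipschitz terms. Hence the
  output rank can be fixed before the input rank, the clipping radius and the network accuracy, in
  this order. Moreover, the derivative of a partition of unity of mesh h is of size 1/h, so the
  glued local models must have value error o(h), not merely o(1).\<close>

lemma continuous_std_normal_density: "continuous_on S std_normal_density"
  unfolding normal_density_def by (intro continuous_intros) auto

text \<open>Makes the cdf an antiderivative of the density up to a constant, the form in which the
  fundamental theorem of calculus applies.\<close>

lemma cdf_std_normal_diff:
  assumes "a \<le> b"
  shows "cdf std_normal_distribution b - cdf std_normal_distribution a = integral {a..b} std_normal_density"
proof -
  interpret real_distribution std_normal_distribution
    by (rule real_dist_normal_dist)
  let ?N = std_normal_distribution and ?f = std_normal_density
  have "((\<lambda>x. indicator {a..b} x * ?f x) has_integral integral {a..b} ?f) UNIV"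
    using integrable_integral[OF integrable_continuous_real[OF continuous_std_normal_density[of "{a..b}"]]]
    unfolding has_integral_restrict_UNIV[of "{a..b}" ?f, symmetric]
    by (rule has_integral_eq[rotated]) (simp add: indicator_def)
  hence nn: "(\<integral>\<^sup>+x. ennreal (indicator {a..b} x * ?f x) \<partial>lborel) = ennreal (integral {a..b} ?f)"
    by (intro nn_integral_has_integral_lborel) auto
  have "cdf ?N b - cdf ?N a = measure ?N {a<..b}"
    using assms cdf_diff_eq[of a b] by (cases "a = b") auto
  moreover have "emeasure ?N {a<..b} = ennreal (integral {a..b} ?f)"
  proof -
    have "emeasure ?N {a<..b} = (\<integral>\<^sup>+x. ennreal (?f x) * indicator {a<..b} x \<partial>lborel)"
      by (rule emeasure_density) auto
    \<comment> \<open>The two integrands differ only at \<open>a\<close>, a Lebesgue null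
      set.\<close>
    also have "\<dots> = (\<integral>\<^sup>+x. ennreal (indicator {a..b} x * ?f x) \<partial>lborel)"
      by (rule nn_integral_cong_AE, rule AE_mp[OF AE_lborel_singleton[of a]])
        (auto simp: indicator_def simp del: AE_lborel_singleton intro!: AE_I2)
    finally show ?thesis by (simp only: nn)
  qed
  moreover have "integral {a..b} ?f \<ge> 0"
    by (intro integral_nonneg integrable_continuous_real continuous_std_normal_density) auto
  ultimately show ?thesis by (simp add: measure_def)
qed

lemma cdf_std_normal_has_derivative:
  "(cdf std_normal_distribution has_real_derivative std_normal_density x) (at x)"
proof -
  let ?P = "cdf std_normal_distribution"
  have "((\<lambda>y. integral {x-1..y} std_normal_density) has_real_derivative std_normal_density x) (at x within {x-1..x+1})"
    by (rule integral_has_real_derivative[OF continuous_std_normal_density]) auto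
  hence "((\<lambda>y. integral {x-1..y} std_normal_density) has_real_derivative std_normal_density x) (at x)"
    by (simp add: at_within_Icc_at)
  hence "((\<lambda>y. ?P (x-1) + integral {x-1..y} std_normal_density) has_real_derivative std_normal_density x) (at x)"
    by (auto intro!: derivative_eq_intros)
  thus ?thesis
  proof (rule has_field_derivative_transform_within_open[where S = "{x-1<..<x+1}"])
    fix y assume "y \<in> {x-1<..<x+1}"
    thus "?P (x-1) + integral {x-1..y} std_normal_density = ?P y"
      using cdf_std_normal_diff[of "x-1" y] by auto
  qed auto
qed

text \<open>The density is even, so the sum of the cdf at x and at -x has derivative 0; its constant
  value is read off at infinity as 0 + 1.\<close>

lemma cdf_std_normal_minus: "cdf std_normal_distribution (- x) = 1 - cdf std_normal_distribution x"
proof -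
  interpret real_distribution std_normal_distribution
    by (rule real_dist_normal_dist)
  let ?P = "cdf std_normal_distribution"
  have "((\<lambda>x. ?P (-x) + ?P x) has_real_derivative 0) (at y)" for y
  proof -
    have "((\<lambda>x. ?P (-x) + ?P x) has_real_derivative
        std_normal_density (-y) * (-1) + std_normal_density y) (at y)"
      by (intro DERIV_add DERIV_chain2[OF cdf_std_normal_has_derivative] cdf_std_normal_has_derivative)
        (auto intro!: derivative_eq_intros)
    thus ?thesis by (simp add: normal_density_def)
  qed
  hence "?P (-y) + ?P y = ?P (-0) + ?P 0" for y
    by (intro DERIV_isconst_all[where f = "\<lambda>y. ?P (-y) + ?P y"]) auto
  then obtain c where c: "\<And>y. ?P (-y) + ?P y = c" by blast
  have "((\<lambda>y. ?P (-y) + ?P y) \<longlongrightarrow> 0 + 1) at_top"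
    by (intro tendsto_add filterlim_compose[OF cdf_lim_at_bot] filterlim_uminus_at_bot_at_top cdf_lim_at_top_prob)
  hence "c = 1" unfolding c by (simp add: tendsto_const_iff)
  thus ?thesis using c[of x] by simp
qed

lemma cdf_std_normal_bounds: "0 \<le> cdf std_normal_distribution x" "cdf std_normal_distribution x \<le> 1"
proof -
  interpret real_distribution std_normal_distribution
    by (rule real_dist_normal_dist)
  show "0 \<le> cdf std_normal_distribution x" "cdf std_normal_distribution x \<le> 1"
    using cdf_nonneg cdf_bounded_prob by auto
qed

lemma gelu_minus: "gelu x - gelu (- x) = x"
  by (simp add: gelu_def cdf_std_normal_minus algebra_simps)

lemma cdf_std_normal_0: "cdf std_normal_distribution 0 = 1/2"
  using cdf_std_normal_minus[of 0] by simp

definition gelu' :: "real \<Rightarrow> real" where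
  "gelu' x = cdf std_normal_distribution x + x * std_normal_density x"

lemma gelu_has_derivative: "(gelu has_real_derivative gelu' x) (at x)"
  unfolding gelu_def[abs_def] gelu'_def
  by (auto intro!: derivative_eq_intros cdf_std_normal_has_derivative)

lemma continuous_cdf_std_normal: "continuous_on S (cdf std_normal_distribution)"
  by (rule DERIV_continuous_on[OF has_field_derivative_at_within[OF cdf_std_normal_has_derivative]])

lemma continuous_gelu: "continuous_on S gelu"
  by (rule DERIV_continuous_on[OF has_field_derivative_at_within[OF gelu_has_derivative]])

lemma continuous_gelu': "continuous_on S gelu'"
  unfolding gelu'_def by (intro continuous_intros continuous_cdf_std_normal continuous_std_normal_density)

text \<open>Chebyshev's inequality with second moment 1. Quadratic decay leaves a factor 1/|x| in
  the distance from \<open>gelu\<close> to \<open>max 0\<close>.\<close>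

lemma cdf_std_normal_tail: assumes "x \<ge> 0" shows "x\<^sup>2 * cdf std_normal_distribution (- x) \<le> 1"
proof (cases "x = 0")
  case False
  hence x: "x > 0" using assms by simp
  let ?N = std_normal_distribution
  interpret real_distribution std_normal_distribution
    by (rule real_dist_normal_dist)
  have i: "integrable ?N (\<lambda>y. y\<^sup>2)"
    using integrable_std_normal_moment[of 2] by (simp add: integrable_density)
  have e: "expectation (\<lambda>y. y\<^sup>2) = 1"
    using integral_std_normal_moment_even[of 1] by (simp add: integral_density)
  have "cdf ?N (-x) = prob {..-x}" by (simp add: cdf_def2)
  also have "\<dots> \<le> prob {y\<in>space ?N. y\<^sup>2 \<ge> x\<^sup>2}"
  proof (rule finite_measure_mono)
    show "{..-x} \<subseteq> {y\<in>space ?N. y\<^sup>2 \<ge> x\<^sup>2}"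
      using x by (auto simp: abs_le_square_iff[symmetric])
  qed auto
  also have "\<dots> \<le> expectation (\<lambda>y. y\<^sup>2) / x\<^sup>2"
    by (rule integral_Markov_inequality_measure[OF i, of "{}"]) (use x in auto)
  finally show ?thesis using x e by (simp add: field_simps)
qed auto

text \<open>For either sign of x, reflection turns the distance into |x| times the cdf at -|x|; the
  second bound is then the tail estimate. So \<open>gelu\<close> approaches \<open>max 0\<close>
  like 1/|x|.\<close>

lemma gelu_relu_le:
  "\<bar>gelu x - max 0 x\<bar> \<le> \<bar>x\<bar>" "\<bar>x\<bar> * \<bar>gelu x - max 0 x\<bar> \<le> 1"
proof -
  have *: "\<bar>gelu x - max 0 x\<bar> = \<bar>x\<bar> * cdf std_normal_distribution (- \<bar>x\<bar>)"
  proof (cases "x \<ge> 0")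
    case True
    hence "gelu x - max 0 x = - (x * (1 - cdf std_normal_distribution x))"
      by (simp add: gelu_def algebra_simps)
    thus ?thesis using True cdf_std_normal_bounds[of x]
      by (simp add: cdf_std_normal_minus abs_mult)
  next
    case False
    thus ?thesis using cdf_std_normal_bounds[of x] by (simp add: gelu_def abs_mult)
  qed
  show "\<bar>gelu x - max 0 x\<bar> \<le> \<bar>x\<bar>"
    unfolding * using cdf_std_normal_bounds[of "- \<bar>x\<bar>"] by (simp add: mult_left_le)
  show "\<bar>x\<bar> * \<bar>gelu x - max 0 x\<bar> \<le> 1"
    unfolding * using cdf_std_normal_tail[of "\<bar>x\<bar>"] by (simp add: power2_eq_square mult.assoc)
qed

lemma gelu_relu_le_1: "\<bar>gelu x - max 0 x\<bar> \<le> 1"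
proof (cases "\<bar>x\<bar> \<le> 1")
  case True thus ?thesis using gelu_relu_le(1)[of x] by linarith
next
  case False
  hence "1 * \<bar>gelu x - max 0 x\<bar> \<le> \<bar>x\<bar> * \<bar>gelu x - max 0 x\<bar>" by (intro mult_right_mono) auto
  thus ?thesis using gelu_relu_le(2)[of x] by linarith
qed

section \<open>Squares and truncated squares from rescaled GELU functions\<close>

lemma std_normal_density_0: "std_normal_density 0 > 0" by (simp add: normal_density_pos)

lemma std_normal_density_ratio:
  "\<bar>std_normal_density x / std_normal_density 0 - 1\<bar> \<le> x\<^sup>2 / 2"
proof -
  have "std_normal_density x / std_normal_density 0 = exp (- (x\<^sup>2 / 2))"
    by (simp add: std_normal_density_def)
  moreover have "1 + - (x\<^sup>2 / 2) \<le> exp (- (x\<^sup>2 / 2))" by (rule exp_ge_add_one_self)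
  moreover have "exp (- (x\<^sup>2 / 2)) \<le> 1" by simp
  ultimately show ?thesis by linarith
qed

text \<open>Controls the density term of \<open>gelu'\<close> after rescaling. With t = x^2 / 2 the
  product is 2 / sqrt (2 pi) times t exp (-t), and both factors are at most 1.\<close>

lemma square_mult_std_normal_density_le: "x\<^sup>2 * std_normal_density x \<le> 1"
proof -
  define t where "t = x\<^sup>2 / 2"
  have "t \<le> exp t" using exp_ge_add_one_self[of t] by linarith
  hence 1: "t * exp (- t) \<le> 1" by (simp add: exp_minus field_simps)
  have "sqrt (2 * pi) \<ge> 2" using pi_ge_two by (intro real_le_rsqrt) auto
  hence 2: "2 / sqrt (2 * pi) \<le> 1" by simp
  have "x\<^sup>2 * std_normal_density x = (2 / sqrt (2 * pi)) * (t * exp (- t))"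
    by (simp add: std_normal_density_def t_def)
  also have "\<dots> \<le> 1 * 1" by (intro mult_mono 1 2) (auto simp: t_def)
  finally show ?thesis by simp
qed

text \<open>By reflection the sum of the two \<open>gelu\<close> terms is h x times (2 cdf (h x) -
  1), so the scaled sum is x \<kappa>(x) with \<kappa>(0) = 0 and slope close to 1. Its derivative
  is \<kappa>(x) + x \<kappa>'(x), hence one bound on \<kappa>' - 1 yields both estimates.\<close>

lemma gelu_approx_square:
  assumes "\<epsilon> > 0"
  shows "\<exists>h>0. \<forall>x. \<bar>x\<bar> \<le> M \<longrightarrow>
    \<bar>(gelu (h * x) + gelu (- h * x)) / (2 * std_normal_density 0 * h\<^sup>2) - x\<^sup>2\<bar> \<le> \<epsilon> \<and>
    \<bar>(gelu' (h * x) - gelu' (- h * x)) / (2 * std_normal_density 0 * h) - 2 * x\<bar> \<le> \<epsilon>"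
proof -
  let ?\<Phi> = "cdf std_normal_distribution" and ?\<phi> = std_normal_density
  define N where "N = \<bar>M\<bar> + 1"
  have N: "N \<ge> 1" "M \<le> N" by (auto simp: N_def)
  \<comment> \<open>As N is at least 1, the value error h^2 N^4 / 2 and the derivative error h^2 N^3
    are both at most h^2 N^4 = \<epsilon>.\<close>
  define h where "h = sqrt \<epsilon> / N\<^sup>2"
  have h: "h > 0" using assms N by (simp add: h_def)
  have hN: "h\<^sup>2 * N ^ 4 = \<epsilon>" using N assms by (simp add: h_def power_divide flip: power_mult)
  have "h\<^sup>2 * N ^ 3 \<le> h\<^sup>2 * N ^ 4" using N by (intro mult_left_mono power_increasing) auto
  hence hN3: "h\<^sup>2 * N ^ 3 \<le> \<epsilon>" using hN by simp
  define \<kappa> where "\<kappa> x = (2 * ?\<Phi> (h * x) - 1) / (2 * ?\<phi> 0 * h)" for x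
  have d: "(\<kappa> has_real_derivative ?\<phi> (h * x) / ?\<phi> 0) (at x)" for x
    unfolding \<kappa>_def using h std_normal_density_0
    by (auto intro!: derivative_eq_intros DERIV_chain2[OF cdf_std_normal_has_derivative] simp: field_simps)
  have r: "\<bar>?\<phi> (h * x) / ?\<phi> 0 - 1\<bar> \<le> h\<^sup>2 * N\<^sup>2 / 2" if "\<bar>x\<bar> \<le> N" for x
  proof -
    have "x\<^sup>2 \<le> N\<^sup>2" using that N by (metis abs_le_square_iff abs_of_nonneg order_trans zero_le_one)
    hence "h\<^sup>2 * x\<^sup>2 \<le> h\<^sup>2 * N\<^sup>2" by (intro mult_left_mono) auto
    thus ?thesis using std_normal_density_ratio[of "h * x"] by (simp add: power_mult_distrib)
  qed
  have \<kappa>: "\<bar>\<kappa> x - x\<bar> \<le> h\<^sup>2 * N\<^sup>2 / 2 * N" if x: "\<bar>x\<bar> \<le> N" for x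
  proof -
    have "norm ((\<kappa> x - x) - (\<kappa> 0 - 0)) \<le> h\<^sup>2 * N\<^sup>2 / 2 * norm (x - 0)"
    proof (rule field_differentiable_bound[of "{-N..N}"])
      fix y assume "y \<in> {-N..N}"
      thus "norm (?\<phi> (h * y) / ?\<phi> 0 - 1) \<le> h\<^sup>2 * N\<^sup>2 / 2" using r[of y] by auto
      show "((\<lambda>x. \<kappa> x - x) has_real_derivative ?\<phi> (h * y) / ?\<phi> 0 - 1) (at y within {-N..N})"
        by (intro DERIV_diff DERIV_ident has_field_derivative_at_within[OF d])
    qed (use x N in auto)
    moreover have "\<kappa> 0 = 0" by (simp add: \<kappa>_def cdf_std_normal_0)
    moreover have "h\<^sup>2 * N\<^sup>2 / 2 * \<bar>x\<bar> \<le> h\<^sup>2 * N\<^sup>2 / 2 * N" using x by (intro mult_left_mono) auto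
    ultimately show ?thesis by simp
  qed
  show ?thesis
  proof (intro exI[of _ h] conjI allI impI h)
    fix x assume "\<bar>x\<bar> \<le> M"
    hence x: "\<bar>x\<bar> \<le> N" using N by linarith
    have "(gelu (h * x) + gelu (- h * x)) / (2 * ?\<phi> 0 * h\<^sup>2) = x * \<kappa> x"
      using h less_imp_neq[OF std_normal_density_0]
      by (simp add: gelu_def \<kappa>_def cdf_std_normal_minus power2_eq_square divide_simps) (simp add: algebra_simps)
    hence "(gelu (h * x) + gelu (- h * x)) / (2 * ?\<phi> 0 * h\<^sup>2) - x\<^sup>2 = x * (\<kappa> x - x)"
      by (simp add: power2_eq_square algebra_simps)
    also have "\<bar>\<dots>\<bar> \<le> N * (h\<^sup>2 * N\<^sup>2 / 2 * N)" unfolding abs_mult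
      using x \<kappa>[OF x] N by (intro mult_mono) auto
    also have "\<dots> = h\<^sup>2 * N ^ 4 / 2" by (simp add: power2_eq_square power4_eq_xxxx)
    also have "\<dots> \<le> \<epsilon>" using hN assms by simp
    finally show "\<bar>(gelu (h * x) + gelu (- h * x)) / (2 * ?\<phi> 0 * h\<^sup>2) - x\<^sup>2\<bar> \<le> \<epsilon>" .
    have sym: "?\<phi> (- h * x) = ?\<phi> (h * x)" by (simp add: normal_density_def)
    have "(gelu' (h * x) - gelu' (- h * x)) / (2 * ?\<phi> 0 * h) = \<kappa> x + x * (?\<phi> (h * x) / ?\<phi> 0)"
      unfolding gelu'_def sym
      using h std_normal_density_0 by (simp add: \<kappa>_def cdf_std_normal_minus field_simps)
    hence "(gelu' (h * x) - gelu' (- h * x)) / (2 * ?\<phi> 0 * h) - 2 * x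
        = (\<kappa> x - x) + x * (?\<phi> (h * x) / ?\<phi> 0 - 1)"
      by (simp add: algebra_simps)
    also have "\<bar>\<dots>\<bar> \<le> h\<^sup>2 * N\<^sup>2 / 2 * N + N * (h\<^sup>2 * N\<^sup>2 / 2)"
    proof (rule order.trans[OF abs_triangle_ineq add_mono[OF \<kappa>[OF x]]])
      show "\<bar>x * (?\<phi> (h * x) / ?\<phi> 0 - 1)\<bar> \<le> N * (h\<^sup>2 * N\<^sup>2 / 2)"
        unfolding abs_mult using x r[OF x] N by (intro mult_mono) auto
    qed
    also have "\<dots> = h\<^sup>2 * N ^ 3" by (simp add: power2_eq_square power3_eq_cube)
    finally show "\<bar>(gelu' (h * x) - gelu' (- h * x)) / (2 * ?\<phi> 0 * h) - 2 * x\<bar> \<le> \<epsilon>" using hN3 by simp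
  qed
qed

text \<open>The function \<open>gelu (a * x) / a\<close> tends to \<open>max 0 x\<close> uniformly,
  but its derivative stays 1/2 at the kink; the extra factor x removes this obstruction. In y = a x
  the errors are y (gelu y - max 0 y) / a^2 and (2 (gelu y - max 0 y) + y^2 density y) / a, with
  numerators bounded on the whole line by 1 and 3.\<close>

lemma gelu_approx_relu_square:
  assumes "a > 0"
  shows "\<bar>x * (gelu (a * x) / a) - (max 0 x)\<^sup>2\<bar> \<le> 1 / a\<^sup>2"
    and "\<bar>x * gelu' (a * x) + gelu (a * x) / a - 2 * max 0 x\<bar> \<le> 3 / a"
proof -
  define y where "y = a * x"
  have x: "x = y / a" using assms by (simp add: y_def)
  have m: "max 0 x = max 0 y / a" using assms by (simp add: x max_def zero_le_divide_iff divide_le_0_iff)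
  have "x * (gelu (a * x) / a) - (max 0 x)\<^sup>2 = (y * (gelu y - max 0 y)) / a\<^sup>2"
  proof -
    have "(max 0 y)\<^sup>2 = y * max 0 y" by (simp add: max_def power2_eq_square)
    thus ?thesis unfolding m y_def[symmetric] unfolding x
      by (simp add: power_divide diff_divide_distrib right_diff_distrib power2_eq_square)
  qed
  also have "\<bar>\<dots>\<bar> \<le> 1 / a\<^sup>2" using gelu_relu_le(2)[of y] by (auto simp: abs_mult intro!: divide_right_mono)
  finally show "\<bar>x * (gelu (a * x) / a) - (max 0 x)\<^sup>2\<bar> \<le> 1 / a\<^sup>2" .
  have "x * gelu' (a * x) + gelu (a * x) / a - 2 * max 0 x
      = (2 * (gelu y - max 0 y) + y\<^sup>2 * std_normal_density y) / a"
    unfolding m y_def[symmetric] unfolding x gelu'_def gelu_def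
    by (simp add: power2_eq_square add_divide_distrib diff_divide_distrib right_diff_distrib distrib_left)
  also have "\<bar>\<dots>\<bar> \<le> 3 / a"
  proof -
    have *: "\<bar>2 * u + v\<bar> \<le> 3" if "\<bar>u\<bar> \<le> 1" "0 \<le> v" "v \<le> 1" for u v :: real
      using that by linarith
    have "\<bar>2 * (gelu y - max 0 y) + y\<^sup>2 * std_normal_density y\<bar> \<le> 3"
      by (intro * gelu_relu_le_1 square_mult_std_normal_density_le) simp
    thus ?thesis using assms by (simp add: divide_right_mono)
  qed
  finally show "\<bar>x * gelu' (a * x) + gelu (a * x) / a - 2 * max 0 x\<bar> \<le> 3 / a" .
qed

text \<open>The integer translates of \<open>bump\<close> form a partition of unity. The spline is built from squares of
  \<open>max 0\<close> because \<open>x * gelu (a * x) / a\<close> tends to \<open>(max 0 x)\<^sup>2\<close> together with its derivative.\<close>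

definition ramp :: "real \<Rightarrow> real" where
  "ramp x = 2 * ((max 0 x)\<^sup>2 - 2 * (max 0 (x - 1 / 2))\<^sup>2 + (max 0 (x - 1))\<^sup>2)"

text \<open>The slope of \<open>ramp\<close>: a tent on [0, 1] with peak 2 at 1/2.\<close>

definition ramp' :: "real \<Rightarrow> real" where
  "ramp' x = 4 * (max 0 x - 2 * max 0 (x - 1 / 2) + max 0 (x - 1))"

definition bump :: "real \<Rightarrow> real" where "bump x = ramp x - ramp (x - 1)"
definition bump' :: "real \<Rightarrow> real" where "bump' x = ramp' x - ramp' (x - 1)"

lemma ramp_simps: "x \<le> 0 \<Longrightarrow> ramp x = 0" "x \<ge> 1 \<Longrightarrow> ramp x = 1"
  by (auto simp: ramp_def power2_eq_square algebra_simps)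

lemma ramp_bounds: "0 \<le> ramp x" "ramp x \<le> 1"
proof -
  consider "x \<le> 0" | "0 \<le> x" "x \<le> 1/2" | "1/2 \<le> x" "x \<le> 1" | "x \<ge> 1" by linarith
  hence "0 \<le> ramp x \<and> ramp x \<le> 1"
  proof cases
    case 2
    hence "ramp x = 2 * x\<^sup>2" by (simp add: ramp_def max_def)
    moreover have "x\<^sup>2 \<le> (1/2)\<^sup>2" using 2 by (intro power_mono) auto
    ultimately show ?thesis by (simp add: power2_eq_square)
  next
    case 3
    hence "ramp x = 2 * (x\<^sup>2 - 2 * (x - 1 / 2)\<^sup>2)" by (simp add: ramp_def max_def)
    hence "ramp x = 1 - 2 * (1 - x)\<^sup>2" by (simp add: power2_eq_square algebra_simps)
    moreover have "(1 - x)\<^sup>2 \<le> (1/2)\<^sup>2" using 3 by (intro power_mono) auto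
    ultimately show ?thesis by (simp add: power2_eq_square)
  qed (auto simp: ramp_simps)
  thus "0 \<le> ramp x" "ramp x \<le> 1" by auto
qed

lemma ramp'_simps: "x \<le> 0 \<Longrightarrow> ramp' x = 0" "x \<ge> 1 \<Longrightarrow> ramp' x = 0"
  by (auto simp: ramp'_def)

lemma ramp'_bounds: "0 \<le> ramp' x" "ramp' x \<le> 2"
  by (auto simp: ramp'_def max_def)

lemma bump_nonneg: "0 \<le> bump x"
  using ramp_bounds[of x] ramp_bounds[of "x - 1"] ramp_simps[of x] ramp_simps[of "x - 1"]
  by (cases "x \<le> 1") (auto simp: bump_def)

lemma bump_support: "bump x \<noteq> 0 \<Longrightarrow> 0 < x \<and> x < 2"
  using ramp_simps[of x] ramp_simps[of "x - 1"] by (auto simp: bump_def) (smt (verit))+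

lemma bump'_support: "bump' x \<noteq> 0 \<Longrightarrow> 0 < x \<and> x < 2"
  using ramp'_simps[of x] ramp'_simps[of "x - 1"] by (auto simp: bump'_def) (smt (verit))+

text \<open>Telescoping leaves the difference of \<open>ramp\<close> at x and at x - N. The
  hypotheses put these two arguments on the plateaus 1 and 0, where the slopes vanish.\<close>

lemma sum_bump:
  assumes "1 \<le> x" "x \<le> real N"
  shows "(\<Sum>k<N. bump (x - real k)) = 1" "(\<Sum>k<N. bump' (x - real k)) = 0"
proof -
  have "(\<Sum>k<N. bump (x - real k)) = (\<Sum>k<N. ramp (x - real k) - ramp (x - real (Suc k)))"
    by (simp add: bump_def algebra_simps)
  also have "\<dots> = 1" using assms by (subst sum_lessThan_telescope') (simp add: ramp_simps)
  finally show "(\<Sum>k<N. bump (x - real k)) = 1" .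
  have "(\<Sum>k<N. bump' (x - real k)) = (\<Sum>k<N. ramp' (x - real k) - ramp' (x - real (Suc k)))"
    by (simp add: bump'_def algebra_simps)
  also have "\<dots> = 0" using assms by (subst sum_lessThan_telescope') (simp add: ramp'_simps)
  finally show "(\<Sum>k<N. bump' (x - real k)) = 0" .
qed

text \<open>The unit intervals carrying the translated slopes do not overlap, so at most one summand
  is nonzero. The bound is independent of N: enlarging the grid does not accumulate
  gradient.\<close>

lemma sum_ramp'_le: "(\<Sum>k<N. ramp' (x - real k)) \<le> 2"
proof (cases "\<exists>k<N. ramp' (x - real k) \<noteq> 0")
  case True
  then obtain k where k: "k < N" "ramp' (x - real k) \<noteq> 0" by blast
  hence r: "real k < x" "x < real k + 1" using ramp'_simps[of "x - real k"] by force+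
  have "ramp' (x - real j) = 0" if "j \<noteq> k" for j
  proof (cases "j < k")
    case True
    hence "real j + 1 \<le> real k" by linarith
    thus ?thesis using r by (intro ramp'_simps(2)) auto
  next
    case False
    hence "real k + 1 \<le> real j" using that by linarith
    thus ?thesis using r by (intro ramp'_simps(1)) auto
  qed
  hence "(\<Sum>j<N. ramp' (x - real j)) = ramp' (x - real k)"
    using k by (subst sum.remove[of _ k]) auto
  thus ?thesis using ramp'_bounds by simp
next
  case False
  hence "(\<Sum>k<N. ramp' (x - real k)) = 0" by (intro sum.neutral) auto
  thus ?thesis by simp
qed

lemma sum_abs_bump'_le: "(\<Sum>k<N. \<bar>bump' (x - real k)\<bar>) \<le> 4"
proof -
  have "(\<Sum>k<N. \<bar>bump' (x - real k)\<bar>) \<le> (\<Sum>k<N. ramp' (x - real k) + ramp' ((x - 1) - real k))"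
  proof (rule sum_mono)
    fix k
    show "\<bar>bump' (x - real k)\<bar> \<le> ramp' (x - real k) + ramp' ((x - 1) - real k)"
      using ramp'_bounds(1)[of "x - real k"] ramp'_bounds(1)[of "x - 1 - real k"]
      by (simp add: bump'_def algebra_simps)
  qed
  also have "\<dots> \<le> 2 + 2" unfolding sum.distrib by (intro add_mono sum_ramp'_le)
  finally show ?thesis by simp
qed

section \<open>Functions computed by GELU networks\<close>

text \<open>Scalar network expressions that do not record their depth, so that terms of different
  depth can be added freely; \<open>realizable\<close> aligns them later. The constructors are exact
  operations; products are reached only in the limit.\<close>

inductive gelu_fun :: "nat \<Rightarrow> (real vec \<Rightarrow> real) \<Rightarrow> bool" for n where
  const: "gelu_fun n (\<lambda>x. c)"
| coord: "i < n \<Longrightarrow> gelu_fun n (\<lambda>x. x $ i)"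
| add: "gelu_fun n f \<Longrightarrow> gelu_fun n g \<Longrightarrow> gelu_fun n (\<lambda>x. f x + g x)"
| scale: "gelu_fun n f \<Longrightarrow> gelu_fun n (\<lambda>x. c * f x)"
| gelu: "gelu_fun n f \<Longrightarrow> gelu_fun n (\<lambda>x. gelu (f x))"

lemma gelu_fun_compose:
  assumes "gelu_fun k f" "\<And>i. i < k \<Longrightarrow> gelu_fun n (g i)"
  shows "gelu_fun n (\<lambda>x. f (vec k (\<lambda>i. g i x)))"
  using assms by induction (auto intro: gelu_fun.intros)

section \<open>Realising several functions by one network of common depth\<close>

lemma gelu_hidden_cong:
  assumes "\<And>i. i < L \<Longrightarrow> W i = W' i" "\<And>i. i < L \<Longrightarrow> b i = b' i"
  shows "gelu_hidden W b L x = gelu_hidden W' b' L x"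
  using assms by (induction L) auto

text \<open>\<open>W\<close> and \<open>b\<close> are constrained below \<open>L\<close> only, so
  that an update at \<open>L\<close> appends a layer and leaves the earlier ones intact.\<close>

definition layers :: "nat \<Rightarrow> nat \<Rightarrow> (nat \<Rightarrow> nat) \<Rightarrow> (nat \<Rightarrow> real mat) \<Rightarrow> (nat \<Rightarrow> real vec) \<Rightarrow> bool" where
  "layers n L d W b \<longleftrightarrow> d 0 = n \<and>
     (\<forall>i<L. W i \<in> carrier_mat (d (i + 1)) (d i) \<and> b i \<in> carrier_vec (d (i + 1)))"

definition layer_affine ::
  "nat \<Rightarrow> nat \<Rightarrow> (nat \<Rightarrow> nat) \<Rightarrow> (nat \<Rightarrow> real mat) \<Rightarrow> (nat \<Rightarrow> real vec) \<Rightarrow> (real vec \<Rightarrow> real) \<Rightarrow> bool" where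
  "layer_affine n L d W b f \<longleftrightarrow>
     (\<exists>a c. \<forall>x\<in>carrier_vec n. f x = c + (\<Sum>j<d L. a j * gelu_hidden W b L x $ j))"

text \<open>All members of \<open>V\<close> share one stack of hidden layers and differ only in
  their affine read-out. This form survives the appending of layers and finally gives a
  vector-valued network.\<close>

definition realizable :: "nat \<Rightarrow> nat \<Rightarrow> (real vec \<Rightarrow> real) set \<Rightarrow> bool" where
  "realizable n L V \<longleftrightarrow> (\<exists>d W b. layers n L d W b \<and> (\<forall>f\<in>V. layer_affine n L d W b f))"

lemma layer_affineI:
  assumes "\<And>x. x \<in> carrier_vec n \<Longrightarrow> f x = c + (\<Sum>j<d L. a j * gelu_hidden W b L x $ j)"
  shows "layer_affine n L d W b f"
  unfolding layer_affine_def using assms by (intro exI[of _ a] exI[of _ c]) simp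

lemma layer_affineE:
  assumes "layer_affine n L d W b f"
  obtains a c where "\<And>x. x \<in> carrier_vec n \<Longrightarrow> f x = c + (\<Sum>j<d L. a j * gelu_hidden W b L x $ j)"
  using assms unfolding layer_affine_def by blast

lemma gelu_hidden_carrier:
  assumes "layers n L d W b" "x \<in> carrier_vec n"
  shows "gelu_hidden W b L x \<in> carrier_vec (d L)"
proof -
  have "l \<le> L \<Longrightarrow> gelu_hidden W b l x \<in> carrier_vec (d l)" for l
  proof (induction l)
    case 0 thus ?case using assms by (simp add: layers_def)
  next
    case (Suc l)
    hence "W l \<in> carrier_mat (d (l + 1)) (d l)" "b l \<in> carrier_vec (d (l + 1))"
      using assms by (auto simp: layers_def)
    thus ?case using Suc by (auto intro!: map_carrier_vec)
  qed
  thus ?thesis by simp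
qed

lemma realizable_mono: "realizable n L V \<Longrightarrow> V' \<subseteq> V \<Longrightarrow> realizable n L V'"
  unfolding realizable_def by blast

lemma mult_mat_vec_index:
  assumes "v \<in> carrier_vec m" "i < k"
  shows "(mat k m A *\<^sub>v v) $ i = (\<Sum>j<m. A (i, j) * v $ j)"
  using assms by (auto simp: scalar_prod_def lessThan_atLeast0 intro!: sum.cong)

lemma sum_lessThan_delta_mult:
  fixes v :: "nat \<Rightarrow> real"
  assumes "i < m"
  shows "(\<Sum>j<m. (if i = j then k else 0) * v j) = k * v i"
proof -
  have "(\<Sum>j<m. (if i = j then k else 0) * v j) = (\<Sum>j<m. if i = j then k * v j else 0)"
    by (rule sum.cong) auto
  thus ?thesis using assms by simp
qed

lemma sum_lessThan_add:
  fixes f :: "nat \<Rightarrow> 'a::comm_monoid_add"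
  shows "(\<Sum>j<m + k. f j) = (\<Sum>j<m. f j) + (\<Sum>j<k. f (m + j))"
  by (induction k) (auto simp: add.assoc)

text \<open>Since \<open>gelu x - gelu (- x) = x\<close>, a further hidden layer can carry along every affine function of
  the previous one, so that functions needing different depths fit into one network.\<close>

lemma realizable_gelu:
  assumes "realizable n L V" "f \<in> V"
  shows "realizable n (Suc L) (insert (\<lambda>x. gelu (f x)) V)"
proof -
  obtain d W b where lay: "layers n L d W b" and
    V: "\<And>f. f \<in> V \<Longrightarrow> layer_affine n L d W b f"
    using assms(1) unfolding realizable_def by blast
  obtain a c where ac: "\<And>x. x \<in> carrier_vec n \<Longrightarrow> f x = c + (\<Sum>j<d L. a j * gelu_hidden W b L x $ j)"
    using layer_affineE[OF V[OF assms(2)]] by metis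
  define m where "m = d L"
  \<comment> \<open>Rows below \<open>m\<close> copy the previous layer, rows \<open>m\<close> to
    \<open>2 * m - 1\<close> copy its negative, and row \<open>2 * m\<close> holds the linear part
    of \<open>f\<close>; the bias \<open>c\<close> enters in that last row only.\<close>
  define A :: "nat \<times> nat \<Rightarrow> real" where
    "A = (\<lambda>(i, j). if i < m then (if i = j then 1 else 0) else if i < 2 * m then (if i - m = j then - 1 else 0) else a j)"
  define d' where "d' = d(Suc L := 2 * m + 1)"
  define W' where "W' = W(L := mat (2 * m + 1) m A)"
  define b' where "b' = b(L := vec (2 * m + 1) (\<lambda>i. if i < 2 * m then 0 else c))"
  let ?h = "gelu_hidden W b L" and ?h' = "gelu_hidden W' b' (Suc L)"
  have lay': "layers n (Suc L) d' W' b'"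
    using lay by (auto simp: layers_def d'_def W'_def b'_def m_def less_Suc_eq)
  have eq: "gelu_hidden W' b' L x = ?h x" for x
    by (rule gelu_hidden_cong) (auto simp: W'_def b'_def)
  have new_layer: "W' L = mat (2 * m + 1) m A" "b' L = vec (2 * m + 1) (\<lambda>i. if i < 2 * m then 0 else c)"
    by (simp_all add: W'_def b'_def)
  have h': "?h' x $ i = gelu (\<Sum>j<m. A (i, j) * ?h x $ j)" if "i < 2 * m" "x \<in> carrier_vec n" for i x
    using that gelu_hidden_carrier[OF lay that(2)]
    by (simp add: eq new_layer m_def[symmetric] mult_mat_vec_index del: index_mult_mat_vec mult_Suc_right)
  have pos: "?h' x $ i = gelu (?h x $ i)" if "i < m" "x \<in> carrier_vec n" for i x
    using that h'[of i x] by (simp add: A_def sum_lessThan_delta_mult del: gelu_hidden.simps)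
  have neg: "?h' x $ (m + i) = gelu (- (?h x $ i))" if "i < m" "x \<in> carrier_vec n" for i x
    using that h'[of "m + i" x] by (simp add: A_def sum_lessThan_delta_mult del: gelu_hidden.simps)
  have new: "?h' x $ (2 * m) = gelu (f x)" if "x \<in> carrier_vec n" for x
    using that gelu_hidden_carrier[OF lay that] ac[OF that]
    by (simp add: eq new_layer m_def[symmetric] mult_mat_vec_index A_def add.commute del: index_mult_mat_vec)
  have "layer_affine n (Suc L) d' W' b' g" if "g \<in> insert (\<lambda>x. gelu (f x)) V" for g
  proof (cases "g \<in> V")
    case True
    then obtain a1 c1 where g: "\<And>x. x \<in> carrier_vec n \<Longrightarrow> g x = c1 + (\<Sum>j<m. a1 j * ?h x $ j)"
      using layer_affineE[OF V] m_def by metis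
    \<comment> \<open>Opposite weights on the pair \<open>j\<close>, \<open>m + j\<close> recover
      the old read-out; the new neuron \<open>2 * m\<close> gets weight 0.\<close>
    define a' where "a' j = (if j < m then a1 j else if j < 2 * m then - a1 (j - m) else 0)" for j
    have "g x = c1 + (\<Sum>j<d' (Suc L). a' j * ?h' x $ j)" if x: "x \<in> carrier_vec n" for x
    proof -
      have "(\<Sum>j<d' (Suc L). a' j * ?h' x $ j)
          = (\<Sum>j<m. a' j * ?h' x $ j) + (\<Sum>j<m. a' (m + j) * ?h' x $ (m + j))"
        by (simp add: d'_def mult_2 sum_lessThan_add a'_def del: gelu_hidden.simps)
      also have "\<dots> = (\<Sum>j<m. a1 j * gelu (?h x $ j)) + (\<Sum>j<m. - a1 j * gelu (- (?h x $ j)))"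
        by (intro arg_cong2[where f = "(+)"] sum.cong refl)
          (simp_all add: a'_def pos neg x del: gelu_hidden.simps)
      also have "\<dots> = (\<Sum>j<m. a1 j * ?h x $ j)"
        by (subst sum.distrib[symmetric], intro sum.cong refl, subst (3) gelu_minus[symmetric])
          (simp add: algebra_simps)
      finally show ?thesis using g[OF x] by simp
    qed
    thus ?thesis by (rule layer_affineI)
  next
    case False
    hence g: "g = (\<lambda>x. gelu (f x))" using that by auto
    have "g x = 0 + (\<Sum>j<d' (Suc L). (if 2 * m = j then 1 else 0) * ?h' x $ j)" if x: "x \<in> carrier_vec n" for x
      using new[OF x] by (simp add: g d'_def sum_lessThan_delta_mult del: gelu_hidden.simps)
    thus ?thesis by (rule layer_affineI)
  qed
  thus ?thesis unfolding realizable_def using lay' by blast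
qed

text \<open>\<open>V\<close> is generalised in the induction: for a sum, \<open>f\<close> is stored
  in it while the depth grows to realise \<open>g\<close>, after which both are affine in the same
  layer. The coordinates are kept in \<open>V\<close> because deeper layers no longer see the
  input.\<close>

lemma realizable_insert:
  assumes "gelu_fun n f" "realizable n L V" "\<And>i. i < n \<Longrightarrow> (\<lambda>x. x $ i) \<in> V"
  shows "\<exists>L'. realizable n L' (insert f V)"
  using assms
proof (induction arbitrary: L V)
  case (const c)
  obtain d W b where "layers n L d W b" "\<And>f. f \<in> V \<Longrightarrow> layer_affine n L d W b f"
    using const(1) unfolding realizable_def by blast
  moreover have "layer_affine n L d W b (\<lambda>x. c)"
    by (rule layer_affineI[where c = c and a = "\<lambda>_. 0"]) simp
  ultimately have "realizable n L (insert (\<lambda>x. c) V)"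
    unfolding realizable_def by blast
  thus ?case by blast
next
  case (coord i)
  hence "insert (\<lambda>x. x $ i) V = V" by auto
  thus ?case using coord by metis
next
  case (add f g)
  obtain L1 where "realizable n L1 (insert f V)" using add by blast
  then obtain L2 where "realizable n L2 (insert g (insert f V))" using add by blast
  then obtain d W b where lay: "layers n L2 d W b" and
    V: "\<And>h. h \<in> insert g (insert f V) \<Longrightarrow> layer_affine n L2 d W b h"
    unfolding realizable_def by blast
  obtain a1 c1 where 1: "\<And>x. x \<in> carrier_vec n \<Longrightarrow> f x = c1 + (\<Sum>j<d L2. a1 j * gelu_hidden W b L2 x $ j)"
    using layer_affineE[OF V[of f]] by blast
  obtain a2 c2 where 2: "\<And>x. x \<in> carrier_vec n \<Longrightarrow> g x = c2 + (\<Sum>j<d L2. a2 j * gelu_hidden W b L2 x $ j)"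
    using layer_affineE[OF V[of g]] by blast
  have "layer_affine n L2 d W b (\<lambda>x. f x + g x)"
    by (rule layer_affineI[where c = "c1 + c2" and a = "\<lambda>j. a1 j + a2 j"]) (simp add: 1 2 sum.distrib algebra_simps)
  hence "realizable n L2 (insert (\<lambda>x. f x + g x) V)"
    unfolding realizable_def using lay V by blast
  thus ?case by blast
next
  case (scale f k)
  then obtain L2 where "realizable n L2 (insert f V)" by blast
  then obtain d W b where lay: "layers n L2 d W b" and
    V: "\<And>h. h \<in> insert f V \<Longrightarrow> layer_affine n L2 d W b h"
    unfolding realizable_def by blast
  obtain a1 c1 where 1: "\<And>x. x \<in> carrier_vec n \<Longrightarrow> f x = c1 + (\<Sum>j<d L2. a1 j * gelu_hidden W b L2 x $ j)"
    using layer_affineE[OF V[of f]] by blast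
  have "layer_affine n L2 d W b (\<lambda>x. k * f x)"
    by (rule layer_affineI[where c = "k * c1" and a = "\<lambda>j. k * a1 j"]) (simp add: 1 sum_distrib_left algebra_simps)
  hence "realizable n L2 (insert (\<lambda>x. k * f x) V)"
    unfolding realizable_def using lay V by blast
  thus ?case by blast
next
  case (gelu f)
  then obtain L1 where "realizable n L1 (insert f V)" by blast
  hence "realizable n (Suc L1) (insert (\<lambda>x. gelu (f x)) (insert f V))"
    by (rule realizable_gelu) simp
  hence "realizable n (Suc L1) (insert (\<lambda>x. gelu (f x)) V)"
    by (rule realizable_mono) auto
  thus ?case by blast
qed

lemma realizable_finite:
  assumes "finite F" "\<And>f. f \<in> F \<Longrightarrow> gelu_fun n f"
  shows "\<exists>L. realizable n L (F \<union> {\<lambda>x. x $ i | i. i < n})"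
  using assms
proof (induction F)
  case empty
  \<comment> \<open>At depth 0 the hidden layer is the input itself.\<close>
  have "layer_affine n 0 (\<lambda>_. n) W b (\<lambda>x. x $ i)" if "i < n" for i W b
    by (rule layer_affineI[where c = 0 and a = "\<lambda>j. if i = j then 1 else 0"]) (simp add: sum_lessThan_delta_mult that)
  hence "realizable n 0 {\<lambda>x. x $ i | i. i < n}"
    unfolding realizable_def layers_def
    by (intro exI[of _ "\<lambda>_. n"] exI[of _ undefined]) auto
  thus ?case by auto
next
  case (insert f F)
  then obtain L where "realizable n L (F \<union> {\<lambda>x. x $ i | i. i < n})" by blast
  from realizable_insert[OF _ this, of f] insert.prems show ?case by auto
qed

lemma is_gelu_network_gelu_fun:
  assumes "\<And>i. i < k \<Longrightarrow> gelu_fun n (f i)"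
  shows "is_gelu_network n k (\<lambda>x. vec k (\<lambda>i. f i x))"
proof -
  obtain L0 where "realizable n L0 (insert (\<lambda>x. 0) (f ` {..<k}) \<union> {\<lambda>x. x $ i | i. i < n})"
    using realizable_finite[of "insert (\<lambda>x. 0) (f ` {..<k})" n] assms gelu_fun.const by auto
  \<comment> \<open>\<open>is_gelu_network\<close> demands at least one hidden layer, while
    \<open>L0\<close> may be 0; applying \<open>gelu\<close> to the dummy function 0 forces a
    further layer.\<close>
  hence "realizable n (Suc L0) (insert (\<lambda>x. gelu 0) (insert (\<lambda>x. 0) (f ` {..<k}) \<union> {\<lambda>x. x $ i | i. i < n}))"
    using realizable_gelu by fastforce
  hence "realizable n (Suc L0) (f ` {..<k})"
    by (rule realizable_mono) auto
  moreover define L where "L = Suc L0"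
  ultimately obtain d W b where lay: "layers n L d W b" and
    V: "\<And>i. i < k \<Longrightarrow> layer_affine n L d W b (f i)"
    unfolding realizable_def by auto
  have "\<exists>ac. \<forall>x\<in>carrier_vec n. f i x = snd ac + (\<Sum>j<d L. fst ac j * gelu_hidden W b L x $ j)" if "i < k" for i
    using layer_affineE[OF V[OF that]] by (metis fst_conv snd_conv)
  then obtain ac where ac: "\<And>i x. i < k \<Longrightarrow> x \<in> carrier_vec n \<Longrightarrow>
      f i x = snd (ac i) + (\<Sum>j<d L. fst (ac i) j * gelu_hidden W b L x $ j)"
    by metis
  define a where "a i = fst (ac i)" for i
  define c where "c i = snd (ac i)" for i
  note ac = ac[folded a_def c_def]
  define d' where "d' = d(Suc L := k)"
  define W' where "W' = W(L := mat k (d L) (\<lambda>(i, j). a i j))"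
  define b' where "b' = b(L := vec k c)"
  have eq: "gelu_hidden W' b' L x = gelu_hidden W b L x" for x
    by (rule gelu_hidden_cong) (auto simp: W'_def b'_def)
  have last: "W' L = mat k (d L) (\<lambda>(i, j). a i j)" "b' L = vec k c"
    by (simp_all add: W'_def b'_def)
  show ?thesis unfolding is_gelu_network_def
  proof (intro exI conjI ballI)
    show "L \<ge> 1" by (simp add: L_def)
    show "d' 0 = n" "d' (L + 1) = k" using lay by (auto simp: d'_def layers_def)
    show "\<forall>i\<le>L. W' i \<in> carrier_mat (d' (i + 1)) (d' i) \<and> b' i \<in> carrier_vec (d' (i + 1))"
      using lay by (auto simp: d'_def W'_def b'_def layers_def le_less)
    fix x :: "real vec" assume x: "x \<in> carrier_vec n"
    show "vec k (\<lambda>i. f i x) = W' L *\<^sub>v gelu_hidden W' b' L x + b' L"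
      using gelu_hidden_carrier[OF lay x] ac[OF _ x]
      by (intro eq_vecI) (auto simp: eq last mult_mat_vec_index simp del: index_mult_mat_vec)
  qed
qed

section \<open>Approximation together with the gradient\<close>

locale net_approximation =
  fixes n :: nat and \<iota> :: "'x \<times> 'z::euclidean_space \<Rightarrow> real vec" and K :: "('x \<times> 'z) set"
begin

text \<open>The function \<open>F'\<close> plays the role of the gradient of \<open>F\<close> in the second variable, but nothing
  requires \<open>F\<close> to be differentiable: pairs \<open>(F, F')\<close> are calculated with like dual numbers, and only
  the approximating networks are differentiated.\<close>

definition approximable :: "('x \<times> 'z \<Rightarrow> real) \<Rightarrow> ('x \<times> 'z \<Rightarrow> 'z) \<Rightarrow> bool" where
  "approximable F F' \<longleftrightarrow> (\<exists>M. \<forall>y\<in>K. \<bar>F y\<bar> \<le> M \<and> norm (F' y) \<le> M) \<and>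
     (\<forall>\<epsilon>>0. \<exists>G G'. gelu_fun n G \<and> (\<forall>y\<in>K.
        ((\<lambda>z. G (\<iota> (fst y, z))) has_derivative (\<lambda>h. inner (G' y) h)) (at (snd y)) \<and>
        \<bar>G (\<iota> y) - F y\<bar> \<le> \<epsilon> \<and> norm (G' y - F' y) \<le> \<epsilon>))"

lemma approximableI:
  assumes "\<And>y. y \<in> K \<Longrightarrow> \<bar>F y\<bar> \<le> M" "\<And>y. y \<in> K \<Longrightarrow> norm (F' y) \<le> M'"
  assumes "\<And>\<epsilon>. \<epsilon> > 0 \<Longrightarrow> \<exists>G G'. gelu_fun n G \<and> (\<forall>y\<in>K.
        ((\<lambda>z. G (\<iota> (fst y, z))) has_derivative (\<lambda>h. inner (G' y) h)) (at (snd y)) \<and>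
        \<bar>G (\<iota> y) - F y\<bar> \<le> \<epsilon> \<and> norm (G' y - F' y) \<le> \<epsilon>)"
  shows "approximable F F'"
  unfolding approximable_def
  using assms by (intro conjI exI[of _ "max M M'"]) (auto simp: le_max_iff_disj)

lemma approximable_bounded:
  assumes "approximable F F'"
  shows "\<exists>M>0. \<forall>y\<in>K. \<bar>F y\<bar> \<le> M \<and> norm (F' y) \<le> M"
proof -
  obtain M where "\<forall>y\<in>K. \<bar>F y\<bar> \<le> M \<and> norm (F' y) \<le> M"
    using assms unfolding approximable_def by blast
  thus ?thesis by (intro exI[of _ "max 1 M"]) (auto simp: le_max_iff_disj)
qed

lemma approximable_net:
  assumes "approximable F F'" "\<epsilon> > 0"
  obtains G G' where "gelu_fun n G"
    "\<And>y. y \<in> K \<Longrightarrow> ((\<lambda>z. G (\<iota> (fst y, z))) has_derivative (\<lambda>h. inner (G' y) h)) (at (snd y))"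
    "\<And>y. y \<in> K \<Longrightarrow> \<bar>G (\<iota> y) - F y\<bar> \<le> \<epsilon>" "\<And>y. y \<in> K \<Longrightarrow> norm (G' y - F' y) \<le> \<epsilon>"
  using assms unfolding approximable_def by blast

text \<open>Closedness under uniform limits of pairs, splitting the error into two halves;
  boundedness is inherited from one approximant at distance 1.\<close>

lemma approximable_limit:
  assumes "\<And>\<epsilon>. \<epsilon> > 0 \<Longrightarrow> \<exists>H H'. approximable H H' \<and>
      (\<forall>y\<in>K. \<bar>H y - F y\<bar> \<le> \<epsilon> \<and> norm (H' y - F' y) \<le> \<epsilon>)"
  shows "approximable F F'"
proof -
  have ex: thesis if "\<epsilon> > 0"
    "\<And>H H'. approximable H H' \<Longrightarrow> (\<And>y. y \<in> K \<Longrightarrow> \<bar>H y - F y\<bar> \<le> \<epsilon>) \<Longrightarrow>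
      (\<And>y. y \<in> K \<Longrightarrow> norm (H' y - F' y) \<le> \<epsilon>) \<Longrightarrow> thesis" for thesis and \<epsilon> :: real
    using assms[OF that(1)] by (elim exE conjE) (rule that(2), auto)
  have one: "(1 :: real) > 0" by simp
  obtain H H' where H: "approximable H H'"
    "\<And>y. y \<in> K \<Longrightarrow> \<bar>H y - F y\<bar> \<le> 1" "\<And>y. y \<in> K \<Longrightarrow> norm (H' y - F' y) \<le> 1"
    by (rule ex[OF one], rule that, assumption) auto
  obtain M where M: "\<And>y. y \<in> K \<Longrightarrow> \<bar>H y\<bar> \<le> M" "\<And>y. y \<in> K \<Longrightarrow> norm (H' y) \<le> M"
    using approximable_bounded[OF H(1)] by blast
  show ?thesis
  proof (rule approximableI)
    fix y assume y: "y \<in> K"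
    show "\<bar>F y\<bar> \<le> M + 1" using H(2)[OF y] M(1)[OF y] by linarith
    show "norm (F' y) \<le> M + 1" using H(3)[OF y] M(2)[OF y] norm_triangle_sub[of "F' y" "H' y"]
      by (simp add: norm_minus_commute)
  next
    fix \<epsilon> :: real assume "\<epsilon> > 0"
    hence e: "\<epsilon> / 2 > 0" by simp
    obtain H H' where H: "approximable H H'"
      "\<And>y. y \<in> K \<Longrightarrow> \<bar>H y - F y\<bar> \<le> \<epsilon> / 2" "\<And>y. y \<in> K \<Longrightarrow> norm (H' y - F' y) \<le> \<epsilon> / 2"
      by (rule ex[OF e], rule that, assumption) auto
    obtain G G' where G: "gelu_fun n G"
      "\<And>y. y \<in> K \<Longrightarrow> ((\<lambda>z. G (\<iota> (fst y, z))) has_derivative (\<lambda>h. inner (G' y) h)) (at (snd y))"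
      "\<And>y. y \<in> K \<Longrightarrow> \<bar>G (\<iota> y) - H y\<bar> \<le> \<epsilon> / 2" "\<And>y. y \<in> K \<Longrightarrow> norm (G' y - H' y) \<le> \<epsilon> / 2"
      by (rule approximable_net[OF H(1) e], rule that, assumption) auto
    have "\<bar>G (\<iota> y) - F y\<bar> \<le> \<epsilon>" if "y \<in> K" for y
      using G(3)[OF that] H(2)[OF that] by linarith
    moreover have "norm (G' y - F' y) \<le> \<epsilon>" if "y \<in> K" for y
      using norm_triangle_le[of "G' y - H' y" "H' y - F' y" \<epsilon>] G(4)[OF that] H(3)[OF that]
      by simp
    ultimately show "\<exists>G G'. gelu_fun n G \<and> (\<forall>y\<in>K.
        ((\<lambda>z. G (\<iota> (fst y, z))) has_derivative (\<lambda>h. inner (G' y) h)) (at (snd y)) \<and>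
        \<bar>G (\<iota> y) - F y\<bar> \<le> \<epsilon> \<and> norm (G' y - F' y) \<le> \<epsilon>)"
      using G(1,2) by (intro exI[of _ G] exI[of _ G'] conjI ballI) auto
  qed
qed

lemma approximable_cong:
  assumes "approximable F F'" "\<And>y. y \<in> K \<Longrightarrow> F y = H y" "\<And>y. y \<in> K \<Longrightarrow> F' y = H' y"
  shows "approximable H H'"
  by (rule approximable_limit, intro exI[of _ F] exI[of _ F']) (use assms in auto)

lemma approximable_const: "approximable (\<lambda>_. c) (\<lambda>_. 0)"
proof (rule approximableI)
  fix \<epsilon> :: real assume "\<epsilon> > 0"
  moreover have "((\<lambda>z. c) has_derivative (\<lambda>h. inner 0 h)) (at (snd y))" for y :: "'x \<times> 'z"
    by (simp add: inner_zero_left)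
  ultimately show "\<exists>G G'. gelu_fun n G \<and> (\<forall>y\<in>K.
        ((\<lambda>z. G (\<iota> (fst y, z))) has_derivative (\<lambda>h. inner (G' y) h)) (at (snd y)) \<and>
        \<bar>G (\<iota> y) - c\<bar> \<le> \<epsilon> \<and> norm (G' y - 0) \<le> \<epsilon>)"
    by (intro exI[of _ "\<lambda>_. c"] exI[of _ "\<lambda>_. 0"]) (auto intro: gelu_fun.const)
qed auto

text \<open>Here \<open>e\<close> is the constant gradient in \<open>z\<close> of an input that is
  affine in \<open>z\<close>; it will be 0 for the coordinates of the encoded parameter.\<close>

lemma approximable_coord:
  assumes "i < n" "\<And>y. y \<in> K \<Longrightarrow> \<bar>\<iota> y $ i\<bar> \<le> M"
    "\<And>x z. \<iota> (x, z) $ i = a x + inner e z"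
  shows "approximable (\<lambda>y. \<iota> y $ i) (\<lambda>_. e)"
proof (rule approximableI)
  fix \<epsilon> :: real assume "\<epsilon> > 0"
  have "((\<lambda>z. \<iota> (x, z) $ i) has_derivative (\<lambda>h. inner e h)) (at z)" for x z
    unfolding assms(3) by (auto intro!: derivative_eq_intros)
  thus "\<exists>G G'. gelu_fun n G \<and> (\<forall>y\<in>K.
        ((\<lambda>z. G (\<iota> (fst y, z))) has_derivative (\<lambda>h. inner (G' y) h)) (at (snd y)) \<and>
        \<bar>G (\<iota> y) - \<iota> y $ i\<bar> \<le> \<epsilon> \<and> norm (G' y - e) \<le> \<epsilon>)"
    using \<open>\<epsilon> > 0\<close> assms(1)
    by (intro exI[of _ "\<lambda>v. v $ i"] exI[of _ "\<lambda>_. e"]) (auto intro: gelu_fun.coord)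
qed (use assms in auto)

lemma approximable_add:
  assumes "approximable F F'" "approximable H H'"
  shows "approximable (\<lambda>y. F y + H y) (\<lambda>y. F' y + H' y)"
proof -
  obtain M where M: "\<And>y. y \<in> K \<Longrightarrow> \<bar>F y\<bar> \<le> M" "\<And>y. y \<in> K \<Longrightarrow> norm (F' y) \<le> M"
    using approximable_bounded[OF assms(1)] by blast
  obtain N where N: "\<And>y. y \<in> K \<Longrightarrow> \<bar>H y\<bar> \<le> N" "\<And>y. y \<in> K \<Longrightarrow> norm (H' y) \<le> N"
    using approximable_bounded[OF assms(2)] by blast
  show ?thesis
  proof (rule approximableI)
    fix y assume y: "y \<in> K"
    show "\<bar>F y + H y\<bar> \<le> M + N" using M(1)[OF y] N(1)[OF y] by linarith
    show "norm (F' y + H' y) \<le> M + N" using M(2)[OF y] N(2)[OF y] by norm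
  next
    fix \<epsilon> :: real assume "\<epsilon> > 0"
    hence e: "\<epsilon> / 2 > 0" by simp
    obtain A A' where A: "gelu_fun n A"
      "\<And>y. y \<in> K \<Longrightarrow> ((\<lambda>z. A (\<iota> (fst y, z))) has_derivative (\<lambda>h. inner (A' y) h)) (at (snd y))"
      "\<And>y. y \<in> K \<Longrightarrow> \<bar>A (\<iota> y) - F y\<bar> \<le> \<epsilon> / 2" "\<And>y. y \<in> K \<Longrightarrow> norm (A' y - F' y) \<le> \<epsilon> / 2"
      by (rule approximable_net[OF assms(1) e], rule that, assumption) auto
    obtain B B' where B: "gelu_fun n B"
      "\<And>y. y \<in> K \<Longrightarrow> ((\<lambda>z. B (\<iota> (fst y, z))) has_derivative (\<lambda>h. inner (B' y) h)) (at (snd y))"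
      "\<And>y. y \<in> K \<Longrightarrow> \<bar>B (\<iota> y) - H y\<bar> \<le> \<epsilon> / 2" "\<And>y. y \<in> K \<Longrightarrow> norm (B' y - H' y) \<le> \<epsilon> / 2"
      by (rule approximable_net[OF assms(2) e], rule that, assumption) auto
    have "\<bar>A (\<iota> y) + B (\<iota> y) - (F y + H y)\<bar> \<le> \<epsilon>" if y: "y \<in> K" for y
      using A(3)[OF y] B(3)[OF y] by linarith
    moreover have "norm (A' y + B' y - (F' y + H' y)) \<le> \<epsilon>" if y: "y \<in> K" for y
      using A(4)[OF y] B(4)[OF y] by norm
    moreover have "((\<lambda>z. A (\<iota> (fst y, z)) + B (\<iota> (fst y, z))) has_derivative (\<lambda>h. inner (A' y + B' y) h)) (at (snd y))"
      if y: "y \<in> K" for y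
      unfolding inner_add_left by (intro has_derivative_add A B y)
    ultimately show "\<exists>G G'. gelu_fun n G \<and> (\<forall>y\<in>K.
        ((\<lambda>z. G (\<iota> (fst y, z))) has_derivative (\<lambda>h. inner (G' y) h)) (at (snd y)) \<and>
        \<bar>G (\<iota> y) - (F y + H y)\<bar> \<le> \<epsilon> \<and> norm (G' y - (F' y + H' y)) \<le> \<epsilon>)"
      by (intro exI[of _ "\<lambda>v. A v + B v"] exI[of _ "\<lambda>y. A' y + B' y"] conjI gelu_fun.add A(1) B(1)) auto
  qed
qed

text \<open>The network applies \<theta> exactly, so only the inner error has to be propagated, by
  uniform continuity of \<theta> and \<theta>' on a compact interval. The gradient difference is
  split so that each small factor meets a bounded one.\<close>

lemma approximable_chain:
  assumes F: "approximable F F'"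
    and \<theta>: "\<And>G. gelu_fun n G \<Longrightarrow> gelu_fun n (\<lambda>v. \<theta> (G v))"
      "\<And>x. (\<theta> has_real_derivative \<theta>' x) (at x)" "continuous_on UNIV \<theta>'"
  shows "approximable (\<lambda>y. \<theta> (F y)) (\<lambda>y. \<theta>' (F y) *\<^sub>R F' y)"
proof -
  obtain M where M: "M > 0" "\<And>y. y \<in> K \<Longrightarrow> \<bar>F y\<bar> \<le> M" "\<And>y. y \<in> K \<Longrightarrow> norm (F' y) \<le> M"
    using approximable_bounded[OF F] by blast
  \<comment> \<open>The margin 1 leaves room for the values of the network, which stay within
    \<delta> \<le> 1 of \<open>F\<close>.\<close>
  define I where "I = {- (M + 1)..M + 1}"
  have I: "compact I" "I \<noteq> {}" using M(1) by (auto simp: I_def)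
  have c\<theta>: "continuous_on I \<theta>" "continuous_on I \<theta>'"
    using DERIV_continuous_on[OF has_field_derivative_at_within[OF \<theta>(2)]] continuous_on_subset[OF \<theta>(3)] by auto
  obtain B where B: "B > 0" "\<And>x. x \<in> I \<Longrightarrow> \<bar>\<theta> x\<bar> \<le> B"
    using compact_imp_bounded[OF compact_continuous_image[OF c\<theta>(1) I(1)]] by (auto simp: bounded_pos)
  obtain B' where B': "B' > 0" "\<And>x. x \<in> I \<Longrightarrow> \<bar>\<theta>' x\<bar> \<le> B'"
    using compact_imp_bounded[OF compact_continuous_image[OF c\<theta>(2) I(1)]] by (auto simp: bounded_pos)
  have FI: "F y \<in> I" if "y \<in> K" for y using M(2)[OF that] by (auto simp: I_def)
  show ?thesis
  proof (rule approximableI)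
    fix y assume y: "y \<in> K"
    show "\<bar>\<theta> (F y)\<bar> \<le> B" using B FI[OF y] by blast
    show "norm (\<theta>' (F y) *\<^sub>R F' y) \<le> B' * M"
      using B'(2)[OF FI[OF y]] M(3)[OF y] B'(1) by (auto intro!: mult_mono)
  next
    fix \<epsilon> :: real assume e: "\<epsilon> > 0"
    have "uniformly_continuous_on I \<theta>" "uniformly_continuous_on I \<theta>'"
      using c\<theta> I by (auto intro: compact_uniformly_continuous)
    moreover have "\<epsilon> / (2 * M) > 0" using e M by simp
    ultimately obtain d1 d2 where d: "d1 > 0" "d2 > 0"
      "\<And>x x'. x \<in> I \<Longrightarrow> x' \<in> I \<Longrightarrow> \<bar>x' - x\<bar> < d1 \<Longrightarrow> \<bar>\<theta> x' - \<theta> x\<bar> < \<epsilon>"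
      "\<And>x x'. x \<in> I \<Longrightarrow> x' \<in> I \<Longrightarrow> \<bar>x' - x\<bar> < d2 \<Longrightarrow> \<bar>\<theta>' x' - \<theta>' x\<bar> < \<epsilon> / (2 * M)"
      using e unfolding uniformly_continuous_on_def dist_real_def by metis
    define \<delta> where "\<delta> = min 1 (min (d1 / 2) (min (d2 / 2) (\<epsilon> / (2 * B'))))"
    have \<delta>: "\<delta> > 0" "\<delta> \<le> 1" "\<delta> < d1" "\<delta> < d2" "\<delta> \<le> \<epsilon> / (2 * B')" using d e B' by (auto simp: \<delta>_def)
    obtain A A' where A: "gelu_fun n A"
      "\<And>y. y \<in> K \<Longrightarrow> ((\<lambda>z. A (\<iota> (fst y, z))) has_derivative (\<lambda>h. inner (A' y) h)) (at (snd y))"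
      "\<And>y. y \<in> K \<Longrightarrow> \<bar>A (\<iota> y) - F y\<bar> \<le> \<delta>" "\<And>y. y \<in> K \<Longrightarrow> norm (A' y - F' y) \<le> \<delta>"
      by (rule approximable_net[OF F \<delta>(1)], rule that, assumption) auto
    have AI: "A (\<iota> y) \<in> I" if "y \<in> K" for y using A(3)[OF that] M(2)[OF that] \<delta> by (auto simp: I_def)
    have "\<bar>\<theta> (A (\<iota> y)) - \<theta> (F y)\<bar> \<le> \<epsilon>" if y: "y \<in> K" for y
      using d(3)[OF FI[OF y] AI[OF y]] A(3)[OF y] \<delta> by linarith
    moreover have "norm (\<theta>' (A (\<iota> y)) *\<^sub>R A' y - \<theta>' (F y) *\<^sub>R F' y) \<le> \<epsilon>" if y: "y \<in> K" for y
    proof -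
      have "\<theta>' (A (\<iota> y)) *\<^sub>R A' y - \<theta>' (F y) *\<^sub>R F' y
          = \<theta>' (A (\<iota> y)) *\<^sub>R (A' y - F' y) + (\<theta>' (A (\<iota> y)) - \<theta>' (F y)) *\<^sub>R F' y"
        by (simp add: algebra_simps)
      also have "norm \<dots> \<le> \<bar>\<theta>' (A (\<iota> y))\<bar> * norm (A' y - F' y) + \<bar>\<theta>' (A (\<iota> y)) - \<theta>' (F y)\<bar> * norm (F' y)"
        by (rule order.trans[OF norm_triangle_ineq]) simp
      also have "\<dots> \<le> B' * (\<epsilon> / (2 * B')) + (\<epsilon> / (2 * M)) * M"
      proof (intro add_mono mult_mono)
        show "\<bar>\<theta>' (A (\<iota> y)) - \<theta>' (F y)\<bar> \<le> \<epsilon> / (2 * M)"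
          using d(4)[OF FI[OF y] AI[OF y]] A(3)[OF y] \<delta> by linarith
        show "norm (A' y - F' y) \<le> \<epsilon> / (2 * B')" using A(4)[OF y] \<delta> by linarith
      qed (use B' AI[OF y] M(1) M(3)[OF y] e in auto)
      also have "\<dots> = \<epsilon>" using B' M(1) by simp
      finally show ?thesis .
    qed
    moreover have "((\<lambda>z. \<theta> (A (\<iota> (fst y, z)))) has_derivative (\<lambda>h. inner (\<theta>' (A (\<iota> y)) *\<^sub>R A' y) h)) (at (snd y))"
      if y: "y \<in> K" for y
      using DERIV_compose_FDERIV[OF \<theta>(2) A(2)[OF y]] by (simp add: mult.commute)
    ultimately show "\<exists>G G'. gelu_fun n G \<and> (\<forall>y\<in>K.
        ((\<lambda>z. G (\<iota> (fst y, z))) has_derivative (\<lambda>h. inner (G' y) h)) (at (snd y)) \<and>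
        \<bar>G (\<iota> y) - \<theta> (F y)\<bar> \<le> \<epsilon> \<and> norm (G' y - \<theta>' (F y) *\<^sub>R F' y) \<le> \<epsilon>)"
      by (intro exI[of _ "\<lambda>v. \<theta> (A v)"] exI[of _ "\<lambda>y. \<theta>' (A (\<iota> y)) *\<^sub>R A' y"] conjI \<theta>(1) A(1)) auto
  qed
qed

lemma approximable_gelu:
  "approximable F F' \<Longrightarrow> approximable (\<lambda>y. gelu (F y)) (\<lambda>y. gelu' (F y) *\<^sub>R F' y)"
  by (rule approximable_chain) (auto intro: gelu_fun.gelu gelu_has_derivative continuous_gelu')

lemma approximable_scale:
  "approximable F F' \<Longrightarrow> approximable (\<lambda>y. c * F y) (\<lambda>y. c *\<^sub>R F' y)"
  by (rule approximable_chain[where \<theta> = "\<lambda>x. c * x" and \<theta>' = "\<lambda>_. c"])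
    (auto intro!: gelu_fun.scale derivative_eq_intros)

lemma approximable_diff:
  "approximable F F' \<Longrightarrow> approximable H H' \<Longrightarrow> approximable (\<lambda>y. F y - H y) (\<lambda>y. F' y - H' y)"
  using approximable_add[OF _ approximable_scale[of H H' "-1"], of F F'] by simp

lemma approximable_sum:
  assumes "\<And>i. i \<in> S \<Longrightarrow> approximable (F i) (F' i)"
  shows "approximable (\<lambda>y. \<Sum>i\<in>S. F i y) (\<lambda>y. \<Sum>i\<in>S. F' i y)"
proof (cases "finite S")
  case True
  thus ?thesis using assms
    by induction (auto intro: approximable_add approximable_const)
qed (auto intro: approximable_const)

text \<open>For \<theta> that is reached only as a limit. The error of \<open>t\<close> matters just
  on the range of \<open>F\<close>, and that of \<open>t'\<close> is multiplied by the norm of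
  \<open>F'\<close>, whence the two terms in \<delta>.\<close>

lemma approximable_outer:
  assumes F: "approximable F F'"
    and "\<And>M \<epsilon>. \<epsilon> > 0 \<Longrightarrow> \<exists>t t'. approximable (\<lambda>y. t (F y)) (\<lambda>y. t' (F y) *\<^sub>R F' y) \<and>
        (\<forall>x. \<bar>x\<bar> \<le> M \<longrightarrow> \<bar>t x - \<theta> x\<bar> \<le> \<epsilon> \<and> \<bar>t' x - \<theta>' x\<bar> \<le> \<epsilon>)"
  shows "approximable (\<lambda>y. \<theta> (F y)) (\<lambda>y. \<theta>' (F y) *\<^sub>R F' y)"
proof (rule approximable_limit)
  fix \<epsilon> :: real assume e: "\<epsilon> > 0"
  obtain M where M: "M > 0" "\<And>y. y \<in> K \<Longrightarrow> \<bar>F y\<bar> \<le> M" "\<And>y. y \<in> K \<Longrightarrow> norm (F' y) \<le> M"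
    using approximable_bounded[OF F] by blast
  define \<delta> where "\<delta> = min \<epsilon> (\<epsilon> / M)"
  have \<delta>: "\<delta> > 0" "\<delta> \<le> \<epsilon>" "\<delta> * M \<le> \<epsilon>" using e M by (auto simp: \<delta>_def min_def field_simps)
  obtain t t' where t: "approximable (\<lambda>y. t (F y)) (\<lambda>y. t' (F y) *\<^sub>R F' y)"
    "\<And>x. \<bar>x\<bar> \<le> M \<Longrightarrow> \<bar>t x - \<theta> x\<bar> \<le> \<delta>" "\<And>x. \<bar>x\<bar> \<le> M \<Longrightarrow> \<bar>t' x - \<theta>' x\<bar> \<le> \<delta>"
    using assms(2)[OF \<delta>(1), of M] by (elim exE conjE) (rule that, assumption, auto)
  have "norm (t' (F y) *\<^sub>R F' y - \<theta>' (F y) *\<^sub>R F' y) \<le> \<epsilon>" if y: "y \<in> K" for y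
  proof -
    have "norm (t' (F y) *\<^sub>R F' y - \<theta>' (F y) *\<^sub>R F' y) = \<bar>t' (F y) - \<theta>' (F y)\<bar> * norm (F' y)"
      by (simp add: scaleR_diff_left[symmetric])
    also have "\<dots> \<le> \<delta> * M" using t(3)[OF M(2)[OF y]] M(3)[OF y] \<delta> by (intro mult_mono) auto
    finally show ?thesis using \<delta> by linarith
  qed
  moreover have "\<bar>t (F y) - \<theta> (F y)\<bar> \<le> \<epsilon>" if y: "y \<in> K" for y
    using t(2)[OF M(2)[OF y]] \<delta> by linarith
  ultimately show "\<exists>H H'. approximable H H' \<and>
      (\<forall>y\<in>K. \<bar>H y - \<theta> (F y)\<bar> \<le> \<epsilon> \<and> norm (H' y - \<theta>' (F y) *\<^sub>R F' y) \<le> \<epsilon>)"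
    using t(1) by (intro exI[of _ "\<lambda>y. t (F y)"] exI[of _ "\<lambda>y. t' (F y) *\<^sub>R F' y"] conjI ballI) auto
qed

lemma approximable_square:
  assumes F: "approximable F F'"
  shows "approximable (\<lambda>y. (F y)\<^sup>2) (\<lambda>y. (2 * F y) *\<^sub>R F' y)"
proof (rule approximable_outer[OF F, where \<theta> = "\<lambda>x. x\<^sup>2" and \<theta>' = "\<lambda>x. 2 * x"])
  fix M \<epsilon> :: real assume "\<epsilon> > 0"
  let ?c = "std_normal_density 0"
  obtain h where h: "h > 0" "\<And>x. \<bar>x\<bar> \<le> M \<Longrightarrow>
      \<bar>(gelu (h * x) + gelu (- h * x)) / (2 * ?c * h\<^sup>2) - x\<^sup>2\<bar> \<le> \<epsilon> \<and>
      \<bar>(gelu' (h * x) - gelu' (- h * x)) / (2 * ?c * h) - 2 * x\<bar> \<le> \<epsilon>"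
    using gelu_approx_square[OF \<open>\<epsilon> > 0\<close>] by blast
  define t where "t x = (gelu (h * x) + gelu (- h * x)) / (2 * ?c * h\<^sup>2)" for x
  define t' where "t' x = (gelu' (h * x) - gelu' (- h * x)) / (2 * ?c * h)" for x
  have "approximable (\<lambda>y. 1 / (2 * ?c * h\<^sup>2) * (gelu (h * F y) + gelu (- h * F y)))
      (\<lambda>y. (1 / (2 * ?c * h\<^sup>2)) *\<^sub>R (gelu' (h * F y) *\<^sub>R (h *\<^sub>R F' y) + gelu' (- h * F y) *\<^sub>R ((- h) *\<^sub>R F' y)))"
    by (intro approximable_scale approximable_add approximable_gelu F)
  hence "approximable (\<lambda>y. t (F y)) (\<lambda>y. t' (F y) *\<^sub>R F' y)"
  proof (rule approximable_cong)
    fix y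
    have "(1 / (2 * ?c * h\<^sup>2)) *\<^sub>R (gelu' (h * F y) *\<^sub>R (h *\<^sub>R F' y) + gelu' (- h * F y) *\<^sub>R ((- h) *\<^sub>R F' y))
        = ((1 / (2 * ?c * h\<^sup>2)) * (gelu' (h * F y) * h + gelu' (- h * F y) * (- h))) *\<^sub>R F' y"
      by (simp only: scaleR_scaleR flip: scaleR_add_left)
    also have "(1 / (2 * ?c * h\<^sup>2)) * (gelu' (h * F y) * h + gelu' (- h * F y) * (- h)) = t' (F y)"
      using h(1) less_imp_neq[OF std_normal_density_0]
      by (simp add: t'_def power2_eq_square divide_simps) (simp add: algebra_simps)
    finally show "(1 / (2 * ?c * h\<^sup>2)) *\<^sub>R (gelu' (h * F y) *\<^sub>R (h *\<^sub>R F' y) + gelu' (- h * F y) *\<^sub>R ((- h) *\<^sub>R F' y))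
        = t' (F y) *\<^sub>R F' y" .
  qed (simp add: t_def)
  thus "\<exists>t t'. approximable (\<lambda>y. t (F y)) (\<lambda>y. t' (F y) *\<^sub>R F' y) \<and>
        (\<forall>x. \<bar>x\<bar> \<le> M \<longrightarrow> \<bar>t x - x\<^sup>2\<bar> \<le> \<epsilon> \<and> \<bar>t' x - 2 * x\<bar> \<le> \<epsilon>)"
    using h(2)[folded t_def t'_def] by (intro exI[of _ t] exI[of _ t']) simp
qed

text \<open>Polarisation: 4 F H = (F + H)^2 - (F - H)^2, and the formal gradients satisfy the
  matching identity.\<close>

lemma approximable_mult:
  assumes "approximable F F'" "approximable H H'"
  shows "approximable (\<lambda>y. F y * H y) (\<lambda>y. F y *\<^sub>R H' y + H y *\<^sub>R F' y)"
proof -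
  have "approximable (\<lambda>y. (1 / 4) * ((F y + H y)\<^sup>2 - (F y - H y)\<^sup>2))
      (\<lambda>y. (1 / 4) *\<^sub>R ((2 * (F y + H y)) *\<^sub>R (F' y + H' y) - (2 * (F y - H y)) *\<^sub>R (F' y - H' y)))"
    by (intro approximable_scale approximable_square approximable_add approximable_diff assms)
  thus ?thesis
  proof (rule approximable_cong)
    fix y
    have "(2 * (F y + H y)) *\<^sub>R (F' y + H' y) - (2 * (F y - H y)) *\<^sub>R (F' y - H' y)
        = (4 * F y) *\<^sub>R H' y + (4 * H y) *\<^sub>R F' y"
      by (subst vector_eq_rdot[symmetric]) (simp add: inner_simps algebra_simps)
    thus "(1 / 4) *\<^sub>R ((2 * (F y + H y)) *\<^sub>R (F' y + H' y) - (2 * (F y - H y)) *\<^sub>R (F' y - H' y))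
        = F y *\<^sub>R H' y + H y *\<^sub>R F' y"
      by (simp add: scaleR_add_right)
  qed (simp add: power2_eq_square algebra_simps)
qed

lemma approximable_prod:
  assumes "finite I" "\<And>i. i \<in> I \<Longrightarrow> approximable (F i) (F' i)"
  shows "approximable (\<lambda>y. \<Prod>i\<in>I. F i y) (\<lambda>y. \<Sum>i\<in>I. (\<Prod>j\<in>I - {i}. F j y) *\<^sub>R F' i y)"
  using assms
proof (induction I)
  case empty
  show ?case using approximable_const[of 1] by simp
next
  case (insert i I)
  have "approximable (\<lambda>y. F i y * (\<Prod>i\<in>I. F i y))
      (\<lambda>y. F i y *\<^sub>R (\<Sum>i\<in>I. (\<Prod>j\<in>I - {i}. F j y) *\<^sub>R F' i y) + (\<Prod>i\<in>I. F i y) *\<^sub>R F' i y)"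
    using insert by (intro approximable_mult) auto
  thus ?case
  proof (rule approximable_cong)
    fix y
    have "(\<Prod>j\<in>insert i I - {k}. F j y) = F i y * (\<Prod>j\<in>I - {k}. F j y)" if "k \<in> I" for k
    proof -
      have "insert i I - {k} = insert i (I - {k})" using that insert by auto
      thus ?thesis using insert by simp
    qed
    moreover have "insert i I - {i} = I" using insert by auto
    ultimately show "F i y *\<^sub>R (\<Sum>i\<in>I. (\<Prod>j\<in>I - {i}. F j y) *\<^sub>R F' i y) + (\<Prod>i\<in>I. F i y) *\<^sub>R F' i y
        = (\<Sum>k\<in>insert i I. (\<Prod>j\<in>insert i I - {k}. F j y) *\<^sub>R F' k y)"
      using insert by (simp add: scaleR_sum_right add.commute)
  qed (use insert in simp)
qed

lemma approximable_relu_square: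
  assumes F: "approximable F F'"
  shows "approximable (\<lambda>y. (max 0 (F y))\<^sup>2) (\<lambda>y. (2 * max 0 (F y)) *\<^sub>R F' y)"
proof (rule approximable_outer[OF F, where \<theta> = "\<lambda>x. (max 0 x)\<^sup>2" and \<theta>' = "\<lambda>x. 2 * max 0 x"])
  fix M \<epsilon> :: real assume e: "\<epsilon> > 0"
  \<comment> \<open>Gives 3 / a \<le> \<epsilon>, and a \<ge> 1 keeps the value error 1 / a^2 below
    that.\<close>
  define a where "a = 1 + 3 / \<epsilon>"
  have a: "a \<ge> 1" "3 / a \<le> \<epsilon>" using e by (auto simp: a_def field_simps)
  have "1 / a\<^sup>2 \<le> 1 / a" using a by (simp add: power2_eq_square field_simps)
  also have "\<dots> \<le> 3 / a" using a by (simp add: field_simps)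
  finally have a2: "1 / a\<^sup>2 \<le> \<epsilon>" using a by linarith
  define t where "t x = x * (gelu (a * x) / a)" for x
  define t' where "t' x = x * gelu' (a * x) + gelu (a * x) / a" for x
  have "approximable (\<lambda>y. F y * (1 / a * gelu (a * F y)))
      (\<lambda>y. F y *\<^sub>R ((1 / a) *\<^sub>R (gelu' (a * F y) *\<^sub>R (a *\<^sub>R F' y))) + (1 / a * gelu (a * F y)) *\<^sub>R F' y)"
    by (intro approximable_mult approximable_scale approximable_gelu F)
  hence "approximable (\<lambda>y. t (F y)) (\<lambda>y. t' (F y) *\<^sub>R F' y)"
    by (rule approximable_cong) (use a in \<open>auto simp: t_def t'_def scaleR_add_left\<close>)
  moreover have "\<bar>t x - (max 0 x)\<^sup>2\<bar> \<le> \<epsilon> \<and> \<bar>t' x - 2 * max 0 x\<bar> \<le> \<epsilon>" for x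
    using gelu_approx_relu_square[of a x] a a2 unfolding t_def t'_def by linarith
  ultimately show "\<exists>t t'. approximable (\<lambda>y. t (F y)) (\<lambda>y. t' (F y) *\<^sub>R F' y) \<and>
        (\<forall>x. \<bar>x\<bar> \<le> M \<longrightarrow> \<bar>t x - (max 0 x)\<^sup>2\<bar> \<le> \<epsilon> \<and> \<bar>t' x - 2 * max 0 x\<bar> \<le> \<epsilon>)"
    by (intro exI[of _ t] exI[of _ t']) simp
qed

lemma approximable_shift:
  assumes "approximable F F'"
  shows "approximable (\<lambda>y. F y - c) F'"
  using approximable_diff[OF assms approximable_const[of c]] by simp

lemma approximable_ramp:
  assumes F: "approximable F F'"
  shows "approximable (\<lambda>y. ramp (F y)) (\<lambda>y. ramp' (F y) *\<^sub>R F' y)"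
proof -
  have q: "approximable (\<lambda>y. (max 0 (F y - c))\<^sup>2) (\<lambda>y. (2 * max 0 (F y - c)) *\<^sub>R F' y)" for c
    by (rule approximable_relu_square[OF approximable_shift[OF F]])
  show ?thesis
    by (rule approximable_cong[OF approximable_scale[OF
            approximable_add[OF approximable_diff[OF q[of 0] approximable_scale[OF q[of "1 / 2"], of 2]] q[of 1]], of 2]])
      (simp_all add: ramp_def ramp'_def scaleR_add_left scaleR_diff_left scaleR_add_right scaleR_diff_right)
qed

lemma approximable_bump:
  assumes F: "approximable F F'"
  shows "approximable (\<lambda>y. bump (F y)) (\<lambda>y. bump' (F y) *\<^sub>R F' y)"
  using approximable_diff[OF approximable_ramp[OF F] approximable_ramp[OF approximable_shift[OF F, of 1]]]
  by (simp add: bump_def bump'_def scaleR_diff_left)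

end

section \<open>Gluing affine functions on a grid\<close>

context net_approximation
begin

text \<open>\<open>A k\<close> and \<open>V k\<close> give an affine model of \<open>f\<close>
  attached to the grid node \<open>k\<close>. The weights sum to 1 and their gradients to 0, so the
  gradient error consists of the weighted errors of \<open>V k\<close> and of the weight gradients
  multiplied by model minus \<open>f\<close>: the large gradients meet the small error \<rho>. A
  coordinate with \<open>e i = 0\<close> adds nothing to this second part, so its mesh may be as
  fine as desired.\<close>

lemma grid_approximable:
  fixes e :: "nat \<Rightarrow> 'z" and h :: "nat \<Rightarrow> real" and A :: "(nat \<Rightarrow> nat) \<Rightarrow> real" and V :: "(nat \<Rightarrow> nat) \<Rightarrow> 'z"
  assumes coord: "\<And>i. i < n \<Longrightarrow> approximable (\<lambda>y. \<iota> y $ i) (\<lambda>_. e i)"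
    and lin: "\<And>v. approximable (\<lambda>y. inner v (snd y)) (\<lambda>_. v)"
    and h: "\<And>i. i < n \<Longrightarrow> h i > 0"
    and range: "\<And>i y. i < n \<Longrightarrow> y \<in> K \<Longrightarrow> \<bar>\<iota> y $ i\<bar> \<le> (real N - 1) * h i"
    and near: "\<And>y k. y \<in> K \<Longrightarrow> (\<And>i. i < n \<Longrightarrow> \<bar>\<iota> y $ i - (real (k i) - real N) * h i\<bar> \<le> 2 * h i) \<Longrightarrow>
        \<bar>A k + inner (V k) (snd y) - f y\<bar> \<le> \<rho> \<and> norm (V k - f' y) \<le> \<sigma>"
  shows "\<exists>F F'. approximable F F' \<and> (\<forall>y\<in>K. \<bar>F y - f y\<bar> \<le> \<rho> \<and>
        norm (F' y - f' y) \<le> \<sigma> + (\<Sum>i<n. 4 / h i * norm (e i)) * \<rho>)"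
proof -
  define P where "P = PiE {..<n} (\<lambda>_. {..<2 * N})"
  have P: "finite P" unfolding P_def by (rule finite_PiE) auto
  \<comment> \<open>The shift by \<open>N\<close> moves the scaled inputs, of modulus at most N - 1,
    into [1, 2 N - 1], where the \<open>2 * N\<close> translates of \<open>bump\<close> sum to
    1.\<close>
  define x where "x i y = 1 / h i * \<iota> y $ i + real N" for i y
  define B where "B i k y = bump (x i y - real k)" for i k y
  define B' where "B' i k y = bump' (x i y - real k) / h i" for i k y
  define wt where "wt k y = (\<Prod>i<n. B i (k i) y)" for k y
  \<comment> \<open>The i-th term of the product rule, written as a product over all axes so that
    its sums over the grid factor axis by axis.\<close>
  define w where "w i k y = (\<Prod>j<n. if j = i then B' i (k i) y else B j (k j) y)" for i k y
  define Q where "Q k y = A k + inner (V k) (snd y)" for k and y :: "'x \<times> 'z"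
  define wt' where "wt' k y = (\<Sum>i<n. w i k y *\<^sub>R e i)" for k y
  have B_approx: "approximable (\<lambda>y. B i k y) (\<lambda>y. B' i k y *\<^sub>R e i)" if "i < n" for i k
  proof -
    have "approximable (\<lambda>y. bump (1 / h i * \<iota> y $ i - (real k - real N)))
        (\<lambda>y. bump' (1 / h i * \<iota> y $ i - (real k - real N)) *\<^sub>R ((1 / h i) *\<^sub>R e i))"
      by (intro approximable_bump approximable_shift approximable_scale coord that)
    thus ?thesis by (rule approximable_cong) (simp_all add: B_def B'_def x_def algebra_simps)
  qed
  have wt_approx: "approximable (wt k) (wt' k)" for k
  proof -
    have "approximable (\<lambda>y. \<Prod>i<n. B i (k i) y) (\<lambda>y. \<Sum>i<n. (\<Prod>j\<in>{..<n} - {i}. B j (k j) y) *\<^sub>R (B' i (k i) y *\<^sub>R e i))"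
      by (intro approximable_prod B_approx) auto
    thus ?thesis
    proof (rule approximable_cong)
      fix y
      have "(\<Prod>j\<in>{..<n} - {i}. B j (k j) y) * B' i (k i) y = w i k y" if "i < n" for i
      proof -
        have "w i k y = B' i (k i) y * (\<Prod>j\<in>{..<n} - {i}. if j = i then B' i (k i) y else B j (k j) y)"
          unfolding w_def using that by (subst prod.remove[of _ i]) auto
        also have "(\<Prod>j\<in>{..<n} - {i}. if j = i then B' i (k i) y else B j (k j) y) = (\<Prod>j\<in>{..<n} - {i}. B j (k j) y)"
          by (intro prod.cong) auto
        finally show ?thesis by simp
      qed
      thus "(\<Sum>i<n. (\<Prod>j\<in>{..<n} - {i}. B j (k j) y) *\<^sub>R (B' i (k i) y *\<^sub>R e i)) = wt' k y"
        by (simp add: wt'_def)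
    qed (simp add: wt_def)
  qed
  define F where "F y = (\<Sum>k\<in>P. wt k y * Q k y)" for y
  define F' where "F' y = (\<Sum>k\<in>P. wt k y *\<^sub>R V k + Q k y *\<^sub>R wt' k y)" for y
  have Q_approx: "approximable (Q k) (\<lambda>_. V k)" for k
    using approximable_add[OF approximable_const[of "A k"] lin[of "V k"]] by (simp add: Q_def[abs_def])
  have F_approx: "approximable F F'"
    unfolding F_def[abs_def] F'_def[abs_def] by (intro approximable_sum approximable_mult wt_approx Q_approx)
  have x_range: "1 \<le> x i y \<and> x i y \<le> real (2 * N)" if "i < n" "y \<in> K" for i y
  proof -
    have "\<bar>1 / h i * \<iota> y $ i\<bar> \<le> real N - 1"
      using range[OF that] h[OF that(1)] by (simp add: abs_mult field_simps)
    thus ?thesis unfolding x_def by (simp only: abs_le_iff of_nat_mult of_nat_numeral) linarith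
  qed
  have sum_B: "(\<Sum>k<2 * N. B i k y) = 1" "(\<Sum>k<2 * N. B' i k y) = 0" if "i < n" "y \<in> K" for i y
    using sum_bump[of "x i y" "2 * N"] x_range[OF that]
    by (auto simp: B_def B'_def sum_divide_distrib[symmetric])
  have sum_abs_B': "(\<Sum>k<2 * N. \<bar>B' i k y\<bar>) \<le> 4 / h i" if "i < n" for i y
    using sum_abs_bump'_le[of "x i y" "2 * N"] h[OF that]
    by (simp add: B'_def abs_divide sum_divide_distrib[symmetric] divide_right_mono)
  have B_nonneg: "B i k y \<ge> 0" for i k y by (simp add: B_def bump_nonneg)
  have sum_wt: "(\<Sum>k\<in>P. wt k y) = 1" if "y \<in> K" for y
    unfolding wt_def P_def using that
    by (subst prod_sum_PiE[symmetric]) (auto simp: sum_B)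
  have sum_w: "(\<Sum>k\<in>P. w i k y) = 0" if "i < n" "y \<in> K" for i y
  proof -
    have "(\<Sum>k\<in>P. w i k y) = (\<Sum>k\<in>P. \<Prod>j<n. if j = i then B' i (k j) y else B j (k j) y)"
      unfolding w_def by (intro sum.cong prod.cong refl) simp
    also have "\<dots> = (\<Prod>j<n. \<Sum>k<2*N. if j = i then B' i k y else B j k y)"
      unfolding P_def by (rule prod_sum_PiE[symmetric]) auto
    also have "\<dots> = 0" using that sum_B(2)[OF that] by (intro prod_zero) (auto intro!: bexI[of _ i])
    finally show ?thesis .
  qed
  have sum_abs_w: "(\<Sum>k\<in>P. \<bar>w i k y\<bar>) \<le> 4 / h i" if i: "i < n" and y: "y \<in> K" for i y
  proof -
    have "(\<Sum>k\<in>P. \<bar>w i k y\<bar>) = (\<Sum>k\<in>P. \<Prod>j<n. \<bar>if j = i then B' i (k j) y else B j (k j) y\<bar>)"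
      unfolding w_def abs_prod by (intro sum.cong prod.cong refl) simp
    also have "\<dots> = (\<Prod>j<n. \<Sum>k<2*N. \<bar>if j = i then B' i k y else B j k y\<bar>)"
      unfolding P_def by (rule prod_sum_PiE[symmetric]) auto
    also have "\<dots> = (\<Sum>k<2*N. \<bar>B' i k y\<bar>) * (\<Prod>j\<in>{..<n} - {i}. \<Sum>k<2*N. \<bar>if j = i then B' i k y else B j k y\<bar>)"
      using i by (subst prod.remove[of _ i]) auto
    also have "(\<Prod>j\<in>{..<n} - {i}. \<Sum>k<2*N. \<bar>if j = i then B' i k y else B j k y\<bar>) = 1"
      using y by (intro prod.neutral ballI) (auto simp: B_nonneg sum_B)
    finally show ?thesis using sum_abs_B'[OF i] by simp
  qed
  have wt_nonneg: "wt k y \<ge> 0" for k y unfolding wt_def by (intro prod_nonneg) (simp add: B_nonneg)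
  have supp: "\<bar>\<iota> y $ i - (real k - real N) * h i\<bar> \<le> 2 * h i" if "B i k y \<noteq> 0 \<or> B' i k y \<noteq> 0" "i < n" for i k y
  proof -
    have "0 < x i y - real k \<and> x i y - real k < 2"
      using that bump_support[of "x i y - real k"] bump'_support[of "x i y - real k"] by (auto simp: B_def B'_def)
    moreover have "\<iota> y $ i - (real k - real N) * h i = (x i y - real k) * h i"
      using h[OF that(2)] by (simp add: x_def field_simps)
    ultimately show ?thesis using h[OF that(2)] by (simp add: abs_mult)
  qed
  \<comment> \<open>If a weight or a term of its gradient is nonzero, then along every axis the
    factor is nonzero in value or in slope, which puts y in the cell of k where \<open>near\<close>
    applies.\<close>
  have nonzero_near: "\<bar>Q k y - f y\<bar> \<le> \<rho> \<and> norm (V k - f' y) \<le> \<sigma>"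
    if "y \<in> K" "wt k y \<noteq> 0 \<or> (\<exists>i<n. w i k y \<noteq> 0)" for k y
  proof -
    have "B i (k i) y \<noteq> 0 \<or> B' i (k i) y \<noteq> 0" if i: "i < n" for i
    proof (cases "wt k y = 0")
      case False
      thus ?thesis using i by (auto simp: wt_def)
    next
      case True
      then obtain j where "j < n" "w j k y \<noteq> 0" using \<open>wt k y \<noteq> 0 \<or> _\<close> by blast
      hence "\<forall>i<n. (if i = j then B' j (k j) y else B i (k i) y) \<noteq> 0" by (auto simp: w_def)
      thus ?thesis using i by (metis (full_types))
    qed
    hence "\<bar>\<iota> y $ i - (real (k i) - real N) * h i\<bar> \<le> 2 * h i" if "i < n" for i
      using supp that by blast
    thus ?thesis using near[OF that(1), of k] by (simp add: Q_def)
  qed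
  have "\<bar>F y - f y\<bar> \<le> \<rho>" if y: "y \<in> K" for y
  proof -
    have "F y - f y = (\<Sum>k\<in>P. wt k y * (Q k y - f y))"
      using sum_wt[OF y] by (simp add: F_def right_diff_distrib sum_subtractf flip: sum_distrib_right)
    also have "\<bar>\<dots>\<bar> \<le> (\<Sum>k\<in>P. wt k y * \<rho>)"
    proof (rule order.trans[OF sum_abs sum_mono])
      fix k show "\<bar>wt k y * (Q k y - f y)\<bar> \<le> wt k y * \<rho>"
        using nonzero_near[OF y, of k] wt_nonneg[of k y]
        by (cases "wt k y = 0") (auto simp: abs_mult intro!: mult_left_mono)
    qed
    also have "\<dots> = \<rho>" using sum_wt[OF y] by (simp flip: sum_distrib_right)
    finally show ?thesis .
  qed
  moreover have "norm (F' y - f' y) \<le> \<sigma> + (\<Sum>i<n. 4 / h i * norm (e i)) * \<rho>" if y: "y \<in> K" for y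
  proof -
    have "(\<Sum>k\<in>P. wt' k y) = (\<Sum>i<n. (\<Sum>k\<in>P. w i k y) *\<^sub>R e i)"
      unfolding wt'_def by (subst sum.swap) (simp add: scaleR_left.sum)
    also have "\<dots> = 0" using sum_w[OF _ y] by simp
    finally have sum_wt': "(\<Sum>k\<in>P. wt' k y) = 0" .
    have "(\<Sum>k\<in>P. wt k y *\<^sub>R (V k - f' y) + (Q k y - f y) *\<^sub>R wt' k y)
        = F' y - (\<Sum>k\<in>P. wt k y) *\<^sub>R f' y - f y *\<^sub>R (\<Sum>k\<in>P. wt' k y)"
      by (simp add: F'_def scaleR_diff_right scaleR_diff_left sum.distrib sum_subtractf scaleR_left.sum scaleR_sum_right)
    hence "F' y - f' y = (\<Sum>k\<in>P. wt k y *\<^sub>R (V k - f' y) + (Q k y - f y) *\<^sub>R wt' k y)"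
      using sum_wt[OF y] sum_wt' by simp
    also have "norm \<dots> \<le> (\<Sum>k\<in>P. wt k y * \<sigma> + (\<Sum>i<n. \<bar>w i k y\<bar> * norm (e i)) * \<rho>)"
    proof (rule order.trans[OF norm_sum sum_mono], rule order.trans[OF norm_triangle_ineq add_mono])
      fix k
      show "norm (wt k y *\<^sub>R (V k - f' y)) \<le> wt k y * \<sigma>"
        using nonzero_near[OF y, of k] wt_nonneg[of k y]
        by (cases "wt k y = 0") (auto intro!: mult_left_mono)
      show "norm ((Q k y - f y) *\<^sub>R wt' k y) \<le> (\<Sum>i<n. \<bar>w i k y\<bar> * norm (e i)) * \<rho>"
      proof (cases "\<exists>i<n. w i k y \<noteq> 0")
        case True
        have "norm (wt' k y) \<le> (\<Sum>i<n. \<bar>w i k y\<bar> * norm (e i))"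
          unfolding wt'_def by (rule order.trans[OF norm_sum]) simp
        moreover have "\<bar>Q k y - f y\<bar> \<le> \<rho>" using nonzero_near[OF y, of k] True by blast
        ultimately have "\<bar>Q k y - f y\<bar> * norm (wt' k y) \<le> \<rho> * (\<Sum>i<n. \<bar>w i k y\<bar> * norm (e i))"
          by (intro mult_mono) auto
        thus ?thesis by (simp add: mult.commute)
      next
        case False
        thus ?thesis by (simp add: wt'_def)
      qed
    qed
    also have "\<dots> = \<sigma> + (\<Sum>i<n. (\<Sum>k\<in>P. \<bar>w i k y\<bar>) * norm (e i)) * \<rho>"
    proof -
      have "(\<Sum>k\<in>P. \<Sum>i<n. \<bar>w i k y\<bar> * norm (e i)) = (\<Sum>i<n. (\<Sum>k\<in>P. \<bar>w i k y\<bar>) * norm (e i))"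
        by (subst sum.swap) (simp add: sum_distrib_right)
      thus ?thesis using sum_wt[OF y] by (simp add: sum.distrib flip: sum_distrib_right)
    qed
    also have "\<dots> \<le> \<sigma> + (\<Sum>i<n. 4 / h i * norm (e i)) * \<rho>"
    proof -
      \<comment> \<open>Nonnegativity of \<rho> comes from \<open>near\<close> at a node of nonzero
        weight, which exists because the weights sum to 1.\<close>
      have "(\<Sum>k\<in>P. wt k y) \<noteq> 0" using sum_wt[OF y] by simp
      then obtain k where "wt k y \<noteq> 0" by (meson sum.neutral)
      hence "\<rho> \<ge> 0" using nonzero_near[OF y, of k] by (meson abs_ge_zero order_trans)
      thus ?thesis by (intro add_left_mono mult_right_mono sum_mono sum_abs_w y) auto
    qed
    finally show ?thesis .
  qed
  ultimately show ?thesis using F_approx by blast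
qed

end

definition coord_axis :: "nat \<Rightarrow> real ^ 'd::finite" where
  "coord_axis j = axis (from_nat_into UNIV j) 1"

lemma norm_coord_axis: "norm (coord_axis j) = 1"
  by (simp add: coord_axis_def)

text \<open>\<open>coord_axis\<close> follows the enumeration used in \<open>coords\<close>, so
  every \<open>z\<close>-input of the network is an inner product with a unit vector.\<close>

lemma coords_index: "j < CARD('d) \<Longrightarrow> coords (z :: real ^ 'd::finite) $ j = inner (coord_axis j) z"
  by (simp add: coords_def coord_axis_def inner_axis' )

lemma sum_coord_axis:
  fixes z :: "real ^ 'd::finite"
  shows "(\<Sum>j<CARD('d). inner (coord_axis j) z *\<^sub>R coord_axis j) = z"
proof -
  have "(\<Sum>j<CARD('d). vec_nth z (from_nat_into UNIV j) *\<^sub>R axis (from_nat_into UNIV j :: 'd) (1 :: real))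
      = (\<Sum>i\<in>UNIV. vec_nth z i *\<^sub>R axis i 1)"
    by (rule sum.reindex_bij_betw[OF bij_betw_from_nat_into_finite]) simp
  also have "\<dots> = z" using basis_expansion[of z] by (simp add: scalar_mult_eq_scaleR)
  finally show ?thesis by (simp add: coord_axis_def inner_axis')
qed

lemma orthonormal_coeff:
  fixes \<psi> :: "nat \<Rightarrow> 'm::real_inner"
  assumes "\<And>i j. inner (\<psi> i) (\<psi> j) = (if i = j then 1 else 0)" "i < r"
  shows "inner (\<Sum>j<r. c j *\<^sub>R \<psi> j) (\<psi> i) = c i"
  using assms(2) by (simp add: inner_sum_left assms(1) if_distrib cong: if_cong)

lemma norm_sum_scaleR_le:
  assumes "\<And>i. i \<in> I \<Longrightarrow> norm (v i) = 1" "\<And>i. i \<in> I \<Longrightarrow> \<bar>a i\<bar> \<le> C"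
  shows "norm (\<Sum>i\<in>I. a i *\<^sub>R v i) \<le> real (card I) * C"
proof -
  have "norm (\<Sum>i\<in>I. a i *\<^sub>R v i) \<le> (\<Sum>i\<in>I. C)"
    by (rule order.trans[OF norm_sum sum_mono]) (use assms in simp)
  thus ?thesis by simp
qed

definition net_input :: "(nat \<Rightarrow> 'm::real_inner) \<Rightarrow> nat \<Rightarrow> 'm \<Rightarrow> 'm \<times> (real ^ 'd::finite) \<Rightarrow> real vec" where
  "net_input \<psi> r b = (\<lambda>(m, z). encode \<psi> r (m - b) @\<^sub>v coords z)"

lemma net_input_index:
  "i < r \<Longrightarrow> net_input \<psi> r b (m, z :: real ^ 'd::finite) $ i = inner (m - b) (\<psi> i)"
  "r \<le> i \<Longrightarrow> i < r + CARD('d) \<Longrightarrow> net_input \<psi> r b (m, z) $ i = inner (coord_axis (i - r)) z"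
proof -
  have d: "dim_vec (encode \<psi> r (m - b)) = r" "dim_vec (coords z) = CARD('d)"
    by (simp_all add: encode_def coords_def)
  show "i < r \<Longrightarrow> net_input \<psi> r b (m, z) $ i = inner (m - b) (\<psi> i)"
    by (simp add: net_input_def d) (simp add: encode_def)
  show "r \<le> i \<Longrightarrow> i < r + CARD('d) \<Longrightarrow> net_input \<psi> r b (m, z) $ i = inner (coord_axis (i - r)) z"
    by (simp add: net_input_def d coords_index)
qed

text \<open>Mean value inequality for \<open>f\<close> minus its linearisation. The hypotheses are
  confined to the segment because the open set of the application need not be convex.\<close>

lemma taylor_bound:
  fixes f :: "'z::euclidean_space \<Rightarrow> real"
  assumes "\<And>x. x \<in> closed_segment z0 z \<Longrightarrow> (f has_derivative (\<lambda>h. inner (f' x) h)) (at x)"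
    and "\<And>x. x \<in> closed_segment z0 z \<Longrightarrow> norm (f' x - f' z0) \<le> C * norm (x - z0)" "C \<ge> 0"
  shows "\<bar>f z - f z0 - inner (f' z0) (z - z0)\<bar> \<le> C * (norm (z - z0))\<^sup>2"
proof -
  have "norm (f z - f z0 - inner (f' z0) (z - z0)) \<le> norm (z - z0) * (C * norm (z - z0))"
  proof (rule differentiable_bound_linearization[where S = "closed_segment z0 z" and f' = "\<lambda>x h. inner (f' x) h"])
    fix t :: real assume "t \<in> {0..1}"
    thus "z0 + t *\<^sub>R (z - z0) \<in> closed_segment z0 z"
      by (auto simp: in_segment algebra_simps intro!: exI[of _ t])
  next
    fix x assume x: "x \<in> closed_segment z0 z"
    show "(f has_derivative (\<lambda>h. inner (f' x) h)) (at x within closed_segment z0 z)"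
      using assms(1)[OF x] by (rule has_derivative_at_withinI)
    have "norm (f' x - f' z0) \<le> C * norm (z - z0)"
      using assms(2)[OF x] segment_bound1[OF x] assms(3) by (meson mult_left_mono order_trans)
    thus "onorm ((\<lambda>h. inner (f' x) h) - (\<lambda>h. inner (f' z0) h)) \<le> C * norm (z - z0)"
      by (intro onorm_le) (auto simp: fun_diff_def inner_diff_left[symmetric] 
        intro!: order.trans[OF Cauchy_Schwarz_ineq2] mult_right_mono)
  qed auto
  thus ?thesis by (simp add: power2_eq_square algebra_simps)
qed

text \<open>The local models are Taylor polynomials in \<open>z\<close> at a grid node, constant in
  \<open>m\<close>. Their value error is a multiple of the distance in \<open>m\<close> plus the
  squared distance in \<open>z\<close>; both must be of order h^2 for the glued gradient error to be
  of order h.\<close>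

lemma gelu_fun_C1_approximation:
  fixes f :: "'m::real_inner \<times> (real ^ 'd::finite) \<Rightarrow> real" and f' :: "'m \<times> (real ^ 'd) \<Rightarrow> real ^ 'd"
    and \<psi> :: "nat \<Rightarrow> 'm"
  assumes orth: "\<And>i j. inner (\<psi> i) (\<psi> j) = (if i = j then 1 else 0)"
    and Z: "compact Z" "open B" "Z \<subseteq> B"
    and deriv: "\<And>m z. z \<in> B \<Longrightarrow> ((\<lambda>z. f (m, z)) has_derivative (\<lambda>h. inner (f' (m, z)) h)) (at z)"
    and lip: "\<And>m1 m2 z. z \<in> B \<Longrightarrow> \<bar>f (m1, z) - f (m2, z)\<bar> \<le> \<kappa> * norm (m1 - m2)"
    and lip': "\<And>m1 m2 z1 z2. z1 \<in> B \<Longrightarrow> z2 \<in> B \<Longrightarrow>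
        norm (f' (m1, z1) - f' (m2, z2)) \<le> \<kappa>' * (norm (m1 - m2) + norm (z1 - z2))"
    and pos: "\<kappa> \<ge> 0" "\<kappa>' \<ge> 0" "\<epsilon> > 0"
  shows "\<exists>G G'. gelu_fun (r + CARD('d)) G \<and>
    (\<forall>m c z. z \<in> Z \<longrightarrow> (\<forall>i<r. \<bar>c i\<bar> \<le> R) \<longrightarrow> m = b + (\<Sum>i<r. c i *\<^sub>R \<psi> i) \<longrightarrow>
      ((\<lambda>z. G (net_input \<psi> r b (m, z))) has_derivative (\<lambda>h. inner (G' (m, z)) h)) (at z) \<and>
      \<bar>G (net_input \<psi> r b (m, z)) - f (m, z)\<bar> \<le> \<epsilon> \<and> norm (G' (m, z) - f' (m, z)) \<le> \<epsilon>)"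
proof -
  let ?d = "CARD('d)"
  define n where "n = r + ?d"
  define K where "K = {(m, z). z \<in> Z \<and> (\<exists>c. (\<forall>i<r. \<bar>c i\<bar> \<le> R) \<and> m = b + (\<Sum>i<r. c i *\<^sub>R \<psi> i))}"
  interpret net_approximation n "net_input \<psi> r b" K .
  have d: "real ?d > 0" by simp
  have norm_\<psi>: "norm (\<psi> i) = 1" for i by (simp add: norm_eq_sqrt_inner orth)
  \<comment> \<open>Grid nodes near \<open>Z\<close> may lie outside \<open>Z\<close>; this margin
    keeps them, and the segments leading to them, inside \<open>B\<close>.\<close>
  obtain \<rho>0 where \<rho>0: "\<rho>0 > 0" "(\<Union>z\<in>Z. cball z \<rho>0) \<subseteq> B"
    using compact_subset_open_imp_cball_epsilon_subset[OF Z] by blast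
  obtain R' where R': "\<And>z. z \<in> Z \<Longrightarrow> norm z \<le> R'"
    using compact_imp_bounded[OF Z(1)] by (auto simp: bounded_iff)
  define R0 where "R0 = max 0 (max R R')"
  \<comment> \<open>The value error will be C1 h^2 and that of the local gradients C2 h; the slopes
    4 / h along the axes of \<open>z\<close> turn the former into 4 d C1 h, with d the dimension.
    Then h makes C h \<le> \<epsilon> / 2, leaving the other half to the network.\<close>
  define C1 where "C1 = \<kappa> * (2 * real r) + \<kappa>' * (2 * real ?d)\<^sup>2"
  define C2 where "C2 = \<kappa>' * (2 * real r + 2 * real ?d)"
  define C where "C = C1 + C2 + 4 * real ?d * C1"
  have C: "C1 \<ge> 0" "C2 \<ge> 0" "C \<ge> 0" "C1 \<le> C" using pos by (auto simp: C1_def C2_def C_def)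
  define h where "h = min 1 (min (\<rho>0 / (2 * real ?d)) (\<epsilon> / (2 * (C + 1))))"
  have h: "h > 0" "h \<le> 1" "h \<le> \<rho>0 / (2 * real ?d)" "h \<le> \<epsilon> / (2 * (C + 1))"
    using \<rho>0 pos C d by (auto simp: h_def)
  have h_ball: "real ?d * (2 * h) \<le> \<rho>0" using h(3) d by (simp add: field_simps)
  have "C * h \<le> (C + 1) * (\<epsilon> / (2 * (C + 1)))" using h C by (intro mult_mono) auto
  moreover have "(C + 1) * (\<epsilon> / (2 * (C + 1))) = \<epsilon> / 2" using C by (simp add: divide_simps)
  ultimately have hC: "C * h \<le> \<epsilon> / 2" by linarith
  have h2: "h\<^sup>2 \<le> h" "h\<^sup>2 > 0" using h by (auto simp: power2_eq_square mult_le_one)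
  \<comment> \<open>The finer mesh \<open>h\<^sup>2\<close> in the coordinates of \<open>m\<close>, in which \<open>f\<close> is only Lipschitz, makes the error of
    the local Taylor polynomials \<open>O(h\<^sup>2)\<close>, which beats the gradients \<open>O(1/h)\<close> of the bump functions.\<close>
  define H where "H i = (if i < r then h\<^sup>2 else h)" for i
  define e :: "nat \<Rightarrow> real ^ 'd" where "e i = (if i < r then 0 else coord_axis (i - r))" for i
  have H: "H i > 0" "h\<^sup>2 \<le> H i" for i using h(1) h2(1) by (simp_all add: H_def)
  \<comment> \<open>Chosen for the finer mesh; the grid then covers the inputs in the coarser mesh
    as well.\<close>
  define N where "N = nat \<lceil>R0 / h\<^sup>2\<rceil> + 1"
  have "R0 / h\<^sup>2 \<le> real N - 1" by (simp add: N_def real_nat_ceiling_ge)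
  hence N: "R0 \<le> (real N - 1) * h\<^sup>2" using h2 by (simp add: field_simps)
  have N1: "real N \<ge> 1" by (simp add: N_def)
  have NH: "R0 \<le> (real N - 1) * H i" for i
    using N mult_left_mono[OF H(2)[of i], of "real N - 1"] N1 by linarith
  have coeff: "inner (m - b) (\<psi> i) = c i" if "m = b + (\<Sum>i<r. c i *\<^sub>R \<psi> i)" "i < r" for m c i
    using orthonormal_coeff[OF orth that(2)] that(1) by simp
  have input_bound: "\<bar>net_input \<psi> r b y $ i\<bar> \<le> R0" if i: "i < n" and yK: "y \<in> K" for i y
  proof (cases "i < r")
    case True
    obtain m z c where y: "y = (m, z)" and c: "\<forall>i<r. \<bar>c i\<bar> \<le> R" "m = b + (\<Sum>i<r. c i *\<^sub>R \<psi> i)"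
      using yK unfolding K_def by blast
    show ?thesis using c(1) True coeff[OF c(2) True] by (auto simp: y net_input_index R0_def)
  next
    case False
    obtain m z where y: "y = (m, z)" and z: "z \<in> Z" using yK unfolding K_def by blast
    have "\<bar>inner (coord_axis (i - r)) z\<bar> \<le> norm z"
      using Cauchy_Schwarz_ineq2[of "coord_axis (i - r)" z] by (simp add: norm_coord_axis)
    thus ?thesis using R'[OF z] False i by (auto simp: y net_input_index n_def R0_def)
  qed
  have coord: "approximable (\<lambda>y. net_input \<psi> r b y $ i) (\<lambda>_. e i)" if "i < n" for i
  proof (rule approximable_coord[OF that input_bound[OF that], where a = "\<lambda>m. if i < r then inner (m - b) (\<psi> i) else 0"])
    fix m and z :: "real ^ 'd"
    show "net_input \<psi> r b (m, z) $ i = (if i < r then inner (m - b) (\<psi> i) else 0) + inner (e i) z"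
      using that by (auto simp: net_input_index n_def e_def)
  qed
  have lin: "approximable (\<lambda>y. inner v (snd y)) (\<lambda>_. v)" for v
  proof -
    have "approximable (\<lambda>y. \<Sum>j<?d. inner (coord_axis j) v * net_input \<psi> r b y $ (r + j))
        (\<lambda>_. \<Sum>j<?d. inner (coord_axis j) v *\<^sub>R e (r + j))"
      by (intro approximable_sum approximable_scale coord) (simp add: n_def)
    thus ?thesis
    proof (rule approximable_cong)
      fix y :: "'m \<times> (real ^ 'd)"
      obtain m z where y: "y = (m, z)" by (cases y)
      have "inner v z = inner (\<Sum>j<?d. inner (coord_axis j) v *\<^sub>R coord_axis j) z" by (simp only: sum_coord_axis)
      thus "(\<Sum>j<?d. inner (coord_axis j) v * net_input \<psi> r b y $ (r + j)) = inner v (snd y)"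
        by (simp add: y net_input_index inner_sum_left)
      show "(\<Sum>j<?d. inner (coord_axis j) v *\<^sub>R e (r + j)) = v"
        using sum_coord_axis[of v] by (simp add: e_def)
    qed
  qed
  define t where "t k i = (real (k i) - real N) * H i" for k :: "nat \<Rightarrow> nat" and i
  define mk where "mk k = b + (\<Sum>i<r. t k i *\<^sub>R \<psi> i)" for k
  define zk :: "(nat \<Rightarrow> nat) \<Rightarrow> real ^ 'd" where "zk k = (\<Sum>j<?d. t k (r + j) *\<^sub>R coord_axis j)" for k
  define V where "V k = f' (mk k, zk k)" for k
  \<comment> \<open>Normalised so that the affine model takes the value of \<open>f\<close> at the
    node.\<close>
  define A where "A k = f (mk k, zk k) - inner (V k) (zk k)" for k
  have near: "\<bar>A k + inner (V k) (snd y) - f y\<bar> \<le> C1 * h\<^sup>2 \<and> norm (V k - f' y) \<le> C2 * h"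
    if y: "y \<in> K" and close: "\<And>i. i < n \<Longrightarrow> \<bar>net_input \<psi> r b y $ i - (real (k i) - real N) * H i\<bar> \<le> 2 * H i" for y k
  proof -
    obtain m z c where mz: "y = (m, z)" and z: "z \<in> Z" and c: "m = b + (\<Sum>i<r. c i *\<^sub>R \<psi> i)"
      using y unfolding K_def by blast
    have "\<bar>c i - t k i\<bar> \<le> 2 * h\<^sup>2" if "i < r" for i
      using close[of i] that coeff[OF c that] by (simp add: mz net_input_index n_def t_def H_def)
    hence "norm (\<Sum>i\<in>{..<r}. (c i - t k i) *\<^sub>R \<psi> i) \<le> real (card {..<r}) * (2 * h\<^sup>2)"
      by (intro norm_sum_scaleR_le norm_\<psi>) auto
    hence m: "norm (m - mk k) \<le> real r * (2 * h\<^sup>2)"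
      by (simp add: c mk_def scaleR_diff_left sum_subtractf)
    have "\<bar>inner (coord_axis j) z - t k (r + j)\<bar> \<le> 2 * h" if "j < ?d" for j
      using close[of "r + j"] that by (simp add: mz net_input_index n_def t_def H_def)
    hence "norm (\<Sum>j\<in>{..<?d}. (inner (coord_axis j) z - t k (r + j)) *\<^sub>R (coord_axis j :: real ^ 'd)) \<le> real (card {..<?d}) * (2 * h)"
      by (intro norm_sum_scaleR_le norm_coord_axis) auto
    hence zz: "norm (z - zk k) \<le> real ?d * (2 * h)"
      by (simp add: zk_def scaleR_diff_left sum_subtractf sum_coord_axis)
    have seg: "x \<in> B" if "x \<in> closed_segment (zk k) z" for x
    proof -
      have "norm (x - z) \<le> norm (zk k - z)" using segment_bound(2)[OF that] by (simp add: norm_minus_commute)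
      hence "x \<in> cball z \<rho>0" using zz h_ball by (simp add: dist_norm norm_minus_commute)
      thus ?thesis using \<rho>0(2) z by blast
    qed
    have zB: "z \<in> B" "zk k \<in> B" using seg by auto
    have "\<bar>f (mk k, z) - f (mk k, zk k) - inner (V k) (z - zk k)\<bar> \<le> \<kappa>' * (norm (z - zk k))\<^sup>2"
      unfolding V_def
    proof (rule taylor_bound[where f = "\<lambda>z. f (mk k, z)" and f' = "\<lambda>z. f' (mk k, z)"])
      fix x assume "x \<in> closed_segment (zk k) z"
      hence x: "x \<in> B" by (rule seg)
      show "((\<lambda>z. f (mk k, z)) has_derivative (\<lambda>h. inner (f' (mk k, x)) h)) (at x)" by (rule deriv[OF x])
      show "norm (f' (mk k, x) - f' (mk k, zk k)) \<le> \<kappa>' * norm (x - zk k)"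
        using lip'[OF x zB(2), of "mk k" "mk k"] by simp
    qed (rule pos)
    moreover have "\<kappa>' * (norm (z - zk k))\<^sup>2 \<le> \<kappa>' * (real ?d * (2 * h))\<^sup>2"
      using zz pos by (intro mult_left_mono power_mono) auto
    moreover have "\<bar>f (mk k, z) - f (m, z)\<bar> \<le> \<kappa> * (real r * (2 * h\<^sup>2))"
    proof (rule order.trans[OF lip[OF zB(1)]])
      show "\<kappa> * norm (mk k - m) \<le> \<kappa> * (real r * (2 * h\<^sup>2))"
        using m pos by (intro mult_left_mono) (simp_all add: norm_minus_commute)
    qed
    moreover have "A k + inner (V k) z - f (m, z)
        = - (f (mk k, z) - f (mk k, zk k) - inner (V k) (z - zk k)) + (f (mk k, z) - f (m, z))"
      by (simp add: A_def inner_diff_right)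
    ultimately have "\<bar>A k + inner (V k) z - f (m, z)\<bar> \<le> \<kappa>' * (real ?d * (2 * h))\<^sup>2 + \<kappa> * (real r * (2 * h\<^sup>2))"
      by linarith
    also have "\<dots> = C1 * h\<^sup>2" by (simp add: C1_def power2_eq_square algebra_simps)
    finally have 1: "\<bar>A k + inner (V k) z - f (m, z)\<bar> \<le> C1 * h\<^sup>2" .
    have "norm (V k - f' (m, z)) \<le> \<kappa>' * (norm (mk k - m) + norm (zk k - z))"
      unfolding V_def by (rule lip'[OF zB(2,1)])
    also have "\<dots> \<le> \<kappa>' * (real r * (2 * h) + real ?d * (2 * h))"
    proof (intro mult_left_mono add_mono pos)
      have "real r * (2 * h\<^sup>2) \<le> real r * (2 * h)" using h2 by (intro mult_left_mono) auto
      thus "norm (mk k - m) \<le> real r * (2 * h)" using m unfolding norm_minus_commute[of "mk k" m] by linarith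
      show "norm (zk k - z) \<le> real ?d * (2 * h)" using zz by (simp add: norm_minus_commute)
    qed
    also have "\<dots> = C2 * h" by (simp add: C2_def algebra_simps)
    finally show ?thesis using 1 by (simp add: mz)
  qed
  have range: "\<bar>net_input \<psi> r b y $ i\<bar> \<le> (real N - 1) * H i" if "i < n" "y \<in> K" for i y
    using input_bound[OF that] NH[of i] by linarith
  have "\<exists>F F'. approximable F F' \<and> (\<forall>y\<in>K. \<bar>F y - f y\<bar> \<le> C1 * h\<^sup>2 \<and>
        norm (F' y - f' y) \<le> C2 * h + (\<Sum>i<n. 4 / H i * norm (e i)) * (C1 * h\<^sup>2))"
    by (rule grid_approximable[OF coord lin H(1) range near])
  then obtain F F' where F: "approximable F F'" and Ff: "\<forall>y\<in>K. \<bar>F y - f y\<bar> \<le> C1 * h\<^sup>2 \<and>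
        norm (F' y - f' y) \<le> C2 * h + (\<Sum>i<n. 4 / H i * norm (e i)) * (C1 * h\<^sup>2)"
    by (elim exE conjE) (rule that)
  \<comment> \<open>Since \<open>e i = 0\<close> for \<open>i < r\<close>, the quotients by the fine
    mesh h^2 are annihilated; each axis of \<open>z\<close> contributes 4 / h.\<close>
  have "(\<Sum>i<n. 4 / H i * norm (e i)) = (\<Sum>i<r. 4 / H i * norm (e i)) + (\<Sum>j<?d. 4 / H (r + j) * norm (e (r + j)))"
    unfolding n_def by (rule sum_lessThan_add)
  also have "\<dots> = real ?d * (4 / h)" by (simp add: e_def H_def norm_coord_axis)
  finally have S: "(\<Sum>i<n. 4 / H i * norm (e i)) * (C1 * h\<^sup>2) = 4 * real ?d * C1 * h"
    using h by (simp add: power2_eq_square)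
  have "C1 * h\<^sup>2 \<le> C * h" using C h h2 by (intro mult_mono) auto
  moreover have "C2 * h + 4 * real ?d * C1 * h \<le> C * h"
    using C h unfolding C_def by (simp add: algebra_simps)
  ultimately have Ff': "\<bar>F y - f y\<bar> \<le> \<epsilon> / 2" "norm (F' y - f' y) \<le> \<epsilon> / 2" if "y \<in> K" for y
    using Ff that hC unfolding S by fastforce+
  have e2: "\<epsilon> / 2 > 0" using pos by simp
  obtain G G' where G: "gelu_fun n G"
    "\<And>y. y \<in> K \<Longrightarrow> ((\<lambda>z. G (net_input \<psi> r b (fst y, z))) has_derivative (\<lambda>h. inner (G' y) h)) (at (snd y))"
    "\<And>y. y \<in> K \<Longrightarrow> \<bar>G (net_input \<psi> r b y) - F y\<bar> \<le> \<epsilon> / 2" "\<And>y. y \<in> K \<Longrightarrow> norm (G' y - F' y) \<le> \<epsilon> / 2"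
    by (rule approximable_net[OF F e2], rule that, assumption) auto
  have "((\<lambda>z. G (net_input \<psi> r b (m, z))) has_derivative (\<lambda>h. inner (G' (m, z)) h)) (at z) \<and>
      \<bar>G (net_input \<psi> r b (m, z)) - f (m, z)\<bar> \<le> \<epsilon> \<and> norm (G' (m, z) - f' (m, z)) \<le> \<epsilon>"
    if "z \<in> Z" "\<forall>i<r. \<bar>c i\<bar> \<le> R" "m = b + (\<Sum>i<r. c i *\<^sub>R \<psi> i)" for m c z
  proof -
    have K: "(m, z) \<in> K" using that unfolding K_def by blast
    have "\<bar>G (net_input \<psi> r b (m, z)) - f (m, z)\<bar> \<le> \<epsilon>"
      using G(3)[OF K] Ff'(1)[OF K] by linarith
    moreover have "norm (G' (m, z) - f' (m, z)) \<le> \<epsilon>"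
      using G(4)[OF K] Ff'(2)[OF K] norm_triangle_le[of "G' (m, z) - F' (m, z)" "F' (m, z) - f' (m, z)" \<epsilon>] by simp
    ultimately show ?thesis using G(2)[OF K] by simp
  qed
  thus ?thesis using G(1) unfolding n_def by (intro exI[of _ G] exI[of _ G'] conjI allI impI) auto
qed

section \<open>Projections, clipping and moments\<close>

definition proj :: "(nat \<Rightarrow> 'a::real_inner) \<Rightarrow> nat \<Rightarrow> 'a \<Rightarrow> 'a" where
  "proj \<phi> r x = (\<Sum>i<r. inner x (\<phi> i) *\<^sub>R \<phi> i)"

lemma linear_proj: "linear (proj \<phi> r)"
  unfolding proj_def
  by (intro linearI) (simp_all add: inner_add_left scaleR_add_left sum.distrib scaleR_sum_right)

text \<open>Pythagoras. This contraction property gives both the integrable majorants and the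
  uniformity in \<open>z\<close>.\<close>

lemma norm_diff_proj_le:
  assumes orth: "\<And>i j. inner (\<phi> i) (\<phi> j) = (if i = j then 1 else 0)"
  shows "norm (x - proj \<phi> r x) \<le> norm x"
proof -
  have coeff: "inner (proj \<phi> r x) (\<phi> i) = inner x (\<phi> i)" if "i < r" for i
    using that by (simp add: proj_def inner_sum_left orth if_distrib cong: if_cong)
  have "inner (x - proj \<phi> r x) (proj \<phi> r x) = (\<Sum>i<r. inner x (\<phi> i) * inner (x - proj \<phi> r x) (\<phi> i))"
    by (subst (2) proj_def) (simp add: inner_sum_right)
  also have "\<dots> = 0" using coeff by (intro sum.neutral) (simp add: inner_diff_left)
  finally have 0: "inner (x - proj \<phi> r x) (proj \<phi> r x) = 0" .
  have "(norm x)\<^sup>2 = (norm ((x - proj \<phi> r x) + proj \<phi> r x))\<^sup>2" by simp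
  also have "\<dots> = (norm (x - proj \<phi> r x))\<^sup>2 + (norm (proj \<phi> r x))\<^sup>2"
    using 0 by (simp only: power2_norm_eq_inner inner_add_left inner_add_right inner_commute[of "proj \<phi> r x" "x - proj \<phi> r x"])
  finally have "(norm (x - proj \<phi> r x))\<^sup>2 \<le> (norm x)\<^sup>2" by simp
  thus ?thesis by simp
qed

text \<open>The vectors eventually fixed by the projections form a subspace containing the basis,
  hence its dense span; the contraction property extends the limit to the closure.\<close>

lemma proj_tendsto:
  assumes "orthonormal_basis \<phi>"
  shows "(\<lambda>r. norm (x - proj \<phi> r x)) \<longlonglongrightarrow> 0"
proof -
  have orth: "\<And>i j. inner (\<phi> i) (\<phi> j) = (if i = j then 1 else 0)"
    and dense: "closure (span (range \<phi>)) = UNIV" using assms by (auto simp: orthonormal_basis_def)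
  define S where "S = {y. \<exists>r0. \<forall>r\<ge>r0. proj \<phi> r y = y}"
  have "subspace S"
  proof (rule subspaceI)
    show "0 \<in> S" by (simp add: S_def linear_0[OF linear_proj])
    fix x y c assume "x \<in> S" "y \<in> S"
    then obtain r1 r2 where "\<forall>r\<ge>r1. proj \<phi> r x = x" "\<forall>r\<ge>r2. proj \<phi> r y = y" by (auto simp: S_def)
    thus "x + y \<in> S" unfolding S_def
      by (auto intro!: exI[of _ "max r1 r2"] simp: linear_add[OF linear_proj])
  next
    fix x c assume "x \<in> S"
    thus "c *\<^sub>R x \<in> S" by (auto simp: S_def linear_cmul[OF linear_proj])
  qed
  moreover have "range \<phi> \<subseteq> S"
  proof clarify
    fix i
    have "proj \<phi> r (\<phi> i) = \<phi> i" if "r \<ge> Suc i" for r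
    proof -
      have "proj \<phi> r (\<phi> i) = (\<Sum>j<r. if i = j then \<phi> j else 0)"
        unfolding proj_def by (intro sum.cong) (auto simp: orth)
      thus ?thesis using that by simp
    qed
    thus "\<phi> i \<in> S" unfolding S_def by blast
  qed
  ultimately have span: "span (range \<phi>) \<subseteq> S" by (intro span_minimal)
  show ?thesis
  proof (rule LIMSEQ_I)
    fix e :: real assume e: "e > 0"
    have "x \<in> closure (span (range \<phi>))" using dense by simp
    then obtain y where y: "y \<in> span (range \<phi>)" "dist y x < e" using e by (auto simp: closure_approachable)
    then obtain r0 where r0: "\<forall>r\<ge>r0. proj \<phi> r y = y" using span by (auto simp: S_def)
    have "norm (norm (x - proj \<phi> r x) - 0) < e" if "r \<ge> r0" for r
    proof -
      have "x - proj \<phi> r x = (x - y) - proj \<phi> r (x - y)"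
        using r0 that by (simp add: linear_diff[OF linear_proj])
      hence "norm (x - proj \<phi> r x) \<le> norm (x - y)"
        using norm_diff_proj_le[OF orth, of "x - y" r] by (simp only:)
      thus ?thesis using y(2) by (simp add: dist_norm norm_minus_commute)
    qed
    thus "\<exists>no. \<forall>r\<ge>no. norm (norm (x - proj \<phi> r x) - 0) < e" by blast
  qed
qed

section \<open>Powers of sums and convergence of moments\<close>

lemma powr_add4_le:
  fixes a b c d p :: real
  assumes "a \<ge> 0" "b \<ge> 0" "c \<ge> 0" "d \<ge> 0" "p \<ge> 0"
  shows "(a + b + c + d) powr p \<le> 4 powr p * (a powr p + b powr p + c powr p + d powr p)"
proof -
  define M where "M = max (max a b) (max c d)"
  have "(a + b + c + d) powr p \<le> (4 * M) powr p"
    using assms by (intro powr_mono2) (auto simp: M_def)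
  also have "\<dots> = 4 powr p * M powr p" using assms by (simp add: powr_mult M_def)
  also have "M powr p \<le> a powr p + b powr p + c powr p + d powr p"
    unfolding M_def max_def by simp
  finally show ?thesis by simp
qed

text \<open>Measurability is asked of the majorants \<open>a1\<close>, \<open>a2\<close>,
  \<open>a3\<close>, since \<open>nn_integral\<close> is monotone on all functions; the error of a
  surrogate can thus be inserted directly.\<close>

lemma nn_integral_powr_le_of_terms:
  fixes E a1 a2 a3 :: "'a \<Rightarrow> real"
  assumes "prob_space M" and p: "p \<ge> 0" and \<omega>: "\<omega> \<ge> 0"
    and [measurable]: "a1 \<in> borel_measurable M" "a2 \<in> borel_measurable M" "a3 \<in> borel_measurable M"
    and nonneg: "\<And>x. a1 x \<ge> 0" "\<And>x. a2 x \<ge> 0" "\<And>x. a3 x \<ge> 0" "a4 \<ge> 0"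
    and small: "(\<integral>\<^sup>+x. ennreal (a1 x powr p) \<partial>M) \<le> ennreal \<omega>" "(\<integral>\<^sup>+x. ennreal (a2 x powr p) \<partial>M) \<le> ennreal \<omega>"
      "(\<integral>\<^sup>+x. ennreal (a3 x powr p) \<partial>M) \<le> ennreal \<omega>" "a4 powr p \<le> \<omega>"
    and E: "\<And>x. 0 \<le> E x" "\<And>x. E x \<le> a1 x + a2 x + a3 x + a4"
  shows "(\<integral>\<^sup>+x. ennreal (E x powr p) \<partial>M) \<le> ennreal (4 powr p * (4 * \<omega>))"
proof -
  interpret prob_space M by fact
  have "(\<integral>\<^sup>+x. ennreal (E x powr p) \<partial>M)
      \<le> (\<integral>\<^sup>+x. ennreal (4 powr p) * (ennreal (a1 x powr p) + ennreal (a2 x powr p) + ennreal (a3 x powr p) + ennreal (a4 powr p)) \<partial>M)"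
  proof (rule nn_integral_mono)
    fix x
    have "E x powr p \<le> (a1 x + a2 x + a3 x + a4) powr p" using E p by (intro powr_mono2) auto
    also have "\<dots> \<le> 4 powr p * (a1 x powr p + a2 x powr p + a3 x powr p + a4 powr p)"
      by (intro powr_add4_le nonneg p)
    finally have "ennreal (E x powr p) \<le> ennreal (4 powr p * (a1 x powr p + a2 x powr p + a3 x powr p + a4 powr p))"
      by (rule ennreal_leI)
    also have "\<dots> = ennreal (4 powr p) * (ennreal (a1 x powr p) + ennreal (a2 x powr p) + ennreal (a3 x powr p) + ennreal (a4 powr p))"
      by (simp add: ennreal_mult ennreal_plus)
    finally show "ennreal (E x powr p) \<le> \<dots>" .
  qed
  also have "\<dots> = ennreal (4 powr p) * ((\<integral>\<^sup>+x. ennreal (a1 x powr p) \<partial>M) + (\<integral>\<^sup>+x. ennreal (a2 x powr p) \<partial>M)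
      + (\<integral>\<^sup>+x. ennreal (a3 x powr p) \<partial>M) + ennreal (a4 powr p))"
    by (simp add: nn_integral_cmult nn_integral_add emeasure_space_1)
  also have "\<dots> \<le> ennreal (4 powr p) * (ennreal \<omega> + ennreal \<omega> + ennreal \<omega> + ennreal \<omega>)"
    by (intro mult_left_mono add_mono small ennreal_leI) auto
  also have "ennreal \<omega> + ennreal \<omega> + ennreal \<omega> + ennreal \<omega> = ennreal (4 * \<omega>)"
    using \<omega> by (subst ennreal_plus[symmetric], simp, simp)+ simp
  also have "ennreal (4 powr p) * ennreal (4 * \<omega>) = ennreal (4 powr p * (4 * \<omega>))"
    using \<omega> by (intro ennreal_mult[symmetric]) auto
  finally show ?thesis .
qed

text \<open>Dominated convergence with majorant (2 C)^p (1 + |m|^p), from 1 + |m| \<le> 2 max(1,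
  |m|). Each error term then needs continuity, linear growth and a pointwise limit.\<close>

lemma eventually_nn_integral_powr_le:
  fixes M :: "'m::real_normed_vector measure" and a :: "nat \<Rightarrow> 'm \<Rightarrow> real"
  assumes "prob_space M" and borel: "sets M = sets borel" and p: "p > 0"
    and moment: "(\<integral>\<^sup>+m. ennreal (norm m powr p) \<partial>M) < \<infinity>"
    and cont: "\<And>n. continuous_on UNIV (a n)"
    and bound: "\<And>n m. 0 \<le> a n m" "\<And>n m. a n m \<le> C * (1 + norm m)"
    and lim: "\<And>m. (\<lambda>n. a n m) \<longlonglongrightarrow> 0" and \<omega>: "\<omega> > 0"
  shows "eventually (\<lambda>n. (\<integral>\<^sup>+m. ennreal (a n m powr p) \<partial>M) \<le> ennreal \<omega>) sequentially"
proof -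
  interpret prob_space M by fact
  have meas: "f \<in> borel_measurable M" if "continuous_on UNIV f" for f :: "'m \<Rightarrow> real"
    using borel_measurable_continuous_onI[OF that] measurable_cong_sets[OF borel refl] by blast
  have [measurable]: "a n \<in> borel_measurable M" for n by (rule meas[OF cont])
  have [measurable]: "norm \<in> borel_measurable M" by (intro meas continuous_intros)
  have C: "C \<ge> 0" using order.trans[OF bound(1)[of 0 0] bound(2)[of 0 0]] by simp
  define w where "w m = ennreal ((2 * C) powr p) * (1 + ennreal (norm m powr p))" for m :: 'm
  have [measurable]: "w \<in> borel_measurable M" unfolding w_def[abs_def] by measurable
  have w: "ennreal (a n m powr p) \<le> w m" for n m
  proof -
    have "a n m powr p \<le> ((2 * C) * max 1 (norm m)) powr p"
    proof (rule powr_mono2)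
      have "C * (1 + norm m) \<le> C * (2 * max 1 (norm m))" using C by (intro mult_left_mono) auto
      thus "a n m \<le> (2 * C) * max 1 (norm m)" using bound(2)[of n m] by simp
    qed (use p bound in auto)
    also have "\<dots> = (2 * C) powr p * (max 1 (norm m)) powr p" using C by (simp add: powr_mult)
    also have "\<dots> \<le> (2 * C) powr p * (1 + norm m powr p)"
      by (intro mult_left_mono) (auto simp: max_def)
    finally have "ennreal (a n m powr p) \<le> ennreal ((2 * C) powr p * (1 + norm m powr p))" by (rule ennreal_leI)
    thus ?thesis by (simp add: w_def ennreal_mult ennreal_plus)
  qed
  have "(\<lambda>n. \<integral>\<^sup>+m. ennreal (a n m powr p) \<partial>M) \<longlonglongrightarrow> (\<integral>\<^sup>+m. 0 \<partial>M)"
  proof (rule nn_integral_dominated_convergence[where w = w])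
    have "(\<integral>\<^sup>+m. w m \<partial>M) = ennreal ((2 * C) powr p) * (1 + (\<integral>\<^sup>+m. ennreal (norm m powr p) \<partial>M))"
      unfolding w_def by (simp add: nn_integral_cmult nn_integral_add emeasure_space_1)
    also have "\<dots> < \<infinity>" using moment by (simp add: ennreal_mult_less_top)
    finally show "(\<integral>\<^sup>+m. w m \<partial>M) < \<infinity>" .
    show "AE m in M. (\<lambda>n. ennreal (a n m powr p)) \<longlonglongrightarrow> 0"
    proof (rule AE_I2)
      fix m
      have "(\<lambda>n. a n m powr p) \<longlonglongrightarrow> 0 powr p"
        by (rule tendsto_powr'[OF lim tendsto_const]) (use p bound in auto)
      hence "(\<lambda>n. ennreal (a n m powr p)) \<longlonglongrightarrow> ennreal 0"
        using p by (intro tendsto_ennrealI) simp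
      thus "(\<lambda>n. ennreal (a n m powr p)) \<longlonglongrightarrow> 0" by simp
    qed
  qed (use w in auto)
  hence "(\<lambda>n. \<integral>\<^sup>+m. ennreal (a n m powr p) \<partial>M) \<longlonglongrightarrow> 0" by simp
  from order_tendstoD(2)[OF this, of "ennreal \<omega>"] \<omega>
  have "eventually (\<lambda>n. (\<integral>\<^sup>+m. ennreal (a n m powr p) \<partial>M) < ennreal \<omega>) sequentially" by simp
  thus ?thesis by (rule eventually_mono) simp
qed

text \<open>With \<open>max 0\<close> in place of \<open>gelu\<close> this is exactly truncation to
  [-R, R]. The replacement costs at most 1 for each of the two terms, whence the 2 in the bounds
  below.\<close>

definition soft_clip :: "real \<Rightarrow> real \<Rightarrow> real" where
  "soft_clip R x = gelu (x + R) - gelu (x - R) - R"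

lemma soft_clip_bound: assumes "R \<ge> 0" shows "\<bar>soft_clip R x\<bar> \<le> R + 2"
  using gelu_relu_le_1[of "x + R"] gelu_relu_le_1[of "x - R"] assms
  unfolding soft_clip_def max_def by (auto split: if_splits)

lemma soft_clip_diff_le: assumes "R \<ge> 0" shows "\<bar>x - soft_clip R x\<bar> \<le> \<bar>x\<bar> + 2"
  using gelu_relu_le_1[of "x + R"] gelu_relu_le_1[of "x - R"] assms
  unfolding soft_clip_def max_def by (auto split: if_splits)

text \<open>For n \<ge> 2 |x| + 1 both arguments x + n and x - n have modulus at least n / 2, where
  \<open>gelu\<close> is within 2 / n of \<open>max 0\<close>.\<close>

lemma soft_clip_tendsto: "(\<lambda>n. \<bar>x - soft_clip (real n) x\<bar>) \<longlonglongrightarrow> 0"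
proof (rule tendsto_sandwich[OF _ _ tendsto_const])
  show "eventually (\<lambda>n. \<bar>x - soft_clip (real n) x\<bar> \<le> 4 / real n) sequentially"
  proof (rule eventually_mono[OF eventually_ge_at_top[of "nat \<lceil>2 * \<bar>x\<bar>\<rceil> + 1"]])
    fix n assume "n \<ge> nat \<lceil>2 * \<bar>x\<bar>\<rceil> + 1"
    hence n: "real n \<ge> 2 * \<bar>x\<bar> + 1" by linarith
    have *: "\<bar>gelu y - max 0 y\<bar> \<le> 2 / real n" if "\<bar>y\<bar> \<ge> real n / 2" for y
    proof -
      have "real n / 2 * \<bar>gelu y - max 0 y\<bar> \<le> \<bar>y\<bar> * \<bar>gelu y - max 0 y\<bar>"
        using that by (intro mult_right_mono) auto
      hence "real n / 2 * \<bar>gelu y - max 0 y\<bar> \<le> 1" using gelu_relu_le(2)[of y] by linarith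
      thus ?thesis using n by (simp add: field_simps)
    qed
    have "\<bar>x + real n\<bar> \<ge> real n / 2" "\<bar>x - real n\<bar> \<ge> real n / 2" using n by linarith+
    note * [OF this(1)] *[OF this(2)]
    moreover have "max 0 (x + real n) = x + real n" "max 0 (x - real n) = 0" using n by auto
    ultimately show "\<bar>x - soft_clip (real n) x\<bar> \<le> 4 / real n"
      unfolding soft_clip_def by (simp add: abs_le_iff)
  qed
  show "(\<lambda>n. 4 / real n) \<longlonglongrightarrow> 0" by (rule lim_const_over_n)
qed auto

lemma continuous_soft_clip: "continuous_on UNIV f \<Longrightarrow> continuous_on UNIV (\<lambda>x. soft_clip R (f x))"
  unfolding soft_clip_def by (intro continuous_intros continuous_on_compose2[OF continuous_gelu]) auto

lemma gelu_fun_soft_clip: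
  assumes "gelu_fun n f" shows "gelu_fun n (\<lambda>x. soft_clip R (f x))"
proof -
  have "gelu_fun n (\<lambda>x. gelu (f x + R) + ((-1) * gelu (f x + - R) + - R))"
    by (intro gelu_fun.add gelu_fun.scale gelu_fun.gelu gelu_fun.const assms)
  thus ?thesis by (simp add: soft_clip_def algebra_simps)
qed

section \<open>The surrogate\<close>

lemma hs_norm_L2_set: "hs_norm A = L2_set (\<lambda>e. norm (A e)) Basis"
  by (simp add: hs_norm_def L2_set_def)

lemma norm_le_hs_norm: "e \<in> Basis \<Longrightarrow> norm (A e) \<le> hs_norm A"
  unfolding hs_norm_L2_set by (rule member_le_L2_set) auto

lemma hs_norm_le_sum: "hs_norm A \<le> (\<Sum>e\<in>Basis. norm (A e))"
  unfolding hs_norm_L2_set by (rule L2_set_le_sum) auto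

lemma hs_norm_nonneg: "hs_norm A \<ge> 0"
  by (simp add: hs_norm_def sum_nonneg)

lemma D_z_has_derivative:
  assumes "continuously_differentiable_on u (UNIV \<times> B)" "z \<in> B"
  shows "((\<lambda>z. u (m, z)) has_derivative D_z u m z) (at z)"
proof -
  obtain u' where "(u has_derivative u') (at (m, z))"
    using assms unfolding continuously_differentiable_on_def by blast
  moreover have "((\<lambda>z. (m, z)) has_derivative (\<lambda>h. (0, h))) (at z)"
    by (intro has_derivative_Pair has_derivative_const has_derivative_ident)
  ultimately have "((\<lambda>z. u (m, z)) has_derivative (\<lambda>h. u' (0, h))) (at z)"
    using has_derivative_compose[of "\<lambda>z. (m, z)" "\<lambda>h. (0, h)" z UNIV u u'] by simp
  thus ?thesis
    unfolding D_z_def using frechet_derivative_works differentiableI by blast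
qed

definition clip_point :: "(nat \<Rightarrow> 'm::real_inner) \<Rightarrow> nat \<Rightarrow> 'm \<Rightarrow> real \<Rightarrow> 'm \<Rightarrow> 'm" where
  "clip_point \<psi> r b R m = b + (\<Sum>i<r. soft_clip R (inner (m - b) (\<psi> i)) *\<^sub>R \<psi> i)"

text \<open>Separates the projection tail, which depends on \<open>r\<close> only, from the clipping
  error, so that \<open>r\<close> can be chosen before \<open>R\<close>.\<close>

lemma norm_diff_clip_point_le:
  assumes orth: "\<And>i j. inner (\<psi> i) (\<psi> j) = (if i = j then 1 else 0)"
  shows "norm (m - clip_point \<psi> r b R m) \<le> norm ((m - b) - proj \<psi> r (m - b))
    + (\<Sum>i<r. \<bar>inner (m - b) (\<psi> i) - soft_clip R (inner (m - b) (\<psi> i))\<bar>)"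
proof -
  have "norm (\<psi> i) = 1" for i by (simp add: norm_eq_sqrt_inner orth)
  hence "norm (\<Sum>i<r. (inner (m - b) (\<psi> i) - soft_clip R (inner (m - b) (\<psi> i))) *\<^sub>R \<psi> i)
      \<le> (\<Sum>i<r. \<bar>inner (m - b) (\<psi> i) - soft_clip R (inner (m - b) (\<psi> i))\<bar>)"
    by (intro order.trans[OF norm_sum]) simp
  moreover have "m - clip_point \<psi> r b R m = ((m - b) - proj \<psi> r (m - b))
      + (\<Sum>i<r. (inner (m - b) (\<psi> i) - soft_clip R (inner (m - b) (\<psi> i))) *\<^sub>R \<psi> i)"
    by (simp add: clip_point_def proj_def scaleR_diff_left sum_subtractf)
  ultimately show ?thesis using norm_triangle_ineq by (smt (verit))
qed

lemma net_input_dim: "dim_vec (net_input \<psi> r b (m, z :: real ^ 'd::finite)) = r + CARD('d)"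
  by (simp add: net_input_def encode_def coords_def)

text \<open>By orthonormality, clipping inside the network amounts to replacing \<open>m\<close> by
  \<open>clip_point\<close>. Whatever \<open>m\<close> is, the unclipped network is then evaluated
  on a bounded set; and as the clipped point is independent of \<open>z\<close>, derivatives in
  \<open>z\<close> are those at that point.\<close>

lemma net_input_clip_point:
  assumes orth: "\<And>i j. inner (\<psi> i) (\<psi> j) = (if i = j then 1 else 0)"
  fixes z :: "real ^ 'd::finite"
  shows "vec (r + CARD('d)) (\<lambda>i. if i < r then soft_clip R (net_input \<psi> r b (m, z) $ i) else net_input \<psi> r b (m, z) $ i)
    = net_input \<psi> r b (clip_point \<psi> r b R m, z)"
proof (rule eq_vecI)
  fix i assume "i < dim_vec (net_input \<psi> r b (clip_point \<psi> r b R m, z))"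
  hence i: "i < r + CARD('d)" by (simp add: net_input_dim)
  show "vec (r + CARD('d)) (\<lambda>i. if i < r then soft_clip R (net_input \<psi> r b (m, z) $ i) else net_input \<psi> r b (m, z) $ i) $ i
      = net_input \<psi> r b (clip_point \<psi> r b R m, z) $ i"
    using i orthonormal_coeff[OF orth, of i r "\<lambda>i. soft_clip R (inner (m - b) (\<psi> i))"]
    by (auto simp: net_input_index clip_point_def)
qed (simp add: net_input_dim)

text \<open>Every coefficient \<open>l\<close> gets its own network, accurate where the coordinates
  of the parameter are at most \<open>R + 2\<close>, the range of \<open>soft_clip R\<close>;
  precomposition with the clip makes the estimates valid for all \<open>m\<close>.\<close>

lemma surrogate_exists:
  fixes f :: "nat \<Rightarrow> 'm::real_inner \<times> (real ^ 'd::finite) \<Rightarrow> real" and f' :: "nat \<Rightarrow> 'm \<times> (real ^ 'd) \<Rightarrow> real ^ 'd"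
    and \<psi> :: "nat \<Rightarrow> 'm" and \<phi> :: "nat \<Rightarrow> 'u::real_inner"
  assumes orth: "\<And>i j. inner (\<psi> i) (\<psi> j) = (if i = j then 1 else 0)"
    and Z: "compact Z" "open B" "Z \<subseteq> B"
    and deriv: "\<And>l m z. z \<in> B \<Longrightarrow> ((\<lambda>z. f l (m, z)) has_derivative (\<lambda>h. inner (f' l (m, z)) h)) (at z)"
    and lip: "\<And>l m1 m2 z. z \<in> B \<Longrightarrow> \<bar>f l (m1, z) - f l (m2, z)\<bar> \<le> \<kappa> * norm (m1 - m2)"
    and lip': "\<And>l m1 m2 z1 z2. z1 \<in> B \<Longrightarrow> z2 \<in> B \<Longrightarrow>
        norm (f' l (m1, z1) - f' l (m2, z2)) \<le> \<kappa>' * (norm (m1 - m2) + norm (z1 - z2))"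
    and pos: "\<kappa> \<ge> 0" "\<kappa>' \<ge> 0" "\<delta> > 0" "R \<ge> 0"
  shows "\<exists>g X X'. is_gelu_network (r + CARD('d)) r_u g \<and> (\<forall>m z. z \<in> Z \<longrightarrow>
      surrogate \<phi> r_u \<psi> r b_u b g (m, z) = (\<Sum>l<r_u. X l (m, z) *\<^sub>R \<phi> l) + b_u \<and>
      D_z (surrogate \<phi> r_u \<psi> r b_u b g) m z = (\<lambda>h. \<Sum>l<r_u. inner (X' l (m, z)) h *\<^sub>R \<phi> l) \<and>
      (\<forall>l<r_u. \<bar>X l (m, z) - f l (clip_point \<psi> r b R m, z)\<bar> \<le> \<delta> \<and>
        norm (X' l (m, z) - f' l (clip_point \<psi> r b R m, z)) \<le> \<delta>))"
proof -
  define n where "n = r + CARD('d)"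
  define Q where "Q l P \<longleftrightarrow> gelu_fun n (fst P) \<and> (\<forall>m c z. z \<in> Z \<longrightarrow> (\<forall>i<r. \<bar>c i\<bar> \<le> R + 2) \<longrightarrow> m = b + (\<Sum>i<r. c i *\<^sub>R \<psi> i) \<longrightarrow>
      ((\<lambda>z. fst P (net_input \<psi> r b (m, z))) has_derivative (\<lambda>h. inner (snd P (m, z)) h)) (at z) \<and>
      \<bar>fst P (net_input \<psi> r b (m, z)) - f l (m, z)\<bar> \<le> \<delta> \<and> norm (snd P (m, z) - f' l (m, z)) \<le> \<delta>)"
    for l and P :: "(real vec \<Rightarrow> real) \<times> ('m \<times> (real ^ 'd) \<Rightarrow> real ^ 'd)"
  have "\<exists>P. Q l P" for l
  proof -
    have "\<exists>G G'. gelu_fun n G \<and> (\<forall>m c z. z \<in> Z \<longrightarrow> (\<forall>i<r. \<bar>c i\<bar> \<le> R + 2) \<longrightarrow> m = b + (\<Sum>i<r. c i *\<^sub>R \<psi> i) \<longrightarrow>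
      ((\<lambda>z. G (net_input \<psi> r b (m, z))) has_derivative (\<lambda>h. inner (G' (m, z)) h)) (at z) \<and>
      \<bar>G (net_input \<psi> r b (m, z)) - f l (m, z)\<bar> \<le> \<delta> \<and> norm (G' (m, z) - f' l (m, z)) \<le> \<delta>)"
      unfolding n_def by (rule gelu_fun_C1_approximation[OF orth Z deriv lip lip' pos(1-3)])
    then obtain G G' where "gelu_fun n G \<and> (\<forall>m c z. z \<in> Z \<longrightarrow> (\<forall>i<r. \<bar>c i\<bar> \<le> R + 2) \<longrightarrow> m = b + (\<Sum>i<r. c i *\<^sub>R \<psi> i) \<longrightarrow>
      ((\<lambda>z. G (net_input \<psi> r b (m, z))) has_derivative (\<lambda>h. inner (G' (m, z)) h)) (at z) \<and>
      \<bar>G (net_input \<psi> r b (m, z)) - f l (m, z)\<bar> \<le> \<delta> \<and> norm (G' (m, z) - f' l (m, z)) \<le> \<delta>)"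
      by (elim exE) (rule that)
    hence "Q l (G, G')" by (simp add: Q_def)
    thus ?thesis by (rule exI)
  qed
  then obtain P where P: "\<And>l. Q l (P l)" by metis
  define G where "G l = fst (P l)" for l
  define G' where "G' l = snd (P l)" for l
  let ?c = "clip_point \<psi> r b R"
  have G_net: "gelu_fun n (G l)" for l using P[of l] by (simp add: Q_def G_def)
  have G: "((\<lambda>z. G l (net_input \<psi> r b (?c m, z))) has_derivative (\<lambda>h. inner (G' l (?c m, z)) h)) (at z)"
      "\<bar>G l (net_input \<psi> r b (?c m, z)) - f l (?c m, z)\<bar> \<le> \<delta>" "norm (G' l (?c m, z) - f' l (?c m, z)) \<le> \<delta>"
    if z: "z \<in> Z" for l m z
  proof -
    have "((\<lambda>z. G l (net_input \<psi> r b (?c m, z))) has_derivative (\<lambda>h. inner (G' l (?c m, z)) h)) (at z) \<and>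
        \<bar>G l (net_input \<psi> r b (?c m, z)) - f l (?c m, z)\<bar> \<le> \<delta> \<and> norm (G' l (?c m, z) - f' l (?c m, z)) \<le> \<delta>"
      unfolding G_def G'_def
      by (rule P[of l, unfolded Q_def, THEN conjunct2, rule_format, OF z _ clip_point_def])
        (use soft_clip_bound[OF pos(4)] in simp)
    thus "((\<lambda>z. G l (net_input \<psi> r b (?c m, z))) has_derivative (\<lambda>h. inner (G' l (?c m, z)) h)) (at z)"
      "\<bar>G l (net_input \<psi> r b (?c m, z)) - f l (?c m, z)\<bar> \<le> \<delta>" "norm (G' l (?c m, z) - f' l (?c m, z)) \<le> \<delta>"
      by auto
  qed
  \<comment> \<open>The inputs from \<open>z\<close> pass unclipped, so that no extra factor enters
    the derivative in \<open>z\<close>.\<close>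
  define g where "g x = vec r_u (\<lambda>l. G l (vec n (\<lambda>i. if i < r then soft_clip R (x $ i) else x $ i)))" for x
  have net: "is_gelu_network n r_u g"
    unfolding g_def[abs_def]
  proof (intro is_gelu_network_gelu_fun gelu_fun_compose[OF G_net])
    fix i assume "i < n"
    thus "gelu_fun n (\<lambda>x. if i < r then soft_clip R (x $ i) else x $ i)"
      by (cases "i < r") (simp_all add: gelu_fun_soft_clip gelu_fun.coord)
  qed
  define X where "X l y = G l (net_input \<psi> r b (?c (fst y), snd y))" for l and y :: "'m \<times> (real ^ 'd)"
  define X' where "X' l y = G' l (?c (fst y), snd y)" for l and y :: "'m \<times> (real ^ 'd)"
  have sur: "surrogate \<phi> r_u \<psi> r b_u b g (m, z) = (\<Sum>l<r_u. X l (m, z) *\<^sub>R \<phi> l) + b_u" for m z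
  proof -
    have "surrogate \<phi> r_u \<psi> r b_u b g (m, z) = decode \<phi> r_u (g (net_input \<psi> r b (m, z))) + b_u"
      by (simp add: surrogate_def net_input_def)
    thus ?thesis
      by (simp add: g_def decode_def n_def net_input_clip_point[OF orth] X_def)
  qed
  have D: "D_z (surrogate \<phi> r_u \<psi> r b_u b g) m z = (\<lambda>h. \<Sum>l<r_u. inner (X' l (m, z)) h *\<^sub>R \<phi> l)" if z: "z \<in> Z" for m z
  proof -
    have "((\<lambda>z. surrogate \<phi> r_u \<psi> r b_u b g (m, z)) has_derivative (\<lambda>h. (\<Sum>l<r_u. inner (X' l (m, z)) h *\<^sub>R \<phi> l) + 0)) (at z)"
      unfolding sur X_def X'_def fst_conv snd_conv
      by (intro has_derivative_add has_derivative_sum has_derivative_scaleR_left has_derivative_const G(1)[OF z])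
    hence "((\<lambda>z. surrogate \<phi> r_u \<psi> r b_u b g (m, z)) has_derivative (\<lambda>h. \<Sum>l<r_u. inner (X' l (m, z)) h *\<^sub>R \<phi> l)) (at z)"
      by simp
    thus ?thesis unfolding D_z_def by (rule frechet_derivative_at[symmetric])
  qed
  have "is_gelu_network (r + CARD('d)) r_u g \<and> (\<forall>m z. z \<in> Z \<longrightarrow>
      surrogate \<phi> r_u \<psi> r b_u b g (m, z) = (\<Sum>l<r_u. X l (m, z) *\<^sub>R \<phi> l) + b_u \<and>
      D_z (surrogate \<phi> r_u \<psi> r b_u b g) m z = (\<lambda>h. \<Sum>l<r_u. inner (X' l (m, z)) h *\<^sub>R \<phi> l) \<and>
      (\<forall>l<r_u. \<bar>X l (m, z) - f l (clip_point \<psi> r b R m, z)\<bar> \<le> \<delta> \<and>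
        norm (X' l (m, z) - f' l (clip_point \<psi> r b R m, z)) \<le> \<delta>))"
    using net sur D G(2,3) by (simp add: n_def X_def X'_def)
  thus ?thesis by (intro exI)
qed

text \<open>The coefficients belong to (m', z). With w = v (m', z) - v (m, \<zeta>), the projection
  tail of v (m', z) is that of w, bounded by the norm of w, plus the tail at the fixed \<zeta>. The
  factor 2 arises because m - m' enters through v (m, z) - v (m', z) and again through w.\<close>

lemma decoded_error_le:
  fixes v :: "'m::real_normed_vector \<times> 'z::real_normed_vector \<Rightarrow> 'u::real_inner"
  assumes orth: "\<And>i j. inner (\<phi> i) (\<phi> j) = (if i = j then 1 else 0)"
    and lip: "\<And>m1 m2 z1 z2. z1 \<in> B \<Longrightarrow> z2 \<in> B \<Longrightarrow>
        norm (v (m1, z1) - v (m2, z2)) \<le> L * (norm (m1 - m2) + norm (z1 - z2))"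
    and z: "z \<in> B" "\<zeta> \<in> B" "norm (z - \<zeta>) \<le> \<eta>" and L: "L \<ge> 0"
    and x: "\<And>l. l < r \<Longrightarrow> \<bar>x l - inner (v (m', z)) (\<phi> l)\<bar> \<le> \<delta>"
  shows "norm (v (m, z) - (\<Sum>l<r. x l *\<^sub>R \<phi> l))
    \<le> 2 * L * norm (m - m') + L * \<eta> + norm (v (m, \<zeta>) - proj \<phi> r (v (m, \<zeta>))) + real r * \<delta>"
proof -
  let ?w = "v (m', z) - v (m, \<zeta>)"
  have "v (m, z) - (\<Sum>l<r. x l *\<^sub>R \<phi> l) = (v (m, z) - v (m', z)) + (?w - proj \<phi> r ?w)
      + (v (m, \<zeta>) - proj \<phi> r (v (m, \<zeta>))) - (\<Sum>l<r. (x l - inner (v (m', z)) (\<phi> l)) *\<^sub>R \<phi> l)"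
    by (simp add: linear_diff[OF linear_proj] scaleR_diff_left sum_subtractf) (simp add: proj_def)
  also have "norm \<dots> \<le> norm (v (m, z) - v (m', z)) + norm (?w - proj \<phi> r ?w)
      + norm (v (m, \<zeta>) - proj \<phi> r (v (m, \<zeta>))) + norm (\<Sum>l<r. (x l - inner (v (m', z)) (\<phi> l)) *\<^sub>R \<phi> l)"
    by norm
  finally have "norm (v (m, z) - (\<Sum>l<r. x l *\<^sub>R \<phi> l)) \<le> \<dots>" .
  moreover have "norm (v (m, z) - v (m', z)) \<le> L * norm (m - m')" using lip[OF z(1) z(1), of m m'] by simp
  moreover have "norm (?w - proj \<phi> r ?w) \<le> L * norm (m - m') + L * \<eta>"
  proof -
    have "norm ?w \<le> L * (norm (m' - m) + norm (z - \<zeta>))" by (rule lip[OF z(1,2)])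
    also have "\<dots> \<le> L * (norm (m - m') + \<eta>)"
      using z L by (intro mult_left_mono add_mono) (auto simp: norm_minus_commute)
    finally show ?thesis using norm_diff_proj_le[OF orth, of ?w r] by (simp add: distrib_left)
  qed
  moreover have "norm (\<Sum>l\<in>{..<r}. (x l - inner (v (m', z)) (\<phi> l)) *\<^sub>R \<phi> l) \<le> real (card {..<r}) * \<delta>"
    using x by (intro norm_sum_scaleR_le) (auto simp: norm_eq_sqrt_inner orth)
  ultimately show ?thesis by simp
qed

section \<open>Choice of the parameters and the mean error\<close>

lemma continuous_on_norm_lipschitz:
  assumes "\<And>x y. norm (f x - f y) \<le> L * norm (x - y)" "L \<ge> 0"
  shows "continuous_on S f"
  by (rule lipschitz_on_continuous_on[of L]) (use assms in \<open>auto intro!: lipschitz_onI simp: dist_norm\<close>)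

lemma continuous_on_proj: "continuous_on S f \<Longrightarrow> continuous_on S (\<lambda>x. proj \<phi> r (f x))"
  unfolding proj_def by (intro continuous_intros)

lemma eventually_sequentially_ex_ge:
  "eventually P sequentially \<Longrightarrow> \<exists>n\<ge>k. P n"
  unfolding eventually_sequentially by (metis max.cobounded1 max.cobounded2)

theorem theorem3p1:
  fixes \<mu>\<^sub>m :: "'m::{real_inner, polish_space} measure"
    and Z_ad B :: "(real ^ 'd::finite) set"
    and u :: "'m \<times> (real ^ 'd) \<Rightarrow> 'u::{real_inner, polish_space}"
    and \<phi> :: "nat \<Rightarrow> 'u" and \<psi> :: "nat \<Rightarrow> 'm"
    and b_u :: 'u and b_m :: 'm
    and p \<epsilon> :: real
  assumes "p \<ge> 2"
    and "assumption_A \<mu>\<^sub>m Z_ad B p u"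
    and "orthonormal_basis \<phi>" and "orthonormal_basis \<psi>"
    and "\<epsilon> > 0"
  shows "\<exists>r_m r_u g. r_m \<ge> 1 \<and> r_u \<ge> 1 \<and> is_gelu_network (r_m + CARD('d)) r_u g \<and>
    (let u\<^sub>\<theta> = surrogate \<phi> r_u \<psi> r_m b_u b_m g in
      (SUP z\<in>Z_ad.
          (\<integral>\<^sup>+ m. ennreal (norm (u (m, z) - u\<^sub>\<theta> (m, z)) powr p) \<partial>\<mu>\<^sub>m)
        + (\<integral>\<^sup>+ m. ennreal (hs_norm (\<lambda>h. D_z u m z h - D_z u\<^sub>\<theta> m z h) powr p) \<partial>\<mu>\<^sub>m))
      \<le> ennreal (\<epsilon> powr p))"
proof -
  have p: "p > 0" using assms(1) by simp
  have orth\<phi>: "\<And>i j. inner (\<phi> i) (\<phi> j) = (if i = j then 1 else 0)"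
    and orth\<psi>: "\<And>i j. inner (\<psi> i) (\<psi> j) = (if i = j then 1 else 0)"
    using assms(3,4) by (auto simp: orthonormal_basis_def)
  have prob: "prob_space \<mu>\<^sub>m" and borel: "sets \<mu>\<^sub>m = sets borel"
    and moment: "(\<integral>\<^sup>+ m. ennreal (norm m powr p) \<partial>\<mu>\<^sub>m) < \<infinity>"
    and Z: "compact Z_ad" "open B" "Z_ad \<subseteq> B"
    and C1: "continuously_differentiable_on u (UNIV \<times> B)"
    using assms(2) by (auto simp: assumption_A_def)
  obtain \<kappa> \<kappa>' where \<kappa>: "\<kappa> > 0" "\<kappa>' > 0" "\<And>z1 z2 m1 m2. z1 \<in> B \<Longrightarrow> z2 \<in> B \<Longrightarrow>
        norm (u (m2, z2) - u (m1, z1)) \<le> \<kappa> * (norm (m2 - m1) + norm (z2 - z1)) \<and>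
        hs_norm (\<lambda>h. D_z u m2 z2 h - D_z u m1 z1 h) \<le> \<kappa>' * (norm (m2 - m1) + norm (z2 - z1))"
    using assms(2) unfolding assumption_A_def by blast
  define L where "L = \<kappa> + \<kappa>'"
  have L: "L > 0" "\<kappa> \<le> L" "\<kappa>' \<le> L" using \<kappa> by (auto simp: L_def)
  define J :: "(real ^ 'd) set" where "J = insert 0 Basis"
  have J: "finite J" "J \<noteq> {}" by (auto simp: J_def)
  define cJ where "cJ = real (card J)"
  have cJ: "cJ > 0" using J by (simp add: cJ_def card_gt_0_iff)
  \<comment> \<open>The index \<open>0 \<notin> Basis\<close> stands for \<open>u\<close> itself, so that values and partial derivatives are treated alike.\<close>
  define v where "v e y = (if e = 0 then u y - b_u else D_z u (fst y) (snd y) e)" for e y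
  have v0: "v 0 y = u y - b_u" for y by (simp add: v_def)
  have v_basis: "v e (m, z) = D_z u m z e" if "e \<in> Basis" for e m z
    using that nonzero_Basis by (auto simp: v_def)
  have lip: "norm (v e (m1, z1) - v e (m2, z2)) \<le> L * (norm (m1 - m2) + norm (z1 - z2))"
    if e: "e \<in> J" and z: "z1 \<in> B" "z2 \<in> B" for e m1 m2 z1 z2
  proof -
    have *: "k * (norm (m1 - m2) + norm (z1 - z2)) \<le> L * (norm (m1 - m2) + norm (z1 - z2))" if "k \<le> L" for k
      using that by (intro mult_right_mono) auto
    show ?thesis
    proof (cases "e = 0")
      case True
      thus ?thesis using \<kappa>(3)[OF z(2,1), of m1 m2] *[OF L(2)] by (simp add: v0)
    next
      case False
      hence e: "e \<in> Basis" using e by (simp add: J_def)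
      show ?thesis
        using \<kappa>(3)[OF z(2,1), of m1 m2] *[OF L(3)]
          norm_le_hs_norm[OF e, of "\<lambda>h. D_z u m1 z1 h - D_z u m2 z2 h"] by (simp add: v_basis[OF e])
    qed
  qed
  define f where "f l y = inner (v 0 y) (\<phi> l)" for l y
  \<comment> \<open>The gradient of \<open>f l\<close>: the vector representing the functional h
    \<mapsto> \<open>inner (D_z u m z h) (\<phi> l)\<close>.\<close>
  define f' where "f' l y = (\<Sum>e\<in>Basis. inner (v e y) (\<phi> l) *\<^sub>R e)" for l y
  have norm_\<phi>: "norm (\<phi> l) = 1" for l by (simp add: norm_eq_sqrt_inner orth\<phi>)
  have inner_\<phi>: "\<bar>inner x (\<phi> l)\<bar> \<le> norm x" for x l
    using Cauchy_Schwarz_ineq2[of x "\<phi> l"] by (simp add: norm_\<phi>)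
  have f_deriv: "((\<lambda>z. f l (m, z)) has_derivative (\<lambda>h. inner (f' l (m, z)) h)) (at z)" if z: "z \<in> B" for l m z
  proof -
    have D: "((\<lambda>z. u (m, z)) has_derivative D_z u m z) (at z)" by (rule D_z_has_derivative[OF C1 z])
    have "inner (D_z u m z h) (\<phi> l) = inner (f' l (m, z)) h" for h
    proof -
      have "D_z u m z h = D_z u m z (\<Sum>e\<in>Basis. inner h e *\<^sub>R e)" by (simp add: euclidean_representation)
      also have "\<dots> = (\<Sum>e\<in>Basis. inner h e *\<^sub>R D_z u m z e)"
        by (simp add: linear_sum[OF has_derivative_linear[OF D]] linear_cmul[OF has_derivative_linear[OF D]])
      finally show ?thesis
        by (simp add: f'_def inner_sum_left inner_sum_right v_basis inner_commute mult.commute)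
    qed
    moreover have "((\<lambda>z. f l (m, z)) has_derivative (\<lambda>h. inner (D_z u m z h - 0) (\<phi> l))) (at z)"
      unfolding f_def v0 by (intro has_derivative_inner_left has_derivative_diff D has_derivative_const)
    ultimately show ?thesis by simp
  qed
  have f_lip: "\<bar>f l (m1, z) - f l (m2, z)\<bar> \<le> L * norm (m1 - m2)" if z: "z \<in> B" for l m1 m2 z
    using inner_\<phi>[of "v 0 (m1, z) - v 0 (m2, z)" l] lip[of 0 z z m1 m2] z
    by (simp add: f_def inner_diff_left J_def)
  have f'_lip: "norm (f' l (m1, z1) - f' l (m2, z2)) \<le> real DIM(real ^ 'd) * L * (norm (m1 - m2) + norm (z1 - z2))"
    if z: "z1 \<in> B" "z2 \<in> B" for l m1 m2 z1 z2
  proof -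
    have "norm (\<Sum>e\<in>Basis. inner (v e (m1, z1) - v e (m2, z2)) (\<phi> l) *\<^sub>R (e :: real ^ 'd))
        \<le> real (card (Basis :: (real ^ 'd) set)) * (L * (norm (m1 - m2) + norm (z1 - z2)))"
    proof (rule norm_sum_scaleR_le)
      fix e :: "real ^ 'd" assume e: "e \<in> Basis"
      show "\<bar>inner (v e (m1, z1) - v e (m2, z2)) (\<phi> l)\<bar> \<le> L * (norm (m1 - m2) + norm (z1 - z2))"
        using e by (intro order.trans[OF inner_\<phi> lip] z) (simp add: J_def)
    qed simp
    thus ?thesis by (simp add: f'_def inner_diff_left scaleR_diff_left sum_subtractf mult.assoc)
  qed
  \<comment> \<open>Four error terms of size \<omega> bound an expectation by 4^p times 4 \<omega>,
    which is half of \<epsilon>^p: one half for the values, one for the derivatives.\<close>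
  define \<omega> where "\<omega> = \<epsilon> powr p / (8 * 4 powr p)"
  have \<omega>: "\<omega> > 0" using assms(5) by (simp add: \<omega>_def)
  \<comment> \<open>The admissible size of the constant error \<open>a4\<close>; \<eta> and \<delta>
    use at most half of it each, after summation over \<open>J\<close>.\<close>
  define \<tau> where "\<tau> = \<omega> powr (1 / p)"
  have \<tau>: "\<tau> > 0" "\<tau> powr p = \<omega>" using \<omega> p by (auto simp: \<tau>_def powr_powr)
  define \<eta> where "\<eta> = \<tau> / (2 * cJ * (L + 1))"
  have \<eta>: "\<eta> > 0" using \<tau> cJ L by (simp add: \<eta>_def)
  obtain S where S: "finite S" "S \<subseteq> Z_ad" "Z_ad \<subseteq> (\<Union>\<zeta>\<in>S. ball \<zeta> \<eta>)"
    using seq_compact_imp_totally_bounded[OF compact_imp_seq_compact[OF Z(1)], rule_format, OF \<eta>]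
    by (elim exE conjE) (rule that)
  have SB: "\<zeta> \<in> B" if "\<zeta> \<in> S" for \<zeta> using that S Z by blast
  have v_cont: "continuous_on UNIV (\<lambda>m. v e (m, \<zeta>))" if "e \<in> J" "\<zeta> \<in> S" for e \<zeta>
    by (rule continuous_on_norm_lipschitz[of _ L]) (use lip[OF that(1) SB[OF that(2)] SB[OF that(2)]] L in auto)
  \<comment> \<open>The terms of \<open>decoded_error_le\<close> summed over \<open>J\<close>,
    whence the factor \<open>cJ\<close>: \<open>a1\<close> is the projection tail of the parameter,
    \<open>a2\<close> its clipping error, \<open>a3\<close> the output tail. Summing
    \<open>a3\<close> over the whole net \<open>S\<close> makes it independent of
    \<open>z\<close>.\<close>
  define a1 where "a1 r m = 2 * L * cJ * norm ((m - b_m) - proj \<psi> r (m - b_m))" for r m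
  define a2 where "a2 r R m = 2 * L * cJ * (\<Sum>i<r. \<bar>inner (m - b_m) (\<psi> i) - soft_clip R (inner (m - b_m) (\<psi> i))\<bar>)" for r R m
  define a3 where "a3 r m = (\<Sum>e\<in>J. \<Sum>\<zeta>\<in>S. norm (v e (m, \<zeta>) - proj \<phi> r (v e (m, \<zeta>))))" for r m
  have a1_cont: "continuous_on UNIV (a1 r)" for r
    unfolding a1_def[abs_def] by (intro continuous_intros continuous_on_proj)
  have a2_cont: "continuous_on UNIV (a2 r R)" for r R
    unfolding a2_def[abs_def] by (intro continuous_intros continuous_soft_clip)
  have a3_cont: "continuous_on UNIV (a3 r)" for r
    unfolding a3_def[abs_def] by (intro continuous_intros continuous_on_proj v_cont)
  have nonneg: "a1 r m \<ge> 0" "a2 r R m \<ge> 0" "a3 r m \<ge> 0" for r R m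
    using L cJ by (auto simp: a1_def a2_def a3_def intro!: mult_nonneg_nonneg sum_nonneg)
  have m_b: "norm (m - b_m) \<le> (1 + norm b_m) * (1 + norm m)" for m
  proof -
    have "norm (m - b_m) \<le> norm m + norm b_m" by (rule norm_triangle_ineq4)
    also have "\<dots> \<le> (1 + norm b_m) * (1 + norm m)" by (simp add: algebra_simps)
    finally show ?thesis .
  qed
  \<comment> \<open>\<open>a3\<close> involves neither the input rank nor the clipping radius, so
    \<open>r_u\<close> can be fixed before both.\<close>
  have "eventually (\<lambda>r. (\<integral>\<^sup>+m. ennreal (a3 r m powr p) \<partial>\<mu>\<^sub>m) \<le> ennreal \<omega>) sequentially"
  proof (rule eventually_nn_integral_powr_le[OF prob borel p moment a3_cont nonneg(3) _ _ \<omega>])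
    define C where "C = (\<Sum>e\<in>J. \<Sum>\<zeta>\<in>S. norm (v e (0, \<zeta>)) + L)"
    fix r m
    have "a3 r m \<le> (\<Sum>e\<in>J. \<Sum>\<zeta>\<in>S. (norm (v e (0, \<zeta>)) + L) * (1 + norm m))"
      unfolding a3_def
    proof (intro sum_mono)
      fix e \<zeta> assume e: "e \<in> J" and \<zeta>: "\<zeta> \<in> S"
      have "norm (v e (m, \<zeta>) - proj \<phi> r (v e (m, \<zeta>))) \<le> norm (v e (m, \<zeta>))"
        by (rule norm_diff_proj_le[OF orth\<phi>])
      also have "\<dots> \<le> norm (v e (0, \<zeta>)) + L * norm m"
        using lip[OF e SB[OF \<zeta>] SB[OF \<zeta>], of m 0] norm_triangle_sub[of "v e (m, \<zeta>)" "v e (0, \<zeta>)"] by simp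
      also have "\<dots> \<le> (norm (v e (0, \<zeta>)) + L) * (1 + norm m)" using L by (simp add: algebra_simps)
      finally show "norm (v e (m, \<zeta>) - proj \<phi> r (v e (m, \<zeta>))) \<le> (norm (v e (0, \<zeta>)) + L) * (1 + norm m)" .
    qed
    thus "a3 r m \<le> C * (1 + norm m)" by (simp add: C_def sum_distrib_right)
  next
    fix m
    show "(\<lambda>r. a3 r m) \<longlonglongrightarrow> 0"
      unfolding a3_def by (intro tendsto_null_sum proj_tendsto assms(3))
  qed
  from eventually_sequentially_ex_ge[OF this, of 1]
  obtain r_u where r_u: "r_u \<ge> 1" "(\<integral>\<^sup>+m. ennreal (a3 r_u m powr p) \<partial>\<mu>\<^sub>m) \<le> ennreal \<omega>"
    by (elim exE conjE) (rule that)
  have "eventually (\<lambda>r. (\<integral>\<^sup>+m. ennreal (a1 r m powr p) \<partial>\<mu>\<^sub>m) \<le> ennreal \<omega>) sequentially"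
  proof (rule eventually_nn_integral_powr_le[OF prob borel p moment a1_cont nonneg(1) _ _ \<omega>])
    fix r m
    have "norm ((m - b_m) - proj \<psi> r (m - b_m)) \<le> (1 + norm b_m) * (1 + norm m)"
      using norm_diff_proj_le[OF orth\<psi>, of "m - b_m" r] m_b[of m] by linarith
    hence "a1 r m \<le> 2 * L * cJ * ((1 + norm b_m) * (1 + norm m))"
      unfolding a1_def using L cJ by (intro mult_left_mono) auto
    thus "a1 r m \<le> (2 * L * cJ * (1 + norm b_m)) * (1 + norm m)" by (simp only: mult.assoc)
  next
    fix m
    show "(\<lambda>r. a1 r m) \<longlonglongrightarrow> 0"
      unfolding a1_def by (intro tendsto_mult_right_zero proj_tendsto assms(4))
  qed
  from eventually_sequentially_ex_ge[OF this, of 1]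
  obtain r where r: "r \<ge> 1" "(\<integral>\<^sup>+m. ennreal (a1 r m powr p) \<partial>\<mu>\<^sub>m) \<le> ennreal \<omega>"
    by (elim exE conjE) (rule that)
  have "eventually (\<lambda>n. (\<integral>\<^sup>+m. ennreal (a2 r (real n) m powr p) \<partial>\<mu>\<^sub>m) \<le> ennreal \<omega>) sequentially"
  proof (rule eventually_nn_integral_powr_le[OF prob borel p moment a2_cont nonneg(2) _ _ \<omega>])
    fix n m
    have "(\<Sum>i<r. \<bar>inner (m - b_m) (\<psi> i) - soft_clip (real n) (inner (m - b_m) (\<psi> i))\<bar>)
        \<le> (\<Sum>i<r. (3 + norm b_m) * (1 + norm m))"
    proof (rule sum_mono)
      fix i
      have "\<bar>inner (m - b_m) (\<psi> i)\<bar> \<le> norm (m - b_m)"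
        using Cauchy_Schwarz_ineq2[of "m - b_m" "\<psi> i"] by (simp add: norm_eq_sqrt_inner[of "\<psi> i"] orth\<psi>)
      hence "\<bar>inner (m - b_m) (\<psi> i) - soft_clip (real n) (inner (m - b_m) (\<psi> i))\<bar> \<le> (1 + norm b_m) * (1 + norm m) + 2"
        using soft_clip_diff_le[of "real n" "inner (m - b_m) (\<psi> i)"] m_b[of m] by simp
      also have "\<dots> \<le> (3 + norm b_m) * (1 + norm m)" by (simp add: algebra_simps)
      finally show "\<bar>inner (m - b_m) (\<psi> i) - soft_clip (real n) (inner (m - b_m) (\<psi> i))\<bar> \<le> (3 + norm b_m) * (1 + norm m)" .
    qed
    hence "a2 r (real n) m \<le> 2 * L * cJ * (\<Sum>i<r. (3 + norm b_m) * (1 + norm m))"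
      unfolding a2_def using L cJ by (intro mult_left_mono) auto
    thus "a2 r (real n) m \<le> (2 * L * cJ * (real r * (3 + norm b_m))) * (1 + norm m)" by (simp add: mult.assoc)
  next
    fix m
    show "(\<lambda>n. a2 r (real n) m) \<longlonglongrightarrow> 0"
      unfolding a2_def by (intro tendsto_mult_right_zero tendsto_null_sum soft_clip_tendsto)
  qed
  from eventually_sequentially_ex_ge[OF this, of 1]
  obtain n where n: "(\<integral>\<^sup>+m. ennreal (a2 r (real n) m powr p) \<partial>\<mu>\<^sub>m) \<le> ennreal \<omega>"
    by (elim exE conjE) (rule that)
  define R where "R = real n"
  \<comment> \<open>The network accuracy is chosen last, so it can absorb the factor
    \<open>r_u\<close> from adding up the coefficient errors.\<close>
  define \<delta> where "\<delta> = \<tau> / (2 * cJ * (real r_u + 1))"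
  have \<delta>: "\<delta> > 0" using \<tau> cJ by (simp add: \<delta>_def)
  define a4 where "a4 = cJ * (L * \<eta> + real r_u * \<delta>)"
  have a4: "a4 \<ge> 0" "a4 powr p \<le> \<omega>"
  proof -
    show "a4 \<ge> 0" using cJ L \<eta> \<delta> by (simp add: a4_def)
    have "cJ * (L * \<eta>) = \<tau> / 2 * (L / (L + 1))" using cJ L by (simp add: \<eta>_def divide_simps)
    also have "\<dots> \<le> \<tau> / 2 * 1" using L \<tau> by (intro mult_left_mono) auto
    finally have 1: "cJ * (L * \<eta>) \<le> \<tau> / 2" by simp
    have "cJ * (real r_u * \<delta>) = \<tau> / 2 * (real r_u / (real r_u + 1))" using cJ by (simp add: \<delta>_def divide_simps)
    also have "\<dots> \<le> \<tau> / 2 * 1" using \<tau> by (intro mult_left_mono) auto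
    finally have "a4 \<le> \<tau>" using 1 by (simp add: a4_def distrib_left)
    hence "a4 powr p \<le> \<tau> powr p" using \<open>a4 \<ge> 0\<close> p by (intro powr_mono2) auto
    thus "a4 powr p \<le> \<omega>" using \<tau> by simp
  qed
  let ?c = "clip_point \<psi> r b_m R"
  have "\<exists>g X X'. is_gelu_network (r + CARD('d)) r_u g \<and> (\<forall>m z. z \<in> Z_ad \<longrightarrow>
      surrogate \<phi> r_u \<psi> r b_u b_m g (m, z) = (\<Sum>l<r_u. X l (m, z) *\<^sub>R \<phi> l) + b_u \<and>
      D_z (surrogate \<phi> r_u \<psi> r b_u b_m g) m z = (\<lambda>h. \<Sum>l<r_u. inner (X' l (m, z)) h *\<^sub>R \<phi> l) \<and>
      (\<forall>l<r_u. \<bar>X l (m, z) - f l (?c m, z)\<bar> \<le> \<delta> \<and> norm (X' l (m, z) - f' l (?c m, z)) \<le> \<delta>))"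
    by (rule surrogate_exists[OF orth\<psi> Z f_deriv f_lip f'_lip]) (use L \<delta> in \<open>auto simp: R_def\<close>)
  then obtain g X X' where net: "is_gelu_network (r + CARD('d)) r_u g" and g: "\<forall>m z. z \<in> Z_ad \<longrightarrow>
      surrogate \<phi> r_u \<psi> r b_u b_m g (m, z) = (\<Sum>l<r_u. X l (m, z) *\<^sub>R \<phi> l) + b_u \<and>
      D_z (surrogate \<phi> r_u \<psi> r b_u b_m g) m z = (\<lambda>h. \<Sum>l<r_u. inner (X' l (m, z)) h *\<^sub>R \<phi> l) \<and>
      (\<forall>l<r_u. \<bar>X l (m, z) - f l (?c m, z)\<bar> \<le> \<delta> \<and> norm (X' l (m, z) - f' l (?c m, z)) \<le> \<delta>)"
    by (elim exE conjE) (rule that)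
  define u\<^sub>\<theta> :: "'m \<times> (real ^ 'd) \<Rightarrow> 'u" where "u\<^sub>\<theta> = surrogate \<phi> r_u \<psi> r b_u b_m g"
  define x where "x e l y = (if e = 0 then X l y else inner (X' l y) e)" for e :: "real ^ 'd" and l y
  have x_basis: "x e l y = inner (X' l y) e" if "e \<in> Basis" for e l y
    using that nonzero_Basis by (auto simp: x_def)
  have x: "\<bar>x e l (m, z) - inner (v e (?c m, z)) (\<phi> l)\<bar> \<le> \<delta>" if "e \<in> J" "z \<in> Z_ad" "l < r_u" for e l m z
  proof (cases "e = 0")
    case True
    thus ?thesis using g that by (simp add: x_def f_def)
  next
    case False
    hence e: "e \<in> Basis" using that by (simp add: J_def)
    have "inner (f' l (?c m, z)) e = inner (v e (?c m, z)) (\<phi> l)"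
      using e by (simp add: f'_def)
    hence "\<bar>x e l (m, z) - inner (v e (?c m, z)) (\<phi> l)\<bar> = \<bar>inner (X' l (m, z) - f' l (?c m, z)) e\<bar>"
      using False by (simp add: x_def inner_diff_left)
    also have "\<dots> \<le> norm (X' l (m, z) - f' l (?c m, z))" using Basis_le_norm[OF e] by simp
    also have "\<dots> \<le> \<delta>" using g that by simp
    finally show ?thesis .
  qed
  \<comment> \<open>One majorant for both errors: the summand at 0 is the error of \<open>u\<close>,
    and the summands over \<open>Basis\<close> bound the Hilbert-Schmidt norm of the derivative
    error.\<close>
  define E where "E m z = (\<Sum>e\<in>J. norm (v e (m, z) - (\<Sum>l<r_u. x e l (m, z) *\<^sub>R \<phi> l)))" for m z
  have E_nonneg: "E m z \<ge> 0" for m z by (simp add: E_def sum_nonneg)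
  have E_bound: "E m z \<le> a1 r m + a2 r R m + a3 r_u m + a4" if z: "z \<in> Z_ad" for m z
  proof -
    obtain \<zeta> where \<zeta>: "\<zeta> \<in> S" "norm (z - \<zeta>) \<le> \<eta>"
      using S(3) z by (force simp: dist_norm norm_minus_commute)
    have zB: "z \<in> B" using z Z by blast
    have "E m z \<le> (\<Sum>e\<in>J. 2 * L * norm (m - ?c m) + L * \<eta> + (\<Sum>\<zeta>\<in>S. norm (v e (m, \<zeta>) - proj \<phi> r_u (v e (m, \<zeta>)))) + real r_u * \<delta>)"
      unfolding E_def
    proof (rule sum_mono)
      fix e assume e: "e \<in> J"
      have "norm (v e (m, z) - (\<Sum>l<r_u. x e l (m, z) *\<^sub>R \<phi> l))
          \<le> 2 * L * norm (m - ?c m) + L * \<eta> + norm (v e (m, \<zeta>) - proj \<phi> r_u (v e (m, \<zeta>))) + real r_u * \<delta>"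
        by (rule decoded_error_le[OF orth\<phi> lip[OF e] zB SB[OF \<zeta>(1)] \<zeta>(2) _ x[OF e z]]) (use L in auto)
      moreover have "norm (v e (m, \<zeta>) - proj \<phi> r_u (v e (m, \<zeta>))) \<le> (\<Sum>\<zeta>\<in>S. norm (v e (m, \<zeta>) - proj \<phi> r_u (v e (m, \<zeta>))))"
        using member_le_sum[OF \<zeta>(1), of "\<lambda>\<zeta>. norm (v e (m, \<zeta>) - proj \<phi> r_u (v e (m, \<zeta>)))"] S(1) by simp
      ultimately show "norm (v e (m, z) - (\<Sum>l<r_u. x e l (m, z) *\<^sub>R \<phi> l))
          \<le> 2 * L * norm (m - ?c m) + L * \<eta> + (\<Sum>\<zeta>\<in>S. norm (v e (m, \<zeta>) - proj \<phi> r_u (v e (m, \<zeta>)))) + real r_u * \<delta>"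
        by linarith
    qed
    also have "\<dots> = 2 * L * cJ * norm (m - ?c m) + a3 r_u m + a4"
      by (simp add: sum.distrib a3_def a4_def cJ_def algebra_simps)
    also have "2 * L * cJ * norm (m - ?c m) \<le> a1 r m + a2 r R m"
      unfolding a1_def a2_def distrib_left[symmetric] using L cJ
      by (intro mult_left_mono norm_diff_clip_point_le orth\<psi>) auto
    finally show ?thesis by simp
  qed
  have meas: "h \<in> borel_measurable \<mu>\<^sub>m" if "continuous_on UNIV h" for h :: "'m \<Rightarrow> real"
    using borel_measurable_continuous_onI[OF that] measurable_cong_sets[OF borel refl] by blast
  have half: "(\<integral>\<^sup>+ m. ennreal (k m powr p) \<partial>\<mu>\<^sub>m) \<le> ennreal (\<epsilon> powr p / 2)"
    if z: "z \<in> Z_ad" and k: "\<And>m. 0 \<le> k m" "\<And>m. k m \<le> E m z" for k z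
  proof -
    have "(\<integral>\<^sup>+ m. ennreal (k m powr p) \<partial>\<mu>\<^sub>m) \<le> ennreal (4 powr p * (4 * \<omega>))"
    proof (rule nn_integral_powr_le_of_terms[OF prob _ _ meas[OF a1_cont] meas[OF a2_cont] meas[OF a3_cont] nonneg a4(1) r(2) n[folded R_def] r_u(2) a4(2)])
      fix m show "k m \<le> a1 r m + a2 r R m + a3 r_u m + a4" using k(2)[of m] E_bound[OF z, of m] by linarith
    qed (use p \<omega> k in auto)
    also have "4 powr p * (4 * \<omega>) = \<epsilon> powr p / 2" by (simp add: \<omega>_def)
    finally show ?thesis .
  qed
  have "(SUP z\<in>Z_ad. (\<integral>\<^sup>+ m. ennreal (norm (u (m, z) - u\<^sub>\<theta> (m, z)) powr p) \<partial>\<mu>\<^sub>m)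
        + (\<integral>\<^sup>+ m. ennreal (hs_norm (\<lambda>h. D_z u m z h - D_z u\<^sub>\<theta> m z h) powr p) \<partial>\<mu>\<^sub>m)) \<le> ennreal (\<epsilon> powr p)"
  proof (rule SUP_least)
    fix z assume z: "z \<in> Z_ad"
    have "norm (u (m, z) - u\<^sub>\<theta> (m, z)) \<le> E m z" for m
    proof -
      have "u (m, z) - u\<^sub>\<theta> (m, z) = v 0 (m, z) - (\<Sum>l<r_u. x 0 l (m, z) *\<^sub>R \<phi> l)"
        using g z by (simp add: u\<^sub>\<theta>_def v0 x_def)
      thus ?thesis unfolding E_def
        using member_le_sum[of 0 J "\<lambda>e. norm (v e (m, z) - (\<Sum>l<r_u. x e l (m, z) *\<^sub>R \<phi> l))"] J by (simp add: J_def)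
    qed
    moreover have "hs_norm (\<lambda>h. D_z u m z h - D_z u\<^sub>\<theta> m z h) \<le> E m z" for m
    proof -
      have "hs_norm (\<lambda>h. D_z u m z h - D_z u\<^sub>\<theta> m z h) \<le> (\<Sum>e\<in>Basis. norm (D_z u m z e - D_z u\<^sub>\<theta> m z e))"
        by (rule hs_norm_le_sum)
      also have "\<dots> = (\<Sum>e\<in>Basis. norm (v e (m, z) - (\<Sum>l<r_u. x e l (m, z) *\<^sub>R \<phi> l)))"
        using g z by (intro sum.cong refl) (simp add: u\<^sub>\<theta>_def v_basis x_basis)
      also have "\<dots> \<le> E m z" unfolding E_def by (rule sum_mono2) (auto simp: J_def)
      finally show ?thesis .
    qed
    ultimately have "(\<integral>\<^sup>+ m. ennreal (norm (u (m, z) - u\<^sub>\<theta> (m, z)) powr p) \<partial>\<mu>\<^sub>m)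
        + (\<integral>\<^sup>+ m. ennreal (hs_norm (\<lambda>h. D_z u m z h - D_z u\<^sub>\<theta> m z h) powr p) \<partial>\<mu>\<^sub>m)
        \<le> ennreal (\<epsilon> powr p / 2) + ennreal (\<epsilon> powr p / 2)"
      by (intro add_mono half[OF z] hs_norm_nonneg norm_ge_zero)
    also have "\<dots> = ennreal (\<epsilon> powr p)" by (subst ennreal_plus[symmetric]) auto
    finally show "(\<integral>\<^sup>+ m. ennreal (norm (u (m, z) - u\<^sub>\<theta> (m, z)) powr p) \<partial>\<mu>\<^sub>m)
        + (\<integral>\<^sup>+ m. ennreal (hs_norm (\<lambda>h. D_z u m z h - D_z u\<^sub>\<theta> m z h) powr p) \<partial>\<mu>\<^sub>m) \<le> ennreal (\<epsilon> powr p)" .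
  qed
  thus ?thesis using r(1) r_u(1) net unfolding Let_def u\<^sub>\<theta>_def by blast
qed

end
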